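(* Let $p$ be a prime with $p\equiv -3\pmod 8$, let $s\ge 1$, $q=p^s$, and let $m\ge 2$ be an integer with $2^{m}\mid(q-1)$ but $2^{m+1}\nmid(q-1)$. Let $n\ge 1$ and let $N$ be the number of $(x_1,\dots,x_n)\in\mathbb F_q^n$ with $x_1^{2^m}+\dots+x_n^{2^m}=0$. For $r=1,2,\dots,m-1$ let $C_r,D_r$ be integers with $$p^{s/2^{r-1}}=C_r^2+D_r^2,\qquad C_r\equiv -1\pmod 4,\qquad p\nmid C_r.$$ If $m=2$ then \begin{align*} N=\,&q^{n-1}+\frac{q-1}{4q}\Bigl[\Bigl(-q^{\frac12}+q^{\frac14}i\sqrt{2(q^{\frac12}+C_1)}\,\Bigr)^n+\Bigl(-q^{\frac12}-q^{\frac14}i\sqrt{2(q^{\frac12}+C_1)}\,\Bigr)^n\\ &+\Bigl(q^{\frac12}+q^{\frac14}i\sqrt{2(q^{\frac12}-C_1)}\,\Bigr)^n+\Bigl(q^{\frac12}-q^{\frac14}i\sqrt{2(q^{\frac12}-C_1)}\,\Bigr)^n\Bigr]. \end{align*} If $m\ge 3$ then, writing $P=-q^{\frac 12}+\sum_{r=2}^{m-2}2^{r-1}C_r q^{\frac{2^{r-1}-1}{2^{r}}}$, \begin{align*} N=\,&q^{n-1}+\frac{q-1}{2^mq}\cdot\Bigl[2^{m-2}\cdot\Bigl((q^{\frac12}+2D_2q^{\frac14})^n+(q^{\frac12}-2D_2q^{\frac14})^n\Bigr)\\ &+\sum_{t=1}^{m-3}2^{m-t-2}\Bigl((-q^{\frac12}+\sum_{r=2}^t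 2^{r-1}C_rq^{\frac{2^{r-1}-1}{2^{r}}}-2^t C_{t+1}q^{\frac{2^{t}-1}{2^{t+1}}}+2^{t+1} D_{t+2}q^{\frac{2^{t+1}-1}{2^{t+2}}})^n\\ &\qquad+(-q^{\frac12}+\sum_{r=2}^t 2^{r-1}C_rq^{\frac{2^{r-1}-1}{2^{r}}}-2^t C_{t+1}q^{\frac{2^{t}-1}{2^{t+1}}}-2^{t+1} D_{t+2}q^{\frac{2^{t+1}-1}{2^{t+2}}})^n\Bigr)\\ &+\Bigl(P+2^{m-2}C_{m-1} q^{\frac{2^{m-2}-1}{2^{m-1}}}+2^{m-2}q^{\frac{2^{m-1}-1}{2^{m}}}i\sqrt{2(q^{\frac1{2^{m-1}}}-C_{m-1})}\,\Bigr)^n\\ &+\Bigl(P+2^{m-2}C_{m-1} q^{\frac{2^{m-2}-1}{2^{m-1}}}-2^{m-2}q^{\frac{2^{m-1}-1}{2^{m}}}i\sqrt{2(q^{\frac1{2^{m-1}}}-C_{m-1})}\,\Bigr)^n\\ &+\Bigl(P-2^{m-2}C_{m-1} q^{\frac{2^{m-2}-1}{2^{m-1}}}+2^{m-2}q^{\frac{2^{m-1}-1}{2^{m}}}i\sqrt{2(q^{\frac1{2^{m-1}}}+C_{m-1})}\,\Bigr)^n\\ &+\Bigl(P-2^{m-2}C_{m-1} q^{\frac{2^{m-2}-1}{2^{m-1}}}-2^{m-2}q^{\frac{2^{m-1}-1}{2^{m}}}i\sqrt{2(q^{\frac1{2^{m-1}}}+C_{m-1})}\,\Bigr)^n\Bigr].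 \end{align*}
   Context: Here $i=\sqrt{-1}$. Powers $q^{a}$ with rational $a$ denote positive real powers, and $\sqrt{\cdot}$ is the nonnegative real square root (the radicands are positive). Empty sums are zero. Under the hypotheses, $2^{m-2}\mid s$, so $p^{s/2^{r-1}}$ is an integer for $r\le m-1$; the conditions determine $C_r$ uniquely and $D_r$ up to sign, and the formula holds for either choice of signs. *)

theory Defs
  imports Complex_Main "HOL-Number_Theory.Cong" "HOL-Computational_Algebra.Primes"
begin

definition qp :: "nat \<Rightarrow> real \<Rightarrow> complex" where
  "qp q a = complex_of_real (real q powr a)"

definition num_sols :: "'a::{finite,field} itself \<Rightarrow> nat \<Rightarrow> nat \<Rightarrow> nat" where
  "num_sols _ k n = card {xs :: 'a list. length xs = n \<and> (\<Sum>x\<leftarrow>xs. x ^ k) = 0}"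

end

theory Submission
  imports Defs "HOL-Library.Cardinality" "HOL-Number_Theory.Residues" "Jordan_Normal_Form.Char_Poly"
begin

text \<open>
  Counting with additive characters reduces the theorem to the Gaussian periods of order \<open>2 ^ m\<close>,
  which are combinations of Gauss sums \<open>G\<^sub>k\<close> of characters of order \<open>2 ^ k\<close>, \<open>k \<le> m\<close>. Since \<open>p\<close>
  generates the residues congruent to 1 modulo 4 in \<open>(\<int>/2\<^sup>k)\<^sup>*\<close>, invariance under Frobenius leaves
  one Gauss sum per order up to conjugation, and with the duplication formula it gives the
  recursion \<open>G\<^sub>k\<^sup>2 = \<plusminus> G\<^sub>1 G\<^sub>k\<^sub>-\<^sub>1\<close> for \<open>k \<ge> 3\<close>. It starts from a quartic Jacobi sum, a Gaussian
  integer of norm \<open>q\<close> that is prime to \<open>p\<close> (a central binomial coefficient modulo \<open>p\<close>) and is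
  known modulo \<open>2 + 2\<i>\<close>, hence is \<open>\<plusminus> C\<^sub>1 \<plusminus> \<i> D\<^sub>1\<close>. Primitive representations of a power of \<open>p\<close> as a sum of two
  squares are unique, so every \<open>G\<^sub>k\<close> with \<open>2 \<le> k < m\<close> is a root of unity times a positive multiple of
  \<open>C\<^sub>k \<plusminus> \<i> D\<^sub>k\<close>. That root of unity is \<open>\<plusminus> 1\<close>, since \<open>(q - \<surd>q Re G\<^sub>k) / 2\<close> is, up to sign, the
  square of a difference of periods, hence an algebraic integer; its sign is then forced to be
  \<open>1\<close> for \<open>k \<le> m - 2\<close> by the recursion, and is immaterial for \<open>k = m - 1\<close>.
\<close>

section \<open>Number-theoretic and field-theoretic preliminaries\<close>

text \<open>The obstacle is that relations between Gauss sums of different orders give only their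
  squares. Each new order costs an unknown sign, and an unknown sign under the next square root
  becomes an unknown fourth root of unity. The ambiguity is resolved at the prime 2, because q is
  odd and \<open>D k\<close> is even. If the real part of the Gauss sum at order 2^k came from
  \<open>D k\<close> instead of \<open>C k\<close>, then z = (q - sqrt q Re G_k) / 2 would satisfy
  (2z - q)^2 = 4N with an integer N, and q^2 / 4 would be an algebraic integer. The signs that
  survive only permute the periods. The sign of \<open>D k\<close> exchanges indices whose odd parts
  are 1 and 3 modulo 4. The sign at order 2^(m-1) exchanges even and odd indices among the last four
  periods. For m = 2, where s is odd, the same exchange absorbs the sign of the quadratic Gauss
  sum.\<close>

lemma finite_field_power_card_minus_one:
  fixes x :: "'a::{finite,field}"
  assumes "x \<noteq> 0"
  shows "x ^ (CARD('a) - 1) = 1"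
proof -
  have bij: "bij_betw ((*) x) (-{0}) (-{0})"
    using assms by (intro bij_betwI[where g = "\<lambda>y. y / x"]) auto
  have "(\<Prod>y\<in>-{0}. y) = (\<Prod>y\<in>-{0}. x * y)"
    using prod.reindex_bij_betw[OF bij, of "\<lambda>y. y"] by simp
  also have "\<dots> = x ^ card (-{0::'a}) * (\<Prod>y\<in>-{0}. y)"
    by (simp add: prod.distrib)
  finally have "x ^ card (-{0::'a}) = 1"
    by auto
  thus ?thesis
    by (simp add: Compl_eq_Diff_UNIV card_Diff_subset)
qed

lemma finite_field_generator:
  "\<exists>g::'a::{finite,field}. g \<noteq> 0 \<and> (\<forall>x. x \<noteq> 0 \<longrightarrow> (\<exists>i < CARD('a) - 1. x = g ^ i))"
proof -
  \<comment> \<open>The type is repackaged as a record so that cyclicity of the multiplicative group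
    can be taken from the algebra of explicit carriers.\<close>
  define R :: "'a ring" where
    "R = \<lparr>carrier = UNIV, monoid.mult = (*), one = 1, ring.zero = 0, add = (+)\<rparr>"
  have "field R"
  proof -
    have "\<exists>y. x + y = 0" for x :: 'a
      using add.right_inverse by blast
    moreover have "x \<noteq> 0 \<Longrightarrow> \<exists>y. x * y = 1" for x :: 'a
      by (rule exI[of _ "inverse x"]) auto
    ultimately show ?thesis
      unfolding R_def using add.right_inverse
      by unfold_locales (auto simp: algebra_simps Units_def)
  qed
  then interpret R: field R .
  have pow: "a [^]\<^bsub>R\<^esub> (i::nat) = a ^ i" for a i
    by (induction i) (auto simp: R_def)
  have "finite (carrier R)"
    by (simp add: R_def)
  from R.finite_field_mult_group_has_gen[OF this] obtain g where
    g: "g \<in> carrier (mult_of R)" "carrier (mult_of R) = {g [^]\<^bsub>R\<^esub> i | i::nat. i \<in> UNIV}"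
    by blast
  have g0: "g \<noteq> 0"
    using g(1) by (simp add: R_def)
  have "\<exists>i < CARD('a) - 1. x = g ^ i" if "x \<noteq> 0" for x
  proof -
    have "x \<in> carrier (mult_of R)"
      using that by (simp add: R_def)
    then obtain i where i: "x = g ^ i"
      unfolding g(2) pow by blast
    have pos: "CARD('a) - 1 > 0"
      using card_mono[of "UNIV :: 'a set" "{0, 1}"] by simp
    have "g ^ i = g ^ (i mod (CARD('a) - 1) + (CARD('a) - 1) * (i div (CARD('a) - 1)))"
      by simp
    also have "\<dots> = g ^ (i mod (CARD('a) - 1))"
      unfolding power_add power_mult finite_field_power_card_minus_one[OF g0] by simp
    finally show ?thesis
      using pos i by (intro exI[of _ "i mod (CARD('a) - 1)"]) simp
  qed
  thus ?thesis
    using g0 by blast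
qed

section \<open>The prime field and the trace character\<close>

lemma CHAR_eq_if_CARD_prime_power:
  assumes "CARD('a::{finite,field}) = p ^ s" "prime p"
  shows "CHAR('a) = p"
proof -
  have "CHAR('a) > 0"
    by (rule finite_imp_CHAR_pos) simp
  hence "prime CHAR('a)"
    by (rule prime_CHAR_semidom)
  moreover have "CHAR('a) dvd p ^ s"
    using CHAR_dvd_CARD[where 'a = 'a] assms(1) by simp
  ultimately show ?thesis
    using assms(2) by (metis prime_dvd_power primes_dvd_imp_eq)
qed

text \<open>The polynomial X^p - X has at most p roots, and the p distinct images of 0, ..., p - 1
  are already roots.\<close>

lemma power_eq_self_imp_of_nat:
  fixes y :: "'a::{finite,field}"
  assumes "prime p" "CHAR('a) = p" "y ^ p = y"
  shows "\<exists>k<p. y = of_nat k"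
proof -
  define P :: "'a poly" where "P = monom 1 p - [:0, 1:]"
  have p2: "p \<ge> 2"
    using assms(1) prime_ge_2_nat by blast
  have degP: "degree P = p"
    unfolding P_def using p2
    by (intro antisym degree_diff_le le_degree) (auto simp: degree_monom_eq coeff_pCons split: nat.splits)
  have P0: "P \<noteq> 0"
    using degP p2 by auto
  have fermat: "(of_nat k :: 'a) ^ p = of_nat k" for k
  proof (induction k)
    case (Suc k)
    have "(1 + of_nat k :: 'a) ^ p = 1 ^ p + of_nat k ^ p"
      by (rule freshmans_dream) (use assms in auto)
    thus ?case
      unfolding of_nat_Suc Suc.IH by simp
  qed (use p2 in auto)
  have roots: "{x. poly P x = 0} = {x. x ^ p = x}"
    by (auto simp: P_def poly_monom)
  have inj: "inj_on (of_nat :: nat \<Rightarrow> 'a) {..<p}"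
    by (rule inj_onI) (simp add: of_nat_eq_iff_cong_CHAR assms(2) cong_def)
  have sub: "(of_nat ` {..<p} :: 'a set) \<subseteq> {x. x ^ p = x}"
    using fermat by auto
  have "card {x::'a. x ^ p = x} \<le> p"
    using card_poly_roots_bound[OF P0] degP roots by simp
  moreover have "card (of_nat ` {..<p} :: 'a set) = p"
    using card_image[OF inj] by simp
  ultimately have "(of_nat ` {..<p} :: 'a set) = {x. x ^ p = x}"
    using sub by (intro card_seteq) auto
  thus ?thesis
    using assms(3) by blast
qed

text \<open>The character is exp(2 pi i Tr x / p) with the absolute trace Tr x = x + x^p + ... +
  x^(p^(s-1)). Frobenius permutes these summands; hence Tr x lies in the prime field and the
  character is invariant under x |-> x^p. Nontriviality is a degree count: as a polynomial the trace
  has degree at most p^(s-1) < q, too small to vanish everywhere.\<close>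

lemma additive_character_exists:
  assumes card: "CARD('a::{finite,field}) = p ^ s" and p: "prime p" and s: "s \<ge> 1"
  shows "\<exists>\<psi> :: 'a \<Rightarrow> complex. (\<forall>x y. \<psi> (x + y) = \<psi> x * \<psi> y) \<and> (\<forall>x. \<psi> (x ^ p) = \<psi> x)
           \<and> (\<forall>x. \<psi> x ^ p = 1) \<and> (\<exists>x. \<psi> x \<noteq> 1)"
proof -
  have char: "CHAR('a) = p"
    by (rule CHAR_eq_if_CARD_prime_power[OF card p])
  have p2: "p \<ge> 2"
    using p prime_ge_2_nat by blast
  define Tr :: "'a \<Rightarrow> 'a" where "Tr = (\<lambda>x. \<Sum>i<s. x ^ (p ^ i))"
  have xq: "x ^ (p ^ s) = x" for x :: 'a
  proof (cases "x = 0")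
    case True
    thus ?thesis using p2 by simp
  next
    case False
    have "x ^ (p ^ s) = x ^ (p ^ s - 1) * x"
      using p2 by (metis Suc_diff_1 pos2 order.strict_trans2 power_Suc2 zero_less_power)
    thus ?thesis
      using finite_field_power_card_minus_one[OF False] card by simp
  qed
  have Tr_add: "Tr (x + y) = Tr x + Tr y" for x y
    unfolding Tr_def
    by (subst sum.distrib[symmetric], intro sum.cong refl freshmans_dream')
       (use p char in auto)
  have Tr_frob: "Tr (x ^ p) = Tr x" for x
  proof -
    have "Tr (x ^ p) + x = (\<Sum>i<Suc s. x ^ (p ^ i))"
      unfolding Tr_def by (subst sum.lessThan_Suc_shift) (simp add: power_mult[symmetric])
    also have "\<dots> = Tr x + x"
      by (simp add: Tr_def xq)
    finally show ?thesis by simp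
  qed
  have Tr_pow: "Tr x ^ p = Tr x" for x
  proof -
    have "Tr x ^ p = Tr (x ^ p)"
      unfolding Tr_def
      by (subst freshmans_dream_sum) (use p char in \<open>auto simp: power_mult[symmetric] mult.commute\<close>)
    thus ?thesis by (simp add: Tr_frob)
  qed
  have "\<exists>k. Tr x = of_nat k" for x
    using power_eq_self_imp_of_nat[OF p char Tr_pow] by blast
  then obtain f where f: "\<And>x. Tr x = of_nat (f x)"
    by metis
  define \<psi> :: "'a \<Rightarrow> complex" where "\<psi> = (\<lambda>x. cis (2 * pi / p) ^ f x)"
  have w: "cis (2 * pi / p) ^ p = 1"
    using p2 by (simp add: DeMoivre)
  have wcong: "cis (2 * pi / p) ^ a = cis (2 * pi / p) ^ b" if "[a = b] (mod p)" for a b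
  proof -
    have *: "cis (2 * pi / p) ^ a = cis (2 * pi / p) ^ (a mod p)" for a
    proof -
      have "cis (2 * pi / p) ^ a = cis (2 * pi / p) ^ (p * (a div p) + a mod p)" by simp
      thus ?thesis unfolding power_add power_mult w by simp
    qed
    show ?thesis
      using that *[of a] *[of b] by (simp add: cong_def)
  qed
  have "\<psi> (x + y) = \<psi> x * \<psi> y" for x y
  proof -
    have "of_nat (f (x + y)) = (of_nat (f x + f y) :: 'a)"
      using Tr_add[of x y] by (simp add: f)
    hence "[f (x + y) = f x + f y] (mod p)"
      using of_nat_eq_iff_cong_CHAR char by blast
    thus ?thesis
      unfolding \<psi>_def power_add[symmetric] by (rule wcong)
  qed
  moreover have "\<psi> (x ^ p) = \<psi> x" for x
  proof -
    have "of_nat (f (x ^ p)) = (of_nat (f x) :: 'a)"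
      using Tr_frob[of x] by (simp add: f)
    hence "[f (x ^ p) = f x] (mod p)"
      using of_nat_eq_iff_cong_CHAR char by blast
    thus ?thesis
      unfolding \<psi>_def by (rule wcong)
  qed
  moreover have "\<psi> x ^ p = 1" for x
    unfolding \<psi>_def using w by (metis mult.commute power_mult power_one)
  moreover have "\<exists>x. \<psi> x \<noteq> 1"
  proof (rule ccontr)
    assume "\<not> ?thesis"
    hence one: "cis (2 * pi / p) ^ f x = 1" for x
      by (auto simp: \<psi>_def)
    have Tr0: "Tr x = 0" for x
    proof -
      have "cis (2 * pi / p) ^ (f x mod p) = 1"
        using one[of x] wcong[of "f x mod p" "f x"] by (simp add: cong_def)
      hence "cis (2 * pi * real (f x mod p) / p) = cis (2 * pi * real 0 / p)"
        by (simp add: DeMoivre mult_ac)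
      moreover have "inj_on (\<lambda>k. cis (2 * pi * real k / real p)) {..<p}"
        using p2 bij_betw_roots_unity[of p] by (simp add: bij_betw_def)
      ultimately have "f x mod p = 0"
        using p2 inj_onD[of "\<lambda>k. cis (2 * pi * real k / real p)" "{..<p}" "f x mod p" 0] by simp
      thus ?thesis
        by (simp add: f of_nat_eq_0_iff_char_dvd char mod_eq_0_iff_dvd)
    qed
    define P :: "'a poly" where "P = (\<Sum>i<s. monom 1 (p ^ i))"
    have poly: "poly P x = 0" for x
      using Tr0[of x] by (simp add: P_def poly_sum poly_monom Tr_def)
    have "coeff P (p ^ (s - 1)) = (\<Sum>i<s. if i = s - 1 then 1 else 0)"
      unfolding P_def coeff_sum
      by (intro sum.cong refl) (use p2 in \<open>auto simp: coeff_monom\<close>)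
    also have "\<dots> = 1" using s by simp
    finally have P0: "P \<noteq> 0" by auto
    have "degree P \<le> p ^ (s - 1)"
      unfolding P_def
      by (intro degree_sum_le) (use p2 in \<open>auto simp: degree_monom_eq intro!: power_increasing\<close>)
    moreover have "card {x. poly P x = 0} \<le> degree P"
      by (rule card_poly_roots_bound[OF P0])
    moreover have "card {x. poly P x = 0} = p ^ s"
      using card poly by simp
    moreover have "p ^ (s - 1) < p ^ s"
      using p2 s by (intro power_strict_increasing) auto
    ultimately show False by linarith
  qed
  ultimately show ?thesis by blast
qed

section \<open>Algebraic integers, sums of two squares, and divisibility by and powers of p\<close>

lemma algebraic_int_poly_root_of_unity:
  fixes w :: complex and P :: "int poly"
  assumes w: "w ^ n = 1" and n: "n > 0"
  shows "algebraic_int (poly (map_poly of_int P) w)"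
proof -
  define z where "z = poly (map_poly of_int P) w"
  \<comment> \<open>Row r holds the coefficients of z * w^r in terms of 1, w, ..., w^(n-1), with
    exponents reduced modulo n. So z is an eigenvalue of an integer matrix and a root of its monic
    characteristic polynomial.\<close>
  define B :: "int mat" where
    "B = mat n n (\<lambda>(r, k). \<Sum>i\<in>{i. i \<le> degree P \<and> (i + r) mod n = k}. coeff P i)"
  define A :: "complex mat" where "A = map_mat of_int B"
  define v where "v = vec n (\<lambda>k. w ^ k)"
  have B: "B \<in> carrier_mat n n"
    by (simp add: B_def)
  hence A: "A \<in> carrier_mat n n"
    by (simp add: A_def)
  have wmod: "w ^ (k mod n) = w ^ k" for k
  proof -
    have "w ^ k = w ^ (n * (k div n) + k mod n)" by simp
    also have "\<dots> = w ^ (k mod n)" unfolding power_add power_mult w by simp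
    finally show ?thesis ..
  qed
  have z_eq: "z = (\<Sum>i\<le>degree P. of_int (coeff P i) * w ^ i)"
    unfolding z_def poly_altdef by (simp add: degree_map_poly coeff_map_poly)
  have "A *\<^sub>v v = z \<cdot>\<^sub>v v"
  proof (rule eq_vecI)
    fix r assume "r < dim_vec (z \<cdot>\<^sub>v v)"
    hence r: "r < n" by (simp add: v_def)
    have "(A *\<^sub>v v) $ r
        = (\<Sum>k<n. (\<Sum>i\<in>{i. i \<le> degree P \<and> (i + r) mod n = k}. of_int (coeff P i)) * w ^ k)"
      using r by (simp add: A_def B_def v_def scalar_prod_def atLeast0LessThan)
    also have "\<dots> = (\<Sum>k<n. \<Sum>i\<in>{i \<in> {..degree P}. (i + r) mod n = k}. of_int (coeff P i) * w ^ (i + r))"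
      unfolding sum_distrib_right
      by (intro sum.cong refl) (auto simp: wmod)
    also have "\<dots> = (\<Sum>i\<le>degree P. of_int (coeff P i) * w ^ (i + r))"
      by (rule sum.group) (use n in auto)
    also have "\<dots> = (z \<cdot>\<^sub>v v) $ r"
      using r by (simp add: z_eq v_def power_add sum_distrib_right mult.assoc)
    finally show "(A *\<^sub>v v) $ r = (z \<cdot>\<^sub>v v) $ r" .
  qed (simp add: A_def B_def v_def)
  moreover have "v $ 0 \<noteq> 0\<^sub>v n $ 0"
    using n by (simp add: v_def)
  hence "v \<noteq> 0\<^sub>v n" by metis
  ultimately have "eigenvector A v z"
    using A by (simp add: eigenvector_def v_def)
  hence "eigenvalue A z"
    by (auto simp: eigenvalue_def)
  hence "poly (char_poly A) z = 0"
    using eigenvalue_root_char_poly[OF A] by simp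
  moreover have "char_poly A = map_poly of_int (char_poly B)"
    unfolding A_def by (rule of_int_hom.char_poly_hom[OF B])
  moreover have "lead_coeff (char_poly B) = 1"
    using degree_monic_char_poly[OF B] by simp
  ultimately show ?thesis
    unfolding algebraic_int_altdef_ipoly z_def[symmetric] by auto
qed

text \<open>Put N = p^k. Multiplying c + id by a + ib or by its conjugate gives X + iY with X^2 +
  Y^2 = N^2. The two candidates for X have a product divisible by N, and p cannot divide both, since
  their sum is 2ac. Hence N divides one of them, and that X is 0 or +-N. The case X = 0 would make N
  = a^2 + c^2 even, so Y = 0 and a^2 = c^2.\<close>

lemma sum_squares_prime_power_unique:
  fixes a b c d :: int and p k :: nat
  assumes p: "prime p" "odd p" and ab: "a\<^sup>2 + b\<^sup>2 = int (p ^ k)" and cd: "c\<^sup>2 + d\<^sup>2 = int (p ^ k)"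
    and "\<not> int p dvd a" "\<not> int p dvd c" and odd: "odd a" "odd c"
  shows "a\<^sup>2 = c\<^sup>2"
proof -
  define N where "N = int (p ^ k)"
  have pp: "prime (int p)" using p by simp
  have N0: "N > 0" using p by (simp add: N_def prime_gt_0_nat)
  have oddN: "odd N" using p by (simp add: N_def)
  have b: "b\<^sup>2 = N - a\<^sup>2" and d: "d\<^sup>2 = N - c\<^sup>2"
    using ab cd by (simp_all add: N_def)
  have key: "a\<^sup>2 = c\<^sup>2" if X: "N dvd a * c + e * b * d" and e: "e = 1 \<or> e = -1" for e
  proof -
    \<comment> \<open>X + iY is (a - e b i)(c + d i); the sign e chooses between a factor and its
      conjugate.\<close>
    define X Y where "X = a * c + e * b * d" and "Y = a * d - e * b * c"
    have e2: "e * e = 1" using e by auto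
    have "X\<^sup>2 + Y\<^sup>2 = a\<^sup>2 * c\<^sup>2 + a\<^sup>2 * d\<^sup>2 + e * e * (b\<^sup>2 * c\<^sup>2 + b\<^sup>2 * d\<^sup>2)"
      unfolding X_def Y_def by (simp add: power2_eq_square algebra_simps)
    also have "\<dots> = N\<^sup>2"
      unfolding e2 b d by (simp add: algebra_simps power2_eq_square)
    finally have XY: "X\<^sup>2 + Y\<^sup>2 = N\<^sup>2" .
    obtain t where t: "X = N * t" using X by (auto simp: X_def)
    have "N\<^sup>2 * t\<^sup>2 \<le> N\<^sup>2 * 1"
      using XY by (simp add: t power_mult_distrib) (smt (verit) zero_le_power2)
    hence "t\<^sup>2 \<le> 1"
      using N0 by (simp add: mult_le_cancel_left)
    hence "t\<^sup>2 = 0 \<or> t\<^sup>2 = 1"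
      using zero_le_power2[of t] by linarith
    thus ?thesis
    proof
      assume "t\<^sup>2 = 0"
      hence "a * c = - (e * b * d)"
        using t by (simp add: X_def)
      hence "(a * c)\<^sup>2 = (e * b * d)\<^sup>2"
        by simp
      hence "a\<^sup>2 * c\<^sup>2 = e * e * (b\<^sup>2 * d\<^sup>2)"
        by (simp add: power2_eq_square algebra_simps)
      hence "N * N = N * (a\<^sup>2 + c\<^sup>2)"
        unfolding e2 b d by (simp add: algebra_simps)
      hence "N = a\<^sup>2 + c\<^sup>2" using N0 by simp
      hence "even N" using odd by simp
      thus ?thesis using oddN by simp
    next
      assume "t\<^sup>2 = 1"
      hence "Y = 0" using XY by (simp add: t power_mult_distrib)
      hence "a * d = e * b * c" by (simp add: Y_def)
      hence "(a * d)\<^sup>2 = (e * b * c)\<^sup>2" by simp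
      hence "a\<^sup>2 * d\<^sup>2 = e * e * (b\<^sup>2 * c\<^sup>2)"
        by (simp add: power2_eq_square algebra_simps)
      hence "N * a\<^sup>2 = N * c\<^sup>2"
        unfolding e2 b d by (simp add: algebra_simps)
      thus ?thesis using N0 by simp
    qed
  qed
  have "(a * c - b * d) * (a * c + b * d) = a\<^sup>2 * c\<^sup>2 - b\<^sup>2 * d\<^sup>2"
    by (simp add: power2_eq_square algebra_simps)
  also have "\<dots> = N * (a\<^sup>2 + c\<^sup>2 - N)"
    unfolding b d by (simp add: algebra_simps)
  finally have dvd: "N dvd (a * c - b * d) * (a * c + b * d)" by simp
  have "\<not> (int p dvd a * c - b * d \<and> int p dvd a * c + b * d)"
  proof
    assume "int p dvd a * c - b * d \<and> int p dvd a * c + b * d"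
    hence "int p dvd (a * c - b * d) + (a * c + b * d)" by (simp only: dvd_add)
    hence "int p dvd 2 * (a * c)" by (simp add: algebra_simps)
    moreover have "\<not> int p dvd 2"
      using p by (metis dvd_refl int_dvd_int_iff of_nat_numeral primes_dvd_imp_eq two_is_prime_nat)
    ultimately show False
      using assms(5,6) pp by (simp add: prime_dvd_mult_iff)
  qed
  then consider "\<not> int p dvd a * c - b * d" | "\<not> int p dvd a * c + b * d" by blast
  thus ?thesis
  proof cases
    case 1
    hence "coprime N (a * c - b * d)"
      using pp by (simp add: N_def prime_imp_coprime)
    hence "N dvd a * c + b * d"
      using dvd by (simp add: coprime_dvd_mult_right_iff)
    thus ?thesis using key[of 1] by simp
  next
    case 2
    hence "coprime N (a * c + b * d)"
      using pp by (simp add: N_def prime_imp_coprime)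
    hence "N dvd a * c - b * d"
      using dvd by (simp add: coprime_dvd_mult_left_iff)
    thus ?thesis using key[of "-1"] by simp
  qed
qed

text \<open>Among the factors of (pn + e)! only p, 2p, ..., np are divisible by p, and their product
  is p^n n!. The remaining e < p factors at the top contribute nothing.\<close>

lemma multiplicity_fact_mult_add:
  fixes p n e :: nat
  assumes p: "prime p" and "e < p"
  shows "multiplicity p (fact (p * n + e) :: nat) = n + multiplicity p (fact n :: nat)"
  using assms(2)
proof (induction n arbitrary: e)
  case 0
  have "\<not> p dvd (fact e :: nat)"
    using p 0 by (simp add: prime_dvd_fact_iff)
  thus ?case
    by (simp add: not_dvd_imp_multiplicity_0)
next
  case (Suc n)
  have p2: "p \<ge> 2" using p prime_ge_2_nat by blast
  show ?case using Suc.prems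
  proof (induction e)
    case 0
    have eq: "p * Suc n + 0 = Suc (p * n + (p - 1))" using p2 by simp
    have "(fact (p * Suc n + 0) :: nat) = (p * Suc n) * fact (p * n + (p - 1))"
      using fact_Suc[of "p * n + (p - 1)", where 'a = nat]
      by (simp only: eq[symmetric] of_nat_id add_0_right)
    hence "multiplicity p (fact (p * Suc n + 0) :: nat)
        = multiplicity p ((p * Suc n) * fact (p * n + (p - 1)))"
      by (rule arg_cong)
    also have "\<dots> = multiplicity p (p * Suc n) + multiplicity p (fact (p * n + (p - 1)) :: nat)"
      by (rule prime_elem_multiplicity_mult_distrib) (use p p2 in auto)
    also have "multiplicity p (p * Suc n) = 1 + multiplicity p (Suc n)"
      using p by (subst prime_elem_multiplicity_mult_distrib) (auto simp: prime_gt_0_nat)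
    also have "multiplicity p (fact (p * n + (p - 1)) :: nat) = n + multiplicity p (fact n :: nat)"
      using Suc.IH[of "p - 1"] p2 by simp
    also have "1 + multiplicity p (Suc n) + (n + multiplicity p (fact n :: nat))
         = Suc n + multiplicity p (fact (Suc n) :: nat)"
      unfolding fact_Suc of_nat_id by (subst prime_elem_multiplicity_mult_distrib) (use p in \<open>simp_all del: mult_Suc\<close>)
    finally show ?case .
  next
    case (Suc e)
    have "\<not> p dvd Suc (p * Suc n + e)"
    proof
      assume "p dvd Suc (p * Suc n + e)"
      hence "p dvd p * Suc n + Suc e" by simp
      hence "p dvd Suc e" using dvd_add_right_iff[of p "p * Suc n" "Suc e"] by simp
      thus False using Suc.prems by (auto dest: dvd_imp_le)
    qed
    hence "multiplicity p (Suc (p * Suc n + e)) = 0"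
      by (rule not_dvd_imp_multiplicity_0)
    moreover have "multiplicity p (fact (p * Suc n + Suc e) :: nat)
        = multiplicity p (Suc (p * Suc n + e)) + multiplicity p (fact (p * Suc n + e) :: nat)"
      unfolding add_Suc_right fact_Suc using p
      by (subst prime_elem_multiplicity_mult_distrib) auto
    ultimately show ?case
      using Suc by simp
  qed
qed

text \<open>All s digits of M = (p^s - 1) / 4 in base p equal d = (p - 1) / 4, and 2d < p, so adding
  M to itself produces no carry. In terms of factorials, each further digit raises the multiplicity
  of p in (2M)! and in (M!)^2 by the same amount.\<close>

lemma prime_not_dvd_central_binomial:
  fixes p s :: nat
  assumes p: "prime p" "p mod 4 = 1"
  shows "\<not> p dvd ((2 * ((p ^ s - 1) div 4)) choose ((p ^ s - 1) div 4))"
proof -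
  define M where "M = (\<lambda>s. (p ^ s - 1) div 4)"
  define d where "d = (p - 1) div 4"
  have p4: "p = 4 * d + 1" using p(2) unfolding d_def by presburger
  have p2: "p \<ge> 2" using p prime_ge_2_nat by blast
  have M4: "p ^ s = 4 * M s + 1" for s
  proof -
    have "p ^ s mod 4 = 1" using power_mod[of p 4 s] p(2) by simp
    thus ?thesis unfolding M_def by presburger
  qed
  have M_Suc: "M (Suc s) = p * M s + d" for s
    using M4[of s] M4[of "Suc s"] p4 by (simp add: algebra_simps)
  have mult: "multiplicity p (fact (2 * M s) :: nat) = 2 * multiplicity p (fact (M s) :: nat)" for s
  proof (induction s)
    case 0
    thus ?case by (simp add: M_def)
  next
    case (Suc s)
    have "2 * M (Suc s) = p * (2 * M s) + 2 * d" by (simp add: M_Suc)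
    thus ?case
      using multiplicity_fact_mult_add[OF p(1), of "2 * d" "2 * M s"] Suc
        multiplicity_fact_mult_add[OF p(1), of d "M s"] p4
      by (simp add: M_Suc)
  qed
  have "fact (M s) * fact (2 * M s - M s) * ((2 * M s) choose (M s)) = (fact (2 * M s) :: nat)"
    by (rule binomial_fact_lemma) simp
  hence "multiplicity p (fact (M s) * fact (M s) * ((2 * M s) choose (M s)))
       = multiplicity p (fact (2 * M s) :: nat)"
    by simp
  moreover have "(2 * M s) choose (M s) > 0" by simp
  ultimately have "multiplicity p ((2 * M s) choose (M s)) = 0"
    using p(1) mult[of s] by (simp add: prime_elem_multiplicity_mult_distrib)
  thus ?thesis
    using p2 \<open>(2 * M s) choose (M s) > 0\<close> unfolding M_def
    by (metis multiplicity_eq_zero_iff not_prime_unit p(1) less_numeral_extra(3))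
qed

text \<open>The 2-adic valuation of p^(2^k) - 1 is exactly k + 2: it is 2 for p itself, and each
  squaring adds one. Multiplication by this power therefore changes an odd residue modulo 2^(k+3) in
  its top bit only.\<close>

lemma power_two_power_cong:
  fixes p k :: nat
  assumes "p mod 8 = 5"
  shows "[p ^ 2 ^ k = 1 + 2 ^ (k + 2)] (mod 2 ^ (k + 3))"
proof (induction k)
  case 0
  show ?case using assms by (simp add: cong_def)
next
  case (Suc k)
  have "[int (p ^ 2 ^ k) = int (1 + 2 ^ (k + 2))] (mod int (2 ^ (k + 3)))"
    using Suc.IH by (simp only: cong_int_iff)
  from cong_sym[OF this] obtain t :: int
    where t: "int (p ^ 2 ^ k) = int (1 + 2 ^ (k + 2)) + int (2 ^ (k + 3)) * t"
    unfolding cong_iff_lin by blast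
  have "int (p ^ 2 ^ Suc k) = (int (p ^ 2 ^ k))\<^sup>2"
    by (simp add: power_mult[symmetric] mult.commute)
  also have "\<dots> = 1 + 2 ^ (k + 3) + 2 ^ (k + 4) * (t + 2 ^ k * (1 + 2 * t)\<^sup>2)"
    unfolding t by (simp add: power_add power2_eq_square algebra_simps)
  finally have "[int (p ^ 2 ^ Suc k) = 1 + 2 ^ (k + 3)] (mod 2 ^ (k + 4))"
    by (simp add: cong_iff_dvd_diff)
  hence "[int (p ^ 2 ^ Suc k) = int (1 + 2 ^ (Suc k + 2))] (mod int (2 ^ (Suc k + 3)))"
    by (simp add: eval_nat_numeral)
  thus ?case by (simp only: cong_int_iff)
qed

text \<open>The exponent is lifted one bit at a time. If p^t agrees with l modulo 2^(k+2) but not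
  modulo 2^(k+3), the wrong top bit is flipped by the factor p^(2^k).\<close>

lemma one_mod_four_eq_power_cong:
  fixes p k l :: nat
  assumes p: "p mod 8 = 5" and l: "l mod 4 = 1"
  shows "\<exists>t. [p ^ t = l] (mod 2 ^ (k + 2))"
proof (induction k)
  case 0
  have "p mod 4 = 1" using p by presburger
  thus ?case using l by (intro exI[of _ 1]) (simp add: cong_def)
next
  case (Suc k)
  then obtain t where t: "[p ^ t = l] (mod 2 ^ (k + 2))" by blast
  have "[int (p ^ t) = int l] (mod int (2 ^ (k + 2)))"
    using t by (simp only: cong_int_iff)
  then obtain u where "int l = int (p ^ t) + int (2 ^ (k + 2)) * u"
    unfolding cong_iff_lin by blast
  hence u: "int l = int (p ^ t) + 2 ^ (k + 2) * u" by simp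
  show ?case
  proof (cases "even u")
    case True
    then obtain v where "u = 2 * v" by blast
    hence "[int (p ^ t) = int l] (mod int (2 ^ (Suc k + 2)))"
      using u by (simp add: cong_iff_dvd_diff)
    thus ?thesis unfolding cong_int_iff by blast
  next
    case False
    have "odd p" using p by presburger
    hence odd: "odd (p ^ t)" by simp
    have "[int (p ^ 2 ^ k) = int (1 + 2 ^ (k + 2))] (mod int (2 ^ (k + 3)))"
      using power_two_power_cong[OF p, of k] by (simp only: cong_int_iff)
    hence "[int (p ^ t) * int (p ^ 2 ^ k) = int (p ^ t) * (1 + 2 ^ (k + 2))] (mod 2 ^ (k + 3))"
      using cong_scalar_left by fastforce
    moreover have "[int (p ^ t) * (1 + 2 ^ (k + 2)) = int l] (mod 2 ^ (k + 3))"
    proof -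
      have "even (int (p ^ t) - u)" using odd False by simp
      then obtain v where v: "int (p ^ t) - u = 2 * v" by blast
      have "int (p ^ t) * (1 + 2 ^ (k + 2)) - int l = 2 ^ (k + 2) * (int (p ^ t) - u)"
        unfolding u by (simp add: algebra_simps)
      also have "\<dots> = 2 ^ (k + 3) * v" unfolding v by (simp add: power_add)
      finally show ?thesis by (simp add: cong_iff_dvd_diff)
    qed
    ultimately have "[int (p ^ t * p ^ 2 ^ k) = int l] (mod int (2 ^ (k + 3)))"
      by (auto intro: cong_trans)
    hence "[p ^ (t + 2 ^ k) = l] (mod 2 ^ (Suc k + 2))"
      unfolding cong_int_iff by (simp add: power_add eval_nat_numeral)
    thus ?thesis by blast
  qed
qed

section \<open>Rearrangement of finite sums, and roots of unity\<close>

lemma sum_multiples: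
  fixes f :: "nat \<Rightarrow> 'b::comm_monoid_add"
  assumes "K > 0"
  shows "(\<Sum>i<K * M. if K dvd i then f i else 0) = (\<Sum>j<M. f (K * j))"
proof -
  have "(\<Sum>i<K * M. if K dvd i then f i else 0) = (\<Sum>i\<in>{i \<in> {..<K * M}. K dvd i}. f i)"
    by (rule sum.inter_filter[symmetric]) simp
  also have "\<dots> = (\<Sum>j<M. f (K * j))"
    using assms by (intro sum.reindex_bij_witness[of _ "\<lambda>j. K * j" "\<lambda>i. i div K"]) auto
  finally show ?thesis .
qed

lemma sum_periodic:
  fixes f :: "nat \<Rightarrow> 'b::comm_semiring_1"
  assumes "\<And>i. f (i + M) = f i"
  shows "(\<Sum>i<K * M. f i) = of_nat K * (\<Sum>j<M. f j)"
proof (induction K)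
  case (Suc K)
  have per: "f (i + K * M) = f i" for i
    by (induction K) (simp_all add: assms add.assoc[symmetric] add.commute[of M])
  have "(\<Sum>i<Suc K * M. f i) = (\<Sum>i<K * M. f i) + (\<Sum>i=K * M..<K * M + M. f i)"
    by (simp add: lessThan_atLeast0 sum.atLeastLessThan_concat add.commute)
  also have "(\<Sum>i=K * M..<K * M + M. f i) = (\<Sum>i<M. f i)"
    using sum.shift_bounds_nat_ivl[of f 0 "K * M" M] by (simp add: per lessThan_atLeast0 add.commute)
  finally show ?case
    using Suc by (simp add: algebra_simps)
qed simp

lemma sum_prod_list_length:
  fixes f :: "'a::finite \<Rightarrow> 'b::comm_semiring_1"
  shows "(\<Sum>xs\<in>{xs. length xs = n}. prod_list (map f xs)) = (\<Sum>x\<in>UNIV. f x) ^ n"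
proof (induction n)
  case 0
  have "{xs :: 'a list. length xs = 0} = {[]}" by auto
  thus ?case by simp
next
  case (Suc n)
  have "(\<Sum>xs\<in>{xs. length xs = Suc n}. prod_list (map f xs))
      = (\<Sum>(x, xs)\<in>UNIV \<times> {xs. length xs = n}. f x * prod_list (map f xs))"
    by (intro sum.reindex_bij_witness[of _ "\<lambda>(x, xs). x # xs" "\<lambda>xs. (hd xs, tl xs)"])
       (auto simp: length_Suc_conv)
  also have "\<dots> = (\<Sum>x\<in>UNIV. f x) * (\<Sum>xs\<in>{xs. length xs = n}. prod_list (map f xs))"
    by (simp add: sum_product sum.cartesian_product)
  finally show ?case
    using Suc by simp
qed

lemma root_unity_power_eq_1_iff:
  assumes "n > 0"
  shows "cis (2 * pi / real n) ^ a = 1 \<longleftrightarrow> n dvd a"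
proof
  assume "cis (2 * pi / real n) ^ a = 1"
  moreover have "cis (2 * pi / real n) ^ a = cis (2 * pi / real n) ^ (n * (a div n) + a mod n)"
    by simp
  moreover have w: "cis (2 * pi / real n) ^ n = 1"
    using assms by (simp add: DeMoivre)
  ultimately have "cis (2 * pi / real n) ^ (a mod n) = 1"
    unfolding power_add power_mult w by simp
  hence "cis (2 * pi * real (a mod n) / real n) = cis (2 * pi * real 0 / real n)"
    by (simp add: DeMoivre mult_ac)
  moreover have "inj_on (\<lambda>k. cis (2 * pi * real k / real n)) {..<n}"
    using assms bij_betw_roots_unity[of n] by (simp add: bij_betw_def)
  ultimately have "a mod n = 0"
    using assms inj_onD[of "\<lambda>k. cis (2 * pi * real k / real n)" "{..<n}" "a mod n" 0] by simp
  thus "n dvd a" by (simp add: mod_eq_0_iff_dvd)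
next
  assume "n dvd a"
  then obtain k where "a = n * k" by blast
  moreover have "cis (2 * pi / real n) ^ n = 1"
    using assms by (simp add: DeMoivre)
  ultimately show "cis (2 * pi / real n) ^ a = 1"
    by (simp add: power_mult)
qed

lemma geometric_sum_root_unity:
  fixes z :: "'b::field"
  assumes "z ^ n = 1"
  shows "(\<Sum>l<n. z ^ l) = (if z = 1 then of_nat n else 0)"
proof (cases "z = 1")
  case False
  have "(z - 1) * (\<Sum>l<n. z ^ l) = z ^ n - 1"
    by (rule power_diff_1_eq[symmetric])
  thus ?thesis using False assms by simp
qed simp

lemma sum_even_odd:
  fixes F :: "nat \<Rightarrow> 'b::comm_monoid_add"
  shows "(\<Sum>l<2 * n. F l) = (\<Sum>l<n. F (2 * l)) + (\<Sum>l<n. F (2 * l + 1))"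
  by (induction n) (simp_all add: add_ac)

lemma sum_pred_closed:
  assumes "P 0" "\<And>x y. P x \<Longrightarrow> P y \<Longrightarrow> P (x + y)" "\<And>x. x \<in> A \<Longrightarrow> P (f x)"
  shows "P (sum f A)"
  using assms(3) by (induction A rule: infinite_finite_induct) (auto intro: assms(1,2))

text \<open>Intended for T = m - 2. Below that valuation a period depends only on t and on the odd
  part of its index modulo 4. The indices 2^(m-2) j with j < 4 that remain are those to which the
  characters of exact order 2^m contribute.\<close>

lemma sum_by_valuation:
  fixes F :: "nat \<Rightarrow> 'b::comm_monoid_add"
  assumes "T \<le> m"
  shows "(\<Sum>j<2 ^ m. F j) = (\<Sum>t<T. \<Sum>l<2 ^ (m - t - 1). F (2 ^ t * (2 * l + 1))) + (\<Sum>j<2 ^ (m - T). F (2 ^ T * j))"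
  using assms
proof (induction T)
  case (Suc T)
  have "2 ^ (m - T) = 2 * (2::nat) ^ (m - Suc T)"
    using Suc.prems by (simp add: Suc_diff_Suc flip: power_Suc)
  hence "(\<Sum>j<2 ^ (m - T). F (2 ^ T * j))
      = (\<Sum>l<2 ^ (m - Suc T). F (2 ^ T * (2 * l))) + (\<Sum>l<2 ^ (m - Suc T). F (2 ^ T * (2 * l + 1)))"
    by (simp only: sum_even_odd)
  thus ?case
    using Suc by (simp add: mult_ac add_ac)
qed simp

lemma sum_odd_mod_four:
  fixes F :: "nat \<Rightarrow> 'b::comm_semiring_1"
  assumes "\<And>u. F (4 * u + 1) = a" "\<And>u. F (4 * u + 3) = b"
  shows "(\<Sum>l<2 ^ Suc k. F (2 * l + 1)) = 2 ^ k * (a + b)"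
proof -
  have "(\<Sum>l<2 ^ Suc k. F (2 * l + 1)) = (\<Sum>u<2 ^ k. F (2 * (2 * u) + 1)) + (\<Sum>u<2 ^ k. F (2 * (2 * u + 1) + 1))"
    unfolding power_Suc by (rule sum_even_odd)
  also have "\<dots> = (\<Sum>u<2 ^ k. F (4 * u + 1)) + (\<Sum>u<2 ^ k. F (4 * u + 3))"
    by (simp add: numeral_3_eq_3)
  finally show ?thesis by (simp add: assms distrib_left del: One_nat_def)
qed

lemma minus_i_power:
  "n mod 4 = 0 \<Longrightarrow> (- \<i>) ^ n = 1" "n mod 4 = 1 \<Longrightarrow> (- \<i>) ^ n = - \<i>"
  "n mod 4 = 2 \<Longrightarrow> (- \<i>) ^ n = -1" "n mod 4 = 3 \<Longrightarrow> (- \<i>) ^ n = \<i>"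
proof -
  have 4: "(- \<i>) ^ 4 = 1" by (simp add: eval_nat_numeral)
  have "(- \<i>) ^ n = (- \<i>) ^ (4 * (n div 4) + n mod 4)" by simp
  hence *: "(- \<i>) ^ n = (- \<i>) ^ (n mod 4)" unfolding power_add power_mult 4 by simp
  show "n mod 4 = 0 \<Longrightarrow> (- \<i>) ^ n = 1" "n mod 4 = 1 \<Longrightarrow> (- \<i>) ^ n = - \<i>"
    "n mod 4 = 2 \<Longrightarrow> (- \<i>) ^ n = -1" "n mod 4 = 3 \<Longrightarrow> (- \<i>) ^ n = \<i>"
    unfolding * by (simp_all add: power2_eq_square power3_eq_cube)
qed

section \<open>Gauss and Jacobi sums\<close>

text \<open>The value 0 at 0 is demanded of the trivial character as well, so that pointwise
  products of characters are characters. A power \<open>\<chi> x ^ l\<close> has this value only for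
  l >= 1, hence the lower bounds on exponents below.\<close>

definition mult_char :: "('a::field \<Rightarrow> complex) \<Rightarrow> bool" where
  "mult_char c \<longleftrightarrow> c 0 = 0 \<and> c 1 = 1 \<and> (\<forall>x y. c (x * y) = c x * c y)"

definition nontrivial_char :: "('a::field \<Rightarrow> complex) \<Rightarrow> bool" where
  "nontrivial_char c \<longleftrightarrow> mult_char c \<and> (\<exists>x. x \<noteq> 0 \<and> c x \<noteq> 1)"

definition jacobi_sum :: "('a::{finite,field} \<Rightarrow> complex) \<Rightarrow> ('a \<Rightarrow> complex) \<Rightarrow> complex" where
  "jacobi_sum c d = (\<Sum>x\<in>UNIV. c x * d (1 - x))"

lemma mult_charD:
  assumes "mult_char c"
  shows "c 0 = 0" "c 1 = 1" "c (x * y) = c x * c y"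
  using assms by (auto simp: mult_char_def)

lemma nontrivial_charD: "nontrivial_char c \<Longrightarrow> mult_char c"
  by (simp add: nontrivial_char_def)

lemma mult_char_power:
  assumes "mult_char c"
  shows "c (x ^ n) = c x ^ n"
  by (induction n) (simp_all add: mult_charD[OF assms])

lemma mult_char_norm:
  fixes c :: "'a::{finite,field} \<Rightarrow> complex"
  assumes "mult_char c" "x \<noteq> 0"
  shows "norm (c x) = 1"
proof -
  have "c x ^ (CARD('a) - 1) = 1"
    using mult_char_power[OF assms(1), of x "CARD('a) - 1"]
      finite_field_power_card_minus_one[OF assms(2)] mult_charD(2)[OF assms(1)] by simp
  hence "norm (c x) ^ (CARD('a) - 1) = 1"
    by (metis norm_one norm_power)
  moreover have "CARD('a) - 1 > 0"
    using card_mono[of "UNIV :: 'a set" "{0, 1}"] by simp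
  ultimately show ?thesis
    by (intro power_eq_imp_eq_base[of _ "CARD('a) - 1" 1]) simp_all
qed

lemma mult_char_cnj:
  fixes c :: "'a::{finite,field} \<Rightarrow> complex"
  assumes "mult_char c" "x \<noteq> 0"
  shows "c x * cnj (c x) = 1" "cnj (c x) * c x = 1"
  using mult_char_norm[OF assms] by (simp_all add: complex_norm_square[symmetric] mult.commute[of "cnj (c x)"])

lemma nontrivial_char_sum:
  fixes c :: "'a::{finite,field} \<Rightarrow> complex"
  assumes "nontrivial_char c"
  shows "(\<Sum>x\<in>UNIV. c x) = 0"
proof -
  have c: "mult_char c"
    using assms by (rule nontrivial_charD)
  obtain a where a: "a \<noteq> 0" "c a \<noteq> 1"
    using assms by (auto simp: nontrivial_char_def)
  have bij: "bij ((*) a)"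
    using a by (intro bij_betwI[where g = "\<lambda>y. y / a"]) auto
  have "(\<Sum>x\<in>UNIV. c x) = (\<Sum>x\<in>UNIV. c (a * x))"
    using sum.reindex_bij_betw[OF bij, of c] by simp
  also have "\<dots> = c a * (\<Sum>x\<in>UNIV. c x)"
    by (simp add: mult_charD[OF c] sum_distrib_left)
  finally have "(1 - c a) * (\<Sum>x\<in>UNIV. c x) = 0"
    by (simp add: algebra_simps)
  thus ?thesis
    using a by simp
qed

text \<open>\<open>psi_frob\<close> is the property special to the trace character: rescaling the
  argument by an element outside the prime field preserves the other assumptions and destroys this
  one. It is the source of the equality of the Gauss sums of c and of c^p.\<close>

locale additive_char =
  fixes p s q :: nat and \<psi> :: "'a::{finite,field} \<Rightarrow> complex"
  assumes card: "CARD('a) = q" and q_def: "q = p ^ s" and p: "prime p" and s: "s \<ge> 1"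
    and psi_add: "\<psi> (x + y) = \<psi> x * \<psi> y"
    and psi_frob: "\<psi> (x ^ p) = \<psi> x"
    and psi_pow: "\<psi> x ^ p = 1"
    and psi_nontrivial: "\<exists>x. \<psi> x \<noteq> 1"
begin

lemma CHAR: "CHAR('a) = p"
  using CHAR_eq_if_CARD_prime_power[of p s] card q_def p by auto

lemma psi_nonzero: "\<psi> x \<noteq> 0"
  using psi_pow[of x] p by (auto simp: power_0_left prime_gt_0_nat)

lemma psi_zero: "\<psi> 0 = 1"
  using psi_add[of 0 0] psi_nonzero[of 0] by simp

lemma psi_norm: "norm (\<psi> x) = 1"
proof -
  have "norm (\<psi> x) ^ p = 1"
    using psi_pow[of x] by (metis norm_one norm_power)
  thus ?thesis
    using p by (intro power_eq_imp_eq_base[of _ p 1]) (simp_all add: prime_gt_0_nat)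
qed

lemma psi_cnj: "cnj (\<psi> x) = \<psi> (- x)"
proof -
  have "\<psi> x * \<psi> (- x) = 1"
    using psi_add[of x "- x"] by (simp add: psi_zero)
  moreover have "\<psi> x * cnj (\<psi> x) = 1"
    by (simp add: complex_norm_square[symmetric] psi_norm)
  ultimately have "\<psi> x * cnj (\<psi> x) = \<psi> x * \<psi> (- x)"
    by simp
  thus ?thesis
    using psi_nonzero by simp
qed

lemma psi_sum_list: "\<psi> (sum_list (map f xs)) = prod_list (map (\<lambda>x. \<psi> (f x)) xs)"
  by (induction xs) (simp_all add: psi_zero psi_add)

text \<open>Translation by b permutes H and multiplies the sum by a factor different from 1. It is
  applied to the whole field and, for the quadratic Gauss sum, to a subfield.\<close>

lemma psi_sum_subgroup:
  assumes "0 \<in> H" "\<And>x y. x \<in> H \<Longrightarrow> y \<in> H \<Longrightarrow> x + y \<in> H" "\<And>x. x \<in> H \<Longrightarrow> - x \<in> H"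
    and "b \<in> H" "\<psi> (b * a) \<noteq> 1"
  shows "(\<Sum>x\<in>H. \<psi> (x * a)) = 0"
proof -
  have bij: "bij_betw ((+) b) H H"
    using assms(2-4) by (intro bij_betwI[where g = "\<lambda>y. - b + y"]) (auto simp del: uminus_add_conv_diff)
  have "(\<Sum>x\<in>H. \<psi> (x * a)) = (\<Sum>x\<in>H. \<psi> ((b + x) * a))"
    using sum.reindex_bij_betw[OF bij, of "\<lambda>x. \<psi> (x * a)"] by simp
  also have "\<dots> = \<psi> (b * a) * (\<Sum>x\<in>H. \<psi> (x * a))"
    by (simp add: ring_distribs psi_add sum_distrib_left)
  finally have "(1 - \<psi> (b * a)) * (\<Sum>x\<in>H. \<psi> (x * a)) = 0"
    by (simp add: algebra_simps)
  thus ?thesis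
    using assms(5) by simp
qed

lemma psi_sum: "(\<Sum>x\<in>UNIV. \<psi> (x * a)) = (if a = 0 then of_nat q else 0)"
proof (cases "a = 0")
  case True
  thus ?thesis
    by (simp add: psi_zero card)
next
  case False
  obtain y where "\<psi> y \<noteq> 1"
    using psi_nontrivial by blast
  hence "\<psi> (y / a * a) \<noteq> 1"
    using False by simp
  from psi_sum_subgroup[OF _ _ _ _ this] False show ?thesis
    by simp
qed

lemma frob_add: "(x + y) ^ p ^ k = x ^ p ^ k + (y :: 'a) ^ p ^ k"
  by (rule freshmans_dream') (use CHAR p in auto)

lemma frob_minus: "(- x) ^ p ^ k = - ((x :: 'a) ^ p ^ k)"
proof -
  have "(- x) ^ p ^ k + x ^ p ^ k = 0"
    unfolding frob_add[symmetric] using p by (simp add: prime_gt_0_nat)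
  thus ?thesis
    by (simp add: eq_neg_iff_add_eq_0)
qed

lemma psi_frob_power: "\<psi> (x ^ p ^ k) = \<psi> x"
proof (induction k)
  case (Suc k)
  have "\<psi> (x ^ p ^ Suc k) = \<psi> ((x ^ p ^ k) ^ p)"
    by (simp add: power_mult[symmetric] mult.commute)
  thus ?case
    using Suc by (simp add: psi_frob)
qed simp

lemma bij_frob: "bij (\<lambda>x :: 'a. x ^ p)"
proof -
  have "inj (\<lambda>x :: 'a. x ^ p)"
  proof (rule injI)
    fix x y :: 'a assume "x ^ p = y ^ p"
    hence "(x + - y) ^ p ^ 1 = 0"
      unfolding frob_add frob_minus by simp
    thus "x = y"
      using p by simp
  qed
  thus ?thesis
    by (simp add: bij_betw_def finite_UNIV_inj_surj)
qed

definition gauss_sum :: "('a \<Rightarrow> complex) \<Rightarrow> complex" where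
  "gauss_sum c = (\<Sum>x\<in>UNIV. c x * \<psi> x)"

lemma gauss_sum_twist:
  assumes "nontrivial_char c"
  shows "(\<Sum>x\<in>UNIV. c x * \<psi> (a * x)) = cnj (c a) * gauss_sum c"
proof (cases "a = 0")
  case True
  thus ?thesis
    using nontrivial_char_sum[OF assms] mult_charD(1)[OF nontrivial_charD[OF assms]]
    by (simp add: psi_zero)
next
  case False
  have c: "mult_char c"
    using assms by (rule nontrivial_charD)
  have bij: "bij ((*) a)"
    using False by (intro bij_betwI[where g = "\<lambda>y. y / a"]) auto
  have "cnj (c a) * gauss_sum c = cnj (c a) * (\<Sum>x\<in>UNIV. c (a * x) * \<psi> (a * x))"
    unfolding gauss_sum_def using sum.reindex_bij_betw[OF bij, of "\<lambda>x. c x * \<psi> x"] by simp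
  also have "\<dots> = (\<Sum>x\<in>UNIV. cnj (c a) * c a * (c x * \<psi> (a * x)))"
    by (simp add: mult_charD[OF c] sum_distrib_left mult_ac)
  also have "\<dots> = (\<Sum>x\<in>UNIV. c x * \<psi> (a * x))"
    by (simp add: mult_char_cnj[OF c False])
  finally show ?thesis ..
qed

text \<open>A Parseval argument: the sum over all a of the squared modulus of sum_x c(x) psi(ax) is
  (q - 1) |G|^2 by the twisting formula, and (q - 1) q by orthogonality in a.\<close>

lemma gauss_sum_norm:
  assumes "nontrivial_char c"
  shows "gauss_sum c * cnj (gauss_sum c) = of_nat q"
proof -
  have c: "mult_char c"
    using assms by (rule nontrivial_charD)
  have cc: "c a * cnj (c a) = (if a = 0 then 0 else 1)" for a
    using mult_char_cnj[OF c, of a] mult_charD(1)[OF c] by simp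
  have q1: "q > 1"
    using card card_mono[of "UNIV :: 'a set" "{0, 1}"] by simp
  have tot: "(\<Sum>a\<in>UNIV. c a * cnj (c a)) = of_nat (q - 1)"
    unfolding cc by (simp add: sum.If_cases Compl_eq_Diff_UNIV card_Diff_subset card)
  have "of_nat (q - 1) * (gauss_sum c * cnj (gauss_sum c))
      = (\<Sum>a\<in>UNIV. (cnj (c a) * gauss_sum c) * cnj (cnj (c a) * gauss_sum c))"
    unfolding tot[symmetric] sum_distrib_right by (intro sum.cong) (simp_all add: mult_ac)
  also have "\<dots> = (\<Sum>a\<in>UNIV. (\<Sum>x\<in>UNIV. c x * \<psi> (a * x)) * (\<Sum>y\<in>UNIV. cnj (c y) * \<psi> (- (a * y))))"
    unfolding gauss_sum_twist[OF assms, symmetric] by (simp add: cnj_sum psi_cnj)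
  also have "\<dots> = (\<Sum>a\<in>UNIV. \<Sum>x\<in>UNIV. \<Sum>y\<in>UNIV. c x * cnj (c y) * \<psi> (a * (x - y)))"
    unfolding sum_product
    by (intro sum.cong refl) (simp add: ring_distribs psi_add mult_ac flip: add_uminus_conv_diff)
  also have "\<dots> = (\<Sum>x\<in>UNIV. \<Sum>y\<in>UNIV. \<Sum>a\<in>UNIV. c x * cnj (c y) * \<psi> (a * (x - y)))"
    by (subst sum.swap) (rule sum.cong[OF refl], rule sum.swap)
  also have "\<dots> = (\<Sum>x\<in>UNIV. \<Sum>y\<in>UNIV. if x = y then c x * cnj (c y) * of_nat q else 0)"
    unfolding sum_distrib_left[symmetric] psi_sum by (intro sum.cong refl) simp
  also have "\<dots> = (\<Sum>x\<in>UNIV. c x * cnj (c x)) * of_nat q"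
    by (simp add: sum_distrib_right)
  also have "\<dots> = of_nat (q - 1) * of_nat q"
    by (simp add: tot)
  finally show ?thesis
    using q1 by simp
qed

lemma gauss_sum_nonzero:
  assumes "nontrivial_char c"
  shows "gauss_sum c \<noteq> 0"
  using gauss_sum_norm[OF assms] q_def p by (auto simp: prime_gt_0_nat)

lemma gauss_sum_cnj:
  assumes "mult_char c"
  shows "gauss_sum (\<lambda>x. cnj (c x)) = c (-1) * cnj (gauss_sum c)"
proof -
  have bij: "bij (uminus :: 'a \<Rightarrow> 'a)"
    by (intro bij_betwI[where g = uminus]) auto
  have neg: "c (- x) = c (-1) * c x" for x
    using mult_charD(3)[OF assms, of "-1" x] by simp
  have real: "c (-1) * cnj (c (-1)) = 1"
    using mult_char_cnj[OF assms, of "-1"] by simp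
  have "cnj (gauss_sum c) = (\<Sum>x\<in>UNIV. cnj (c (- (- x))) * \<psi> (- x))"
    by (simp add: gauss_sum_def psi_cnj)
  also have "\<dots> = (\<Sum>x\<in>UNIV. cnj (c (- x)) * \<psi> x)"
    using sum.reindex_bij_betw[OF bij, of "\<lambda>x. cnj (c (- x)) * \<psi> x"] by simp
  also have "\<dots> = cnj (c (-1)) * gauss_sum (\<lambda>x. cnj (c x))"
    unfolding gauss_sum_def sum_distrib_left
    by (intro sum.cong refl, subst neg) (simp add: mult_ac)
  finally have "c (-1) * cnj (gauss_sum c) = c (-1) * cnj (c (-1)) * gauss_sum (\<lambda>x. cnj (c x))"
    by simp
  thus ?thesis
    by (simp add: real)
qed

lemma gauss_sum_frob:
  assumes "mult_char c"
  shows "gauss_sum (\<lambda>x. c x ^ p) = gauss_sum c"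
proof -
  have "gauss_sum c = (\<Sum>x\<in>UNIV. c (x ^ p) * \<psi> (x ^ p))"
    unfolding gauss_sum_def using sum.reindex_bij_betw[OF bij_frob, of "\<lambda>x. c x * \<psi> x"] by simp
  thus ?thesis
    by (simp add: gauss_sum_def psi_frob mult_char_power[OF assms])
qed

text \<open>Grouping the product by z = x + y leaves the convolution of c and d at z. For z not 0 it
  is rescaled to a Jacobi sum; at z = 0 it is a multiple of the complete sum of cd, which vanishes
  because cd is nontrivial.\<close>

lemma gauss_sum_mult:
  assumes c: "mult_char c" and d: "mult_char d" and cd: "nontrivial_char (\<lambda>x. c x * d x)"
  shows "gauss_sum c * gauss_sum d = jacobi_sum c d * gauss_sum (\<lambda>x. c x * d x)"
proof -
  have inner: "(\<Sum>x\<in>UNIV. c x * d (z - x)) = c z * d z * jacobi_sum c d" for z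
  proof (cases "z = 0")
    case True
    have neg: "d (- x) = d (-1) * d x" for x
      using mult_charD(3)[OF d, of "-1" x] by simp
    have "(\<Sum>x\<in>UNIV. c x * d (- x)) = d (-1) * (\<Sum>x\<in>UNIV. c x * d x)"
      unfolding sum_distrib_left by (intro sum.cong refl, subst neg) (simp add: mult_ac)
    thus ?thesis
      using True nontrivial_char_sum[OF cd] mult_charD(1)[OF c] by simp
  next
    case False
    have bij: "bij ((*) z)"
      using False by (intro bij_betwI[where g = "\<lambda>y. y / z"]) auto
    have "(\<Sum>x\<in>UNIV. c x * d (z - x)) = (\<Sum>x\<in>UNIV. c (z * x) * d (z - z * x))"
      using sum.reindex_bij_betw[OF bij, of "\<lambda>x. c x * d (z - x)"] by simp
    also have "\<dots> = (\<Sum>x\<in>UNIV. c (z * x) * d (z * (1 - x)))"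
      by (simp add: algebra_simps)
    also have "\<dots> = c z * d z * jacobi_sum c d"
      unfolding jacobi_sum_def sum_distrib_left
      by (simp add: mult_charD[OF c] mult_charD[OF d] mult_ac)
    finally show ?thesis .
  qed
  have "gauss_sum c * gauss_sum d = (\<Sum>x\<in>UNIV. \<Sum>y\<in>UNIV. c x * d y * \<psi> (x + y))"
    unfolding gauss_sum_def sum_product by (simp add: psi_add mult_ac)
  also have "\<dots> = (\<Sum>x\<in>UNIV. \<Sum>z\<in>UNIV. c x * d (z - x) * \<psi> z)"
  proof (rule sum.cong[OF refl])
    fix x :: 'a
    have bij: "bij (\<lambda>z. z - x)"
      by (intro bij_betwI[where g = "\<lambda>y. y + x"]) auto
    show "(\<Sum>y\<in>UNIV. c x * d y * \<psi> (x + y)) = (\<Sum>z\<in>UNIV. c x * d (z - x) * \<psi> z)"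
      using sum.reindex_bij_betw[OF bij, of "\<lambda>y. c x * d y * \<psi> (x + y)"] by simp
  qed
  also have "\<dots> = (\<Sum>z\<in>UNIV. (\<Sum>x\<in>UNIV. c x * d (z - x)) * \<psi> z)"
    unfolding sum_distrib_right by (rule sum.swap)
  also have "\<dots> = jacobi_sum c d * gauss_sum (\<lambda>x. c x * d x)"
    unfolding inner gauss_sum_def sum_distrib_left by (simp add: mult_ac)
  finally show ?thesis .
qed

end

section \<open>Characters of two-power order\<close>

locale two_power_char = additive_char p s q \<psi>
  for p s q :: nat and \<psi> :: "'a::{finite,field} \<Rightarrow> complex" +
  fixes m :: nat and g :: 'a
  assumes p8: "p mod 8 = 5" and m2: "m \<ge> 2"
    and dvd: "2 ^ m dvd q - 1" and ndvd: "\<not> 2 ^ (m + 1) dvd q - 1"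
    and g0: "g \<noteq> 0" and gen: "x \<noteq> 0 \<Longrightarrow> \<exists>i<q - 1. x = g ^ i"
begin

lemma q1: "q > 1"
  using card card_mono[of "UNIV :: 'a set" "{0, 1}"] by simp

lemma g_order: "g ^ (q - 1) = 1"
  using finite_field_power_card_minus_one[OF g0] card by simp

lemma inj_g: "inj_on (\<lambda>i. g ^ i) {..<q - 1}" and image_g: "(\<lambda>i. g ^ i) ` {..<q - 1} = -{0}"
proof -
  show img: "(\<lambda>i. g ^ i) ` {..<q - 1} = -{0}"
    using gen g0 by auto
  have "card ((\<lambda>i. g ^ i) ` {..<q - 1}) = card {..<q - 1}"
    unfolding img by (simp add: Compl_eq_Diff_UNIV card_Diff_subset card)
  thus "inj_on (\<lambda>i. g ^ i) {..<q - 1}"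
    by (intro eq_card_imp_inj_on) simp_all
qed

lemma g_pow_mod: "g ^ i = g ^ (i mod (q - 1))"
proof -
  have "g ^ i = g ^ ((q - 1) * (i div (q - 1)) + i mod (q - 1))" by simp
  thus ?thesis unfolding power_add power_mult g_order by simp
qed

lemma g_pow_eq_iff: "g ^ i = g ^ j \<longleftrightarrow> [i = j] (mod (q - 1))"
proof
  assume "g ^ i = g ^ j"
  hence "g ^ (i mod (q - 1)) = g ^ (j mod (q - 1))"
    using g_pow_mod by metis
  thus "[i = j] (mod (q - 1))"
    unfolding cong_def using inj_g q1 by (auto dest: inj_onD)
qed (metis g_pow_mod cong_def)

lemma sum_nonzero: "(\<Sum>x\<in>-{0}. f x) = (\<Sum>i<q - 1. f (g ^ i))"
  unfolding image_g[symmetric] sum.reindex[OF inj_g] o_def ..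

lemma sum_UNIV: "(\<Sum>x\<in>UNIV. f x) = f 0 + (\<Sum>i<q - 1. f (g ^ i))"
proof -
  have "(\<Sum>x\<in>UNIV. f x) = f 0 + (\<Sum>x\<in>UNIV - {0}. f x)"
    by (rule sum.remove) auto
  thus ?thesis by (simp add: sum_nonzero Compl_eq_Diff_UNIV[symmetric])
qed

definition \<zeta> :: complex where "\<zeta> = cis (2 * pi / real (2 ^ m))"

lemma zeta_pow_eq_1_iff: "\<zeta> ^ a = 1 \<longleftrightarrow> 2 ^ m dvd a"
  unfolding \<zeta>_def by (rule root_unity_power_eq_1_iff) simp

lemma zeta_pow_cong: "[a = b] (mod 2 ^ m) \<Longrightarrow> \<zeta> ^ a = \<zeta> ^ b"
proof -
  have *: "\<zeta> ^ a = \<zeta> ^ (a mod 2 ^ m)" for a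
  proof -
    have "\<zeta> ^ a = \<zeta> ^ (2 ^ m * (a div 2 ^ m) + a mod 2 ^ m)" by simp
    moreover have "\<zeta> ^ 2 ^ m = 1" by (simp add: zeta_pow_eq_1_iff)
    ultimately show ?thesis unfolding power_add power_mult by simp
  qed
  show "[a = b] (mod 2 ^ m) \<Longrightarrow> \<zeta> ^ a = \<zeta> ^ b"
    using *[of a] *[of b] by (simp add: cong_def)
qed

lemma zeta_pow_two_power:
  assumes "k \<le> m"
  shows "\<zeta> ^ 2 ^ (m - k) = cis (2 * pi / real (2 ^ k))"
proof -
  have "(2 :: real) ^ m = 2 ^ (m - k) * 2 ^ k"
    using assms by (simp add: power_add[symmetric])
  thus ?thesis
    by (simp add: \<zeta>_def DeMoivre field_simps)
qed

definition \<chi> :: "'a \<Rightarrow> complex" where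
  "\<chi> x = (if x = 0 then 0 else \<zeta> ^ (SOME i. x = g ^ i))"

lemma chi_0 [simp]: "\<chi> 0 = 0"
  by (simp add: \<chi>_def)

text \<open>Two exponents of the same element differ by a multiple of q - 1, hence of 2^m, so the
  arbitrary choice in \<open>\<chi>\<close> does not affect the power of
  \<open>\<zeta>\<close>.\<close>

lemma chi_g [simp]: "\<chi> (g ^ i) = \<zeta> ^ i"
proof -
  have "g ^ i = g ^ (SOME j. g ^ i = g ^ j)"
    by (rule someI[of _ i]) simp
  hence "[i = (SOME j. g ^ i = g ^ j)] (mod 2 ^ m)"
    using g_pow_eq_iff dvd cong_dvd_modulus_nat by blast
  thus ?thesis
    using g0 by (simp add: \<chi>_def zeta_pow_cong)
qed

lemma chi_mult: "\<chi> (x * y) = \<chi> x * \<chi> y"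
proof (cases "x = 0 \<or> y = 0")
  case False
  then obtain i j where "x = g ^ i" "y = g ^ j"
    using gen by blast
  thus ?thesis
    using chi_g[of "i + j"] by (simp add: power_add)
qed auto

lemma chi_1 [simp]: "\<chi> 1 = 1"
  using chi_g[of 0] by simp

lemma mult_char_chi_pow: "l \<ge> 1 \<Longrightarrow> mult_char (\<lambda>x. \<chi> x ^ l)"
  by (simp add: mult_char_def chi_mult power_mult_distrib)

lemma nontrivial_chi_pow:
  assumes "\<not> 2 ^ m dvd l"
  shows "nontrivial_char (\<lambda>x. \<chi> x ^ l)"
proof -
  have "l \<ge> 1" using assms by (cases l) auto
  moreover have "\<chi> g ^ l \<noteq> 1"
    using chi_g[of 1] assms by (simp add: zeta_pow_eq_1_iff)
  ultimately show ?thesis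
    using mult_char_chi_pow[of l] g0 unfolding nontrivial_char_def by blast
qed

lemma chi_pow_cong:
  assumes "[a = b] (mod 2 ^ m)" "a \<ge> 1" "b \<ge> 1"
  shows "\<chi> x ^ a = \<chi> x ^ b"
proof (cases "x = 0")
  case True
  thus ?thesis using assms by (simp add: power_0_left)
next
  case False
  then obtain i where "x = g ^ i" using gen by blast
  thus ?thesis
    using assms(1) by (simp add: power_mult[symmetric] zeta_pow_cong cong_scalar_left)
qed

lemma cnj_chi_pow:
  assumes "0 < l" "l < 2 ^ m"
  shows "cnj (\<chi> x ^ l) = \<chi> x ^ (2 ^ m - l)"
proof (cases "x = 0")
  case True
  thus ?thesis using assms by (simp add: power_0_left)
next
  case False
  have "\<chi> x ^ l * cnj (\<chi> x ^ l) = 1"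
    using mult_char_cnj(1)[OF mult_char_chi_pow[of l] False] assms by simp
  moreover have "\<chi> x ^ l * \<chi> x ^ (2 ^ m - l) = 1"
  proof -
    obtain i where "x = g ^ i" using False gen by blast
    thus ?thesis
      using assms by (simp add: power_add[symmetric] power_mult[symmetric] zeta_pow_eq_1_iff flip: distrib_left)
  qed
  ultimately have "\<chi> x ^ l * cnj (\<chi> x ^ l) = \<chi> x ^ l * \<chi> x ^ (2 ^ m - l)" by simp
  moreover have "\<chi> x ^ l \<noteq> 0" using False mult_char_norm[OF mult_char_chi_pow[of 1], of x] by auto
  ultimately show ?thesis by (metis mult_left_cancel)
qed

lemma minus_one_eq: "-1 = g ^ ((q - 1) div 2)" and even_q1: "even (q - 1)"
proof -
  show ev: "even (q - 1)"
    using dvd_trans[OF le_imp_power_dvd[of 1 m 2] dvd] m2 by simp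
  define h where "h = (q - 1) div 2"
  have h: "q - 1 = 2 * h" using ev by (simp add: h_def)
  have "(g ^ h)\<^sup>2 = 1"
    using g_order h by (simp add: power_mult[symmetric] mult.commute)
  moreover have "g ^ h \<noteq> 1"
  proof
    assume "g ^ h = 1"
    hence "[h = 0] (mod (q - 1))" using g_pow_eq_iff[of h 0] by simp
    hence "2 * h dvd h" using h by (simp add: cong_0_iff)
    thus False using q1 h by (auto dest: dvd_imp_le)
  qed
  ultimately show "-1 = g ^ ((q - 1) div 2)"
    by (simp add: h_def power2_eq_1_iff)
qed

lemma zeta_half: "\<zeta> ^ 2 ^ (m - 1) = -1"
  using zeta_pow_two_power[of 1] m2 by simp

text \<open>2^m is the exact power of 2 in q - 1, so the index (q - 1) / 2 of -1 is an odd multiple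
  of 2^(m-1).\<close>

lemma chi_minus_one: "\<chi> (-1) = -1"
proof -
  obtain o' where o': "q - 1 = 2 ^ m * o'" using dvd by blast
  have odd: "odd o'" using ndvd unfolding o' by auto
  have "(q - 1) div 2 = 2 ^ (m - 1) * o'"
    unfolding o' using m2 by (cases m) auto
  hence "\<chi> (-1) = (\<zeta> ^ 2 ^ (m - 1)) ^ o'"
    unfolding minus_one_eq chi_g by (simp add: power_mult)
  thus ?thesis unfolding zeta_half using odd by simp
qed

definition G :: "nat \<Rightarrow> complex" where "G l = gauss_sum (\<lambda>x. \<chi> x ^ l)"

lemma G_cong: "[a = b] (mod 2 ^ m) \<Longrightarrow> a \<ge> 1 \<Longrightarrow> b \<ge> 1 \<Longrightarrow> G a = G b"
  unfolding G_def using chi_pow_cong[of a b] by presburger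

lemma G_norm: "\<not> 2 ^ m dvd l \<Longrightarrow> G l * cnj (G l) = of_nat q"
  unfolding G_def by (intro gauss_sum_norm nontrivial_chi_pow)

lemma G_complement:
  assumes "0 < l" "l < 2 ^ m"
  shows "G (2 ^ m - l) = (-1) ^ l * cnj (G l)"
  using gauss_sum_cnj[OF mult_char_chi_pow[of l]] assms
  by (simp add: G_def cnj_chi_pow[OF assms] chi_minus_one del: complex_cnj_power)

lemma G_frob: "l \<ge> 1 \<Longrightarrow> G (l * p ^ t) = G l"
proof (induction t)
  case (Suc t)
  have "l * p ^ t \<ge> 1" using Suc.prems p by (simp add: Suc_leI prime_gt_0_nat)
  from gauss_sum_frob[OF mult_char_chi_pow[OF this]]
  have "G (l * p ^ t * p) = G (l * p ^ t)"
    by (simp add: G_def power_mult[symmetric])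
  thus ?case using Suc by (simp add: mult_ac)
qed simp

text \<open>Frobenius makes the Gauss sum of a character of order \<open>2 ^ k\<close> depend only on the residue
  modulo 4 of its index, because \<open>p\<close> generates the residues congruent to 1 modulo 4.\<close>

lemma G_one_mod_four:
  assumes "2 \<le> k" "k \<le> m" "l mod 4 = 1"
  shows "G (2 ^ (m - k) * l) = G (2 ^ (m - k))"
proof -
  obtain t where "[p ^ t = l] (mod 2 ^ (k - 2 + 2))"
    using one_mod_four_eq_power_cong[OF p8 assms(3)] by blast
  hence "[p ^ t = l] (mod 2 ^ k)" using assms(1) by (simp only: le_add_diff_inverse2)
  hence "[2 ^ (m - k) * p ^ t = 2 ^ (m - k) * l] (mod 2 ^ (m - k) * 2 ^ k)"
    by (rule cong_cmult_leftI)
  hence c: "[2 ^ (m - k) * p ^ t = 2 ^ (m - k) * l] (mod 2 ^ m)"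
    using assms by (simp add: power_add[symmetric])
  have "l \<ge> 1" using assms by (cases l) auto
  hence "G (2 ^ (m - k) * l) = G (2 ^ (m - k) * p ^ t)"
    using p by (intro G_cong cong_sym[OF c]) (auto simp: Suc_leI prime_gt_0_nat)
  thus ?thesis by (simp add: G_frob)
qed

text \<open>The complementary index 2^k - l is 1 modulo 4, so this is the conjugate of the preceding
  case. The sign is -1 raised to the index 2^(m-k) l', which is odd only for k = m.\<close>

lemma G_three_mod_four:
  assumes k: "2 \<le> k" "k \<le> m" and l: "l mod 4 = 3" "l < 2 ^ k"
  shows "G (2 ^ (m - k) * l) = (if k = m then -1 else 1) * cnj (G (2 ^ (m - k)))"
proof -
  define l' where "l' = 2 ^ k - l"
  have "4 dvd (2::nat) ^ k" using le_imp_power_dvd[of 2 k "2::nat"] k(1) by simp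
  then obtain v where v: "(2::nat) ^ k = 4 * v" by blast
  have l4: "l = 4 * (l div 4) + 3" using l(1) by (metis mult_div_mod_eq)
  have "l' = 4 * (v - l div 4 - 1) + 1"
    using l(2) l4 unfolding l'_def v by linarith
  hence "l' mod 4 = 1" by (simp only: mod_mult_self4) simp
  moreover have "0 < l'" "l' < 2 ^ k" using l l4 by (simp_all add: l'_def)
  ultimately have l': "l' mod 4 = 1" "0 < l'" "l' < 2 ^ k" by blast+
  have pw: "(2::nat) ^ m = 2 ^ (m - k) * 2 ^ k" using k by (simp add: power_add[symmetric])
  have "l = 2 ^ k - l'" using l by (simp add: l'_def)
  hence eq: "2 ^ (m - k) * l = 2 ^ m - 2 ^ (m - k) * l'"
    by (simp only: pw diff_mult_distrib2)
  have "0 < 2 ^ (m - k) * l'" "2 ^ (m - k) * l' < 2 ^ m"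
    using l' by (simp_all add: pw)
  from G_complement[OF this] eq
  have "G (2 ^ (m - k) * l) = (-1) ^ (2 ^ (m - k) * l') * cnj (G (2 ^ (m - k) * l'))"
    by simp
  also have "G (2 ^ (m - k) * l') = G (2 ^ (m - k))"
    by (rule G_one_mod_four[OF k l'(1)])
  also have "(-1 :: complex) ^ (2 ^ (m - k) * l') = (if k = m then -1 else 1)"
  proof (cases "k = m")
    case True
    have "odd l'" using l'(1) by presburger
    thus ?thesis using True by simp
  next
    case False
    hence "even (2 ^ (m - k) * l')" using k by simp
    thus ?thesis using False by simp
  qed
  finally show ?thesis .
qed

text \<open>For u not 0 the bracket is the number of solutions of x^(2^k) = u. The trivial character
  is written as the separate 1, so u = 0 is counted exactly once too.\<close>

lemma sum_two_power:
  fixes h :: "'a \<Rightarrow> complex"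
  assumes k: "k \<le> m"
  shows "(\<Sum>x\<in>UNIV. h (x ^ 2 ^ k))
       = (\<Sum>u\<in>UNIV. h u * (1 + (\<Sum>l = 1..<2 ^ k. \<chi> u ^ (2 ^ (m - k) * l))))"
proof -
  define K :: nat where "K = 2 ^ k"
  define w where "w = \<zeta> ^ 2 ^ (m - k)"
  have K0: "K > 0" by (simp add: K_def)
  have "K dvd q - 1"
    using dvd k le_imp_power_dvd[of k m "2::nat"] by (auto simp: K_def intro: dvd_trans)
  then obtain M where M: "q - 1 = K * M" by blast
  have w1: "w ^ a = 1 \<longleftrightarrow> K dvd a" for a
    unfolding w_def zeta_pow_two_power[OF k] K_def by (rule root_unity_power_eq_1_iff) simp
  have inner: "1 + (\<Sum>l = 1..<K. \<chi> (g ^ i) ^ (2 ^ (m - k) * l)) = (if K dvd i then of_nat K else 0)" for i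
  proof -
    have "1 + (\<Sum>l = 1..<K. \<chi> (g ^ i) ^ (2 ^ (m - k) * l)) = 1 + (\<Sum>l = 1..<K. (w ^ i) ^ l)"
      by (simp add: w_def power_mult[symmetric] mult_ac)
    also have "\<dots> = (\<Sum>l<K. (w ^ i) ^ l)"
      using K0 by (simp add: lessThan_atLeast0 sum.atLeast_Suc_lessThan)
    also have "\<dots> = (if w ^ i = 1 then of_nat K else 0)"
      by (rule geometric_sum_root_unity) (simp add: power_mult[symmetric] w1)
    finally show ?thesis by (simp add: w1)
  qed
  have "(\<Sum>x\<in>UNIV. h (x ^ K)) = h 0 + (\<Sum>i<K * M. h ((g ^ i) ^ K))"
    using K0 by (simp only: sum_UNIV M) (simp add: power_0_left)
  also have "(\<Sum>i<K * M. h ((g ^ i) ^ K)) = of_nat K * (\<Sum>j<M. h ((g ^ j) ^ K))"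
  proof (rule sum_periodic)
    fix i
    have "(g ^ (i + M)) ^ K = (g ^ i) ^ K * g ^ (q - 1)"
      unfolding M by (simp add: power_mult[symmetric] power_add[symmetric] algebra_simps)
    thus "h ((g ^ (i + M)) ^ K) = h ((g ^ i) ^ K)" unfolding g_order by simp
  qed
  also have "\<dots> = (\<Sum>j<M. h (g ^ (K * j)) * of_nat K)"
    by (simp add: sum_distrib_left power_mult[symmetric] mult_ac)
  also have "\<dots> = (\<Sum>i<K * M. if K dvd i then h (g ^ i) * of_nat K else 0)"
    by (rule sum_multiples[OF K0, symmetric])
  also have "\<dots> = (\<Sum>i<q - 1. h (g ^ i) * (1 + (\<Sum>l = 1..<K. \<chi> (g ^ i) ^ (2 ^ (m - k) * l))))"
    unfolding inner M by (intro sum.cong) auto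
  also have "h 0 + \<dots> = (\<Sum>u\<in>UNIV. h u * (1 + (\<Sum>l = 1..<K. \<chi> u ^ (2 ^ (m - k) * l))))"
    unfolding sum_UNIV by (simp add: power_0_left)
  finally show ?thesis by (simp add: K_def)
qed

text \<open>With x = 0 included, this is 1 + 2^m times the classical Gaussian period of the coset of
  g^j modulo 2^m-th powers.\<close>

definition period :: "nat \<Rightarrow> complex" where
  "period j = (\<Sum>x\<in>UNIV. \<psi> (g ^ j * x ^ 2 ^ m))"

lemma period_eq: "period j = (\<Sum>l = 1..<2 ^ m. cnj \<zeta> ^ (j * l) * G l)"
proof -
  have "period j = (\<Sum>u\<in>UNIV. \<psi> (g ^ j * u) * (1 + (\<Sum>l = 1..<2 ^ m. \<chi> u ^ l)))"
    unfolding period_def using sum_two_power[of m "\<lambda>u. \<psi> (g ^ j * u)"] by simp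
  also have "\<dots> = (\<Sum>u\<in>UNIV. \<psi> (g ^ j * u)) + (\<Sum>u\<in>UNIV. \<Sum>l = 1..<2 ^ m. \<chi> u ^ l * \<psi> (g ^ j * u))"
    by (simp add: distrib_left sum.distrib sum_distrib_left mult_ac)
  also have "(\<Sum>u\<in>UNIV. \<psi> (g ^ j * u)) = 0"
    using psi_sum[of "g ^ j"] g0 by (simp add: mult.commute)
  also have "(\<Sum>u\<in>UNIV. \<Sum>l = 1..<2 ^ m. \<chi> u ^ l * \<psi> (g ^ j * u))
      = (\<Sum>l = 1..<2 ^ m. \<Sum>u\<in>UNIV. \<chi> u ^ l * \<psi> (g ^ j * u))"
    by (rule sum.swap)
  also have "\<dots> = (\<Sum>l = 1..<2 ^ m. cnj \<zeta> ^ (j * l) * G l)"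
  proof (intro sum.cong refl)
    fix l :: nat assume "l \<in> {1..<2 ^ m}"
    hence "\<not> 2 ^ m dvd l" by (auto dest: dvd_imp_le)
    from gauss_sum_twist[OF nontrivial_chi_pow[OF this], of "g ^ j"]
    show "(\<Sum>u\<in>UNIV. \<chi> u ^ l * \<psi> (g ^ j * u)) = cnj \<zeta> ^ (j * l) * G l"
      by (simp add: G_def power_mult)
  qed
  finally show ?thesis by simp
qed

text \<open>Orthogonality of \<open>\<psi>\<close> detects the equation, and the sum over all lists
  factors into an n-th power for each coefficient a. The coefficient 0 gives q^n. For a = g^i the
  factor depends only on i modulo 2^m, so each period occurs (q - 1) / 2^m times.\<close>

lemma num_zeros_eq:
  assumes "n \<ge> 1"
  shows "of_nat (card {xs :: 'a list. length xs = n \<and> (\<Sum>x\<leftarrow>xs. x ^ 2 ^ m) = 0})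
       = of_nat q ^ (n - 1) + (of_nat q - 1) / (2 ^ m * of_nat q) * (\<Sum>j<2 ^ m. period j ^ n)"
proof -
  define A where "A = {xs :: 'a list. length xs = n}"
  define B where "B = {xs :: 'a list. length xs = n \<and> (\<Sum>x\<leftarrow>xs. x ^ 2 ^ m) = 0}"
  define S where "S = (\<lambda>a. \<Sum>x\<in>UNIV. \<psi> (a * x ^ 2 ^ m))"
  have finA: "finite A"
    using finite_lists_length_eq[of "UNIV :: 'a set" n] by (simp add: A_def)
  have BA: "B = {xs \<in> A. (\<Sum>x\<leftarrow>xs. x ^ 2 ^ m) = 0}"
    by (auto simp: A_def B_def)
  have "of_nat q * of_nat (card B) = (\<Sum>xs\<in>A. if (\<Sum>x\<leftarrow>xs. x ^ 2 ^ m) = 0 then of_nat q else (0 :: complex))"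
    using finA by (simp add: BA sum.inter_filter[symmetric])
  also have "\<dots> = (\<Sum>xs\<in>A. \<Sum>a\<in>UNIV. \<psi> (a * (\<Sum>x\<leftarrow>xs. x ^ 2 ^ m)))"
    by (simp add: psi_sum)
  also have "\<dots> = (\<Sum>xs\<in>A. \<Sum>a\<in>UNIV. prod_list (map (\<lambda>x. \<psi> (a * x ^ 2 ^ m)) xs))"
    by (simp add: psi_sum_list flip: sum_list_const_mult)
  also have "\<dots> = (\<Sum>a\<in>UNIV. \<Sum>xs\<in>A. prod_list (map (\<lambda>x. \<psi> (a * x ^ 2 ^ m)) xs))"
    by (rule sum.swap)
  also have "\<dots> = (\<Sum>a\<in>UNIV. S a ^ n)"
    unfolding A_def S_def sum_prod_list_length ..
  also have "\<dots> = S 0 ^ n + (\<Sum>i<q - 1. period i ^ n)"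
    unfolding sum_UNIV by (simp add: S_def period_def)
  also have "S 0 = of_nat q"
    by (simp add: S_def psi_zero card)
  also have "(\<Sum>i<q - 1. period i ^ n) = of_nat ((q - 1) div 2 ^ m) * (\<Sum>j<2 ^ m. period j ^ n)"
  proof -
    have eq: "q - 1 = (q - 1) div 2 ^ m * 2 ^ m" using dvd by simp
    have per: "period (i + 2 ^ m) = period i" for i
    proof -
      have "cnj \<zeta> ^ ((i + 2 ^ m) * l) = cnj \<zeta> ^ (i * l)" for l
      proof -
        have "\<zeta> ^ ((i + 2 ^ m) * l) = \<zeta> ^ (i * l)"
          by (intro zeta_pow_cong) (simp add: cong_def algebra_simps)
        thus ?thesis by (metis complex_cnj_power)
      qed
      thus ?thesis by (simp add: period_eq)
    qed
    show ?thesis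
      by (subst eq, rule sum_periodic) (simp add: per)
  qed
  finally have *: "of_nat q * of_nat (card B) = of_nat q ^ n + of_nat ((q - 1) div 2 ^ m) * (\<Sum>j<2 ^ m. period j ^ n)" .
  have c: "of_nat ((q - 1) div 2 ^ m) = (of_nat q - 1 :: complex) / 2 ^ m"
  proof -
    have "(of_nat (q - 1) :: complex) = of_nat ((q - 1) div 2 ^ m * 2 ^ m)" using dvd by simp
    thus ?thesis using q1 by (simp add: of_nat_diff)
  qed
  have qn: "(of_nat q :: complex) ^ n = of_nat q * of_nat q ^ (n - 1)"
    using assms by (cases n) auto
  have "of_nat (card B) = (of_nat q * of_nat (card B)) / (of_nat q :: complex)"
    using q1 by simp
  also have "\<dots> = of_nat q ^ (n - 1) + (of_nat q - 1) / (2 ^ m * of_nat q) * (\<Sum>j<2 ^ m. period j ^ n)"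
    unfolding * c qn using q1 by (simp add: add_divide_distrib)
  finally show ?thesis unfolding B_def .
qed

section \<open>Splitting the periods by the order of the characters\<close>

lemma cnj_zeta_pow_eq_1_iff:
  assumes "k \<le> m"
  shows "(cnj \<zeta> ^ 2 ^ (m - k)) ^ a = 1 \<longleftrightarrow> 2 ^ k dvd a"
proof -
  have "(cnj \<zeta> ^ 2 ^ (m - k)) ^ a = cnj ((\<zeta> ^ 2 ^ (m - k)) ^ a)" by simp
  also have "\<dots> = 1 \<longleftrightarrow> (\<zeta> ^ 2 ^ (m - k)) ^ a = 1"
    by (metis complex_cnj_cnj complex_cnj_one)
  also have "\<dots> \<longleftrightarrow> 2 ^ k dvd a"
    unfolding zeta_pow_two_power[OF assms] by (rule root_unity_power_eq_1_iff) simp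
  finally show ?thesis .
qed

lemma cnj_zeta_quarter: "cnj \<zeta> ^ 2 ^ (m - 2) = - \<i>"
proof -
  have "cnj \<zeta> ^ 2 ^ (m - 2) = cnj (\<zeta> ^ 2 ^ (m - 2))" by simp
  also have "\<dots> = cnj (cis (pi / 2))" using zeta_pow_two_power[OF m2] by (simp add: field_simps)
  finally show ?thesis by simp
qed

lemma cnj_zeta_half: "cnj \<zeta> ^ 2 ^ (m - 1) = - 1"
  using arg_cong[OF zeta_half, of cnj] by simp

text \<open>The closed form of the share of \<open>period_eq\<close> that belongs to the characters
  of exact order 2^k. They have only two Gauss sums, \<open>G (2 ^ (m - k))\<close> and its
  conjugate up to sign, and the roots of unity in front of them cancel unless 2^(k-2) divides
  j.\<close>

definition order_part :: "nat \<Rightarrow> nat \<Rightarrow> complex" where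
  "order_part k j = (if 2 ^ (k - 2) dvd j then
     let w = (- \<i>) ^ (j div 2 ^ (k - 2)) * G (2 ^ (m - k))
     in 2 ^ (k - 2) * (w + (if k = m then -1 else 1) * cnj w) else 0)"

text \<open>On the indices in a fixed odd class modulo 4 the Gauss sum is constant, so a geometric
  sum of ratio z^(4j) remains, where z is a primitive 2^k-th root of unity. It vanishes unless
  2^(k-2) divides j, and then z^(2^(k-2)) = -i produces the powers of -i.\<close>

lemma sum_odd_multiples:
  assumes k: "2 \<le> k" "k \<le> m"
  shows "(\<Sum>l<2 ^ (k - 1). cnj \<zeta> ^ (j * (2 ^ (m - k) * (2 * l + 1))) * G (2 ^ (m - k) * (2 * l + 1)))
       = order_part k j"
proof -
  define z where "z = cnj \<zeta> ^ 2 ^ (m - k)"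
  define e :: complex where "e = (if k = m then -1 else 1)"
  define Gk where "Gk = G (2 ^ (m - k))"
  define n :: nat where "n = 2 ^ (k - 2)"
  have k4: "2 ^ k = 4 * n" and k2: "2 ^ (k - 1) = 2 * n"
  proof -
    obtain r where "k = r + 2" using k(1) by (metis le_add_diff_inverse2)
    thus "2 ^ k = 4 * n" "2 ^ (k - 1) = 2 * n" by (simp_all add: n_def)
  qed
  have "(\<Sum>l<2 ^ (k - 1). cnj \<zeta> ^ (j * (2 ^ (m - k) * (2 * l + 1))) * G (2 ^ (m - k) * (2 * l + 1)))
      = (\<Sum>l<2 * n. z ^ (j * (2 * l + 1)) * G (2 ^ (m - k) * (2 * l + 1)))"
    unfolding k2 by (simp only: z_def power_mult[symmetric] mult_ac)
  also have "\<dots> = (\<Sum>u<n. z ^ (j * (2 * (2 * u) + 1)) * G (2 ^ (m - k) * (2 * (2 * u) + 1)))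
      + (\<Sum>u<n. z ^ (j * (2 * (2 * u + 1) + 1)) * G (2 ^ (m - k) * (2 * (2 * u + 1) + 1)))"
    by (rule sum_even_odd)
  also have "(\<Sum>u<n. z ^ (j * (2 * (2 * u) + 1)) * G (2 ^ (m - k) * (2 * (2 * u) + 1)))
      = (\<Sum>u<n. (z ^ (4 * j)) ^ u * (z ^ j * Gk))"
  proof (rule sum.cong[OF refl])
    fix u assume "u \<in> {..<n}"
    have "(2 * (2 * u) + 1) mod 4 = 1" by presburger
    hence "G (2 ^ (m - k) * (2 * (2 * u) + 1)) = Gk"
      unfolding Gk_def by (rule G_one_mod_four[OF k])
    moreover have "z ^ (j * (2 * (2 * u) + 1)) = (z ^ (4 * j)) ^ u * z ^ j"
      unfolding power_mult[symmetric] power_add[symmetric] by (rule arg_cong[where f = "(^) z"]) (simp add: algebra_simps)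
    ultimately show "z ^ (j * (2 * (2 * u) + 1)) * G (2 ^ (m - k) * (2 * (2 * u) + 1)) = (z ^ (4 * j)) ^ u * (z ^ j * Gk)"
      by simp
  qed
  also have "(\<Sum>u<n. z ^ (j * (2 * (2 * u + 1) + 1)) * G (2 ^ (m - k) * (2 * (2 * u + 1) + 1)))
      = (\<Sum>u<n. (z ^ (4 * j)) ^ u * (z ^ (3 * j) * (e * cnj Gk)))"
  proof (rule sum.cong[OF refl])
    fix u assume u: "u \<in> {..<n}"
    have "(2 * (2 * u + 1) + 1) mod 4 = 3" by presburger
    moreover have "2 * (2 * u + 1) + 1 < 2 ^ k" using u unfolding k4 by simp
    ultimately have "G (2 ^ (m - k) * (2 * (2 * u + 1) + 1)) = e * cnj Gk"
      unfolding e_def Gk_def by (rule G_three_mod_four[OF k])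
    moreover have "z ^ (j * (2 * (2 * u + 1) + 1)) = (z ^ (4 * j)) ^ u * z ^ (3 * j)"
      unfolding power_mult[symmetric] power_add[symmetric] by (rule arg_cong[where f = "(^) z"]) (simp add: algebra_simps)
    ultimately show "z ^ (j * (2 * (2 * u + 1) + 1)) * G (2 ^ (m - k) * (2 * (2 * u + 1) + 1))
        = (z ^ (4 * j)) ^ u * (z ^ (3 * j) * (e * cnj Gk))"
      by simp
  qed
  also have "(\<Sum>u<n. (z ^ (4 * j)) ^ u * (z ^ j * Gk)) + (\<Sum>u<n. (z ^ (4 * j)) ^ u * (z ^ (3 * j) * (e * cnj Gk)))
      = (\<Sum>u<n. (z ^ (4 * j)) ^ u) * (z ^ j * Gk + z ^ (3 * j) * (e * cnj Gk))"
    by (simp add: sum_distrib_right distrib_left)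
  also have "(\<Sum>u<n. (z ^ (4 * j)) ^ u) = (if z ^ (4 * j) = 1 then of_nat n else 0)"
  proof (rule geometric_sum_root_unity)
    have "(z ^ (4 * j)) ^ n = z ^ (4 * j * n)" by (rule power_mult[symmetric])
    also have "\<dots> = 1" unfolding z_def cnj_zeta_pow_eq_1_iff[OF k(2)] k4 by simp
    finally show "(z ^ (4 * j)) ^ n = 1" .
  qed
  also have "z ^ (4 * j) = 1 \<longleftrightarrow> n dvd j"
    unfolding z_def cnj_zeta_pow_eq_1_iff[OF k(2)] k4 by simp
  also have "(if n dvd j then of_nat n else 0) * (z ^ j * Gk + z ^ (3 * j) * (e * cnj Gk)) = order_part k j"
  proof (cases "n dvd j")
    case True
    then obtain j' where j': "j = n * j'" by blast
    have n0: "n > 0" by (simp add: n_def)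
    have "z ^ n = cnj \<zeta> ^ 2 ^ (m - 2)"
      unfolding z_def n_def power_mult[symmetric] power_add[symmetric] using k by simp
    hence zn: "z ^ n = - \<i>" by (simp add: cnj_zeta_quarter)
    have zj: "z ^ j = (- \<i>) ^ j'" by (simp add: j' power_mult zn)
    have "z ^ (3 * j) = ((z ^ n) ^ 3) ^ j'" by (simp add: j' power_mult[symmetric] mult_ac)
    also have "\<dots> = \<i> ^ j'" unfolding zn by (simp add: power3_eq_cube)
    finally have z3: "z ^ (3 * j) = cnj ((- \<i>) ^ j')" by simp
    show ?thesis
      using True n0 unfolding order_part_def n_def[symmetric] e_def[symmetric] Gk_def[symmetric] zj z3
      by (simp add: j' Let_def n_def mult_ac)
  next
    case False
    thus ?thesis by (simp add: order_part_def n_def)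
  qed
  finally show ?thesis .
qed

lemma period_decomp: "period j = (-1) ^ j * G (2 ^ (m - 1)) + (\<Sum>k = 2..m. order_part k j)"
proof -
  \<comment> \<open>\<open>F\<close> is 0 at 0 because the trivial character is absent from
    \<open>period_eq\<close>. \<open>T k\<close> then collects the nontrivial characters of order
    dividing 2^k.\<close>
  define F where "F = (\<lambda>l. if l = 0 then 0 else cnj \<zeta> ^ (j * l) * G l)"
  define T where "T = (\<lambda>k. \<Sum>l<2 ^ k. F (2 ^ (m - k) * l))"
  have T1: "T 1 = (-1) ^ j * G (2 ^ (m - 1))"
  proof -
    have "{..<2::nat} = {0, 1}" by auto
    hence "T 1 = cnj \<zeta> ^ (j * 2 ^ (m - 1)) * G (2 ^ (m - 1))"
      by (simp add: T_def F_def)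
    thus ?thesis unfolding mult.commute[of j] power_mult cnj_zeta_half .
  qed
  have step: "T (Suc k) = T k + order_part (Suc k) j" if k: "1 \<le> k" "Suc k \<le> m" for k
  proof -
    have pw: "2 ^ (m - Suc k) * (2 * l) = 2 ^ (m - k) * l" for l :: nat
      using k by (simp add: Suc_diff_Suc[symmetric])
    have "T (Suc k) = (\<Sum>l<2 * 2 ^ k. F (2 ^ (m - Suc k) * l))" by (simp add: T_def)
    also have "\<dots> = (\<Sum>l<2 ^ k. F (2 ^ (m - Suc k) * (2 * l))) + (\<Sum>l<2 ^ k. F (2 ^ (m - Suc k) * (2 * l + 1)))"
      by (rule sum_even_odd)
    also have "(\<Sum>l<2 ^ k. F (2 ^ (m - Suc k) * (2 * l))) = T k"
      unfolding pw T_def ..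
    also have "(\<Sum>l<2 ^ k. F (2 ^ (m - Suc k) * (2 * l + 1))) = order_part (Suc k) j"
      using sum_odd_multiples[of "Suc k" j] k by (simp add: F_def)
    finally show ?thesis .
  qed
  have "T k = (-1) ^ j * G (2 ^ (m - 1)) + (\<Sum>k = 2..k. order_part k j)" if "1 \<le> k" "k \<le> m" for k
    using that
  proof (induction k rule: dec_induct)
    case base
    thus ?case using T1 by simp
  next
    case (step k)
    thus ?case using \<open>\<And>k. 1 \<le> k \<Longrightarrow> Suc k \<le> m \<Longrightarrow> T (Suc k) = T k + order_part (Suc k) j\<close>[of k]
      by (simp add: add.assoc)
  qed
  from this[of m] have "T m = (-1) ^ j * G (2 ^ (m - 1)) + (\<Sum>k = 2..m. order_part k j)"
    using m2 by simp
  moreover have "T m = period j"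
  proof -
    have "T m = F 0 + (\<Sum>l = 1..<2 ^ m. F l)"
      by (simp add: T_def lessThan_atLeast0 sum.atLeast_Suc_lessThan)
    also have "\<dots> = period j"
      unfolding period_eq by (simp add: F_def)
    finally show ?thesis .
  qed
  ultimately show ?thesis by simp
qed

section \<open>The quadratic character, duplication, and the recursion between orders\<close>

lemma odd_p: "odd p"
  using p8 by presburger

lemma p_mod_4: "p mod 4 = 1"
  using p8 by presburger

lemma two_nonzero: "(2 :: 'a) \<noteq> 0"
proof
  assume "(2 :: 'a) = 0"
  hence "of_nat 2 = (0 :: 'a)" by simp
  hence "p dvd 2" using of_nat_eq_0_iff_char_dvd[of 2, where 'a = 'a] CHAR by simp
  thus False using p odd_p by (metis primes_dvd_imp_eq two_is_prime_nat even_numeral)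
qed

lemma q1_four: "4 dvd q - 1"
  using dvd le_imp_power_dvd[OF m2, of "2::nat"] by (auto intro: dvd_trans)

text \<open>The fact behind this is that 2 is a nonresidue modulo p, in the form 4^t = -1 with t =
  (p - 1) / 4 odd. Frobenius fixes a square root I of -1, so (1 + I)^(4t) = 1, while (1 + I)^4 = -4.
  As t is odd, it can be cancelled from exponents of 2^m-th roots of unity.\<close>

lemma chi_four: "\<chi> 4 = -1"
proof -
  obtain M where M: "q - 1 = 4 * M" using q1_four by blast
  define I where "I = g ^ M"
  have "I\<^sup>2 = g ^ ((q - 1) div 2)"
    unfolding I_def M by (simp add: power_mult[symmetric] mult.commute)
  hence I2: "I\<^sup>2 = -1" using minus_one_eq by simp
  have I4: "I ^ 4 = 1"
  proof -
    have "I ^ 4 = (I\<^sup>2)\<^sup>2" by (simp add: power_mult[symmetric])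
    thus ?thesis by (simp add: I2)
  qed
  define t where "t = (p - 1) div 4"
  have pt: "p = 4 * t + 1" using p_mod_4 unfolding t_def by presburger
  have todd: "odd t" using p8 pt by presburger
  have "(1 + I) ^ p = 1 + I ^ p"
    using frob_add[of 1 I 1] by simp
  also have "I ^ p = I" unfolding pt power_add power_mult I4 by simp
  finally have "(1 + I) ^ (4 * t) * (1 + I) = 1 * (1 + I)"
    unfolding pt by (simp add: power_add)
  moreover have "1 + I \<noteq> 0"
  proof
    assume "1 + I = 0"
    hence "I = -1" by (simp add: eq_neg_iff_add_eq_0 add.commute)
    hence "(1 :: 'a) = -1" using I2 by simp
    hence "(2 :: 'a) = 0" by (simp add: eq_neg_iff_add_eq_0)
    thus False using two_nonzero by simp
  qed
  ultimately have "(1 + I) ^ (4 * t) = 1" by (metis mult_right_cancel)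
  moreover have "(1 + I) ^ 4 = - 4"
  proof -
    have "(1 + I)\<^sup>2 = 2 * I" using I2 by (simp add: power2_sum)
    hence "((1 + I)\<^sup>2)\<^sup>2 = 4 * I\<^sup>2" by (simp add: power_mult_distrib)
    thus ?thesis by (simp add: I2 power_mult[symmetric])
  qed
  ultimately have "(- 4 :: 'a) ^ t = 1" by (simp add: power_mult)
  hence "(4 :: 'a) ^ t = -1" using todd by (simp add: minus_equation_iff)
  hence y: "\<chi> 4 ^ t = -1"
    using mult_char_power[OF mult_char_chi_pow[of 1], of 4 t] chi_minus_one by simp
  have "(4 :: 'a) \<noteq> 0" using two_nonzero by (metis mult_2 no_zero_divisors numeral_Bit0 numeral_code(2) mult_2_right)
  then obtain a where "(4 :: 'a) = g ^ a" using gen by blast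
  hence a: "\<chi> 4 = \<zeta> ^ a" by (simp only: chi_g)
  have "\<zeta> ^ (2 * a * t) = (\<chi> 4 ^ t)\<^sup>2" by (simp add: a power_mult[symmetric] mult_ac)
  also have "\<dots> = 1" unfolding y by simp
  finally have "2 ^ m dvd 2 * a * t" by (simp only: zeta_pow_eq_1_iff)
  moreover have "coprime (2 ^ m) t" using todd by simp
  ultimately have "2 ^ m dvd 2 * a" by (simp add: coprime_dvd_mult_left_iff)
  hence "(\<chi> 4)\<^sup>2 = 1" unfolding a power_mult[symmetric] zeta_pow_eq_1_iff by (simp add: mult.commute)
  hence "\<chi> 4 = 1 \<or> \<chi> 4 = -1" by (simp add: power2_eq_1_iff)
  thus ?thesis using y by auto
qed

definition \<phi> :: "'a \<Rightarrow> complex" where "\<phi> x = \<chi> x ^ 2 ^ (m - 1)"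

lemma phi_0 [simp]: "\<phi> 0 = 0"
  by (simp add: \<phi>_def)

lemma phi_g: "\<phi> (g ^ i) = (-1) ^ i"
proof -
  have "\<phi> (g ^ i) = (\<zeta> ^ 2 ^ (m - 1)) ^ i"
    unfolding \<phi>_def chi_g by (simp add: power_mult[symmetric] mult.commute)
  thus ?thesis unfolding zeta_half .
qed

lemma not_dvd_two_power: "k \<ge> 1 \<Longrightarrow> k \<le> m \<Longrightarrow> \<not> 2 ^ m dvd (2 ^ (m - k) :: nat)"
  by (auto simp: nat_dvd_not_less dest: dvd_imp_le intro!: power_strict_increasing)

lemma nontrivial_phi: "nontrivial_char \<phi>"
proof -
  have "\<phi> = (\<lambda>x. \<chi> x ^ 2 ^ (m - 1))" by (simp add: \<phi>_def fun_eq_iff)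
  thus ?thesis using nontrivial_chi_pow[OF not_dvd_two_power[of 1]] m2 by simp
qed

lemma phi_mult: "\<phi> (x * y) = \<phi> x * \<phi> y"
  using mult_charD(3)[OF nontrivial_charD[OF nontrivial_phi]] .

lemma phi_minus_one: "\<phi> (-1) = 1"
  unfolding \<phi>_def chi_minus_one using m2 by simp

lemma phi_cases: "x \<noteq> 0 \<Longrightarrow> \<phi> x = 1 \<or> \<phi> x = -1"
  using gen[of x] phi_g by (metis neg_one_even_power neg_one_odd_power)

lemma sum_square: "(\<Sum>x\<in>UNIV. h (x\<^sup>2)) = (\<Sum>u\<in>UNIV. h u * (1 + \<phi> u))" for h :: "'a \<Rightarrow> complex"
proof -
  have "{1..<2::nat} = {1}" by auto
  thus ?thesis using sum_two_power[of 1 h] m2 by (simp add: \<phi>_def)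
qed

text \<open>This is the duplication formula in terms of Jacobi sums. Since 1 + \<open>\<phi>\<close>
  counts square roots, the left side is the sum of c(1 - x^2), and x = 1 - 2t turns 1 - x^2 into
  4t(1 - t).\<close>

lemma jacobi_sum_phi:
  assumes "nontrivial_char c"
  shows "jacobi_sum c \<phi> = c 4 * jacobi_sum c c"
proof -
  have c: "mult_char c" using assms by (rule nontrivial_charD)
  have bij: "bij (\<lambda>x :: 'a. 1 - x)" by (intro bij_betwI[where g = "\<lambda>y. 1 - y"]) auto
  have bij2: "bij (\<lambda>t :: 'a. 1 - 2 * t)"
    using two_nonzero by (intro bij_betwI[where g = "\<lambda>y. (1 - y) / 2"]) (auto simp: field_simps)
  have "jacobi_sum c \<phi> = (\<Sum>u\<in>UNIV. c (1 - u) * \<phi> u)"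
    unfolding jacobi_sum_def using sum.reindex_bij_betw[OF bij, of "\<lambda>x. c x * \<phi> (1 - x)"] by simp
  also have "\<dots> = (\<Sum>u\<in>UNIV. c (1 - u) * (1 + \<phi> u)) - (\<Sum>u\<in>UNIV. c (1 - u))"
    by (simp add: distrib_left sum.distrib)
  also have "(\<Sum>u\<in>UNIV. c (1 - u)) = 0"
    using sum.reindex_bij_betw[OF bij, of c] nontrivial_char_sum[OF assms] by simp
  also have "(\<Sum>u\<in>UNIV. c (1 - u) * (1 + \<phi> u)) = (\<Sum>x\<in>UNIV. c (1 - x\<^sup>2))"
    by (rule sum_square[symmetric])
  also have "\<dots> = (\<Sum>t\<in>UNIV. c (1 - (1 - 2 * t)\<^sup>2))"
    using sum.reindex_bij_betw[OF bij2, of "\<lambda>x. c (1 - x\<^sup>2)"] by simp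
  also have "\<dots> = (\<Sum>t\<in>UNIV. c (4 * (t * (1 - t))))"
    by (intro sum.cong refl arg_cong[where f = c]) (simp add: power2_eq_square algebra_simps)
  also have "\<dots> = c 4 * jacobi_sum c c"
    unfolding jacobi_sum_def sum_distrib_left by (simp only: mult_charD[OF c])
  finally show ?thesis by simp
qed

text \<open>The exponent 2^(m-2) gives a character of order 4. Pairing it with \<open>\<phi>\<close>
  rather than with itself is the form in which it occurs both in \<open>G_square\<close> and in the
  count of points on y^2 = 1 - x^4.\<close>

definition J :: complex where "J = jacobi_sum (\<lambda>x. \<chi> x ^ 2 ^ (m - 2)) \<phi>"

lemma G_square:
  assumes k: "2 \<le> k" "k \<le> m"
  shows "(G (2 ^ (m - k)))\<^sup>2 = (if k = m then -1 else 1) * jacobi_sum (\<lambda>x. \<chi> x ^ 2 ^ (m - k)) \<phi>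
           * G (2 ^ (m - (k - 1)))"
proof -
  define l :: nat where "l = 2 ^ (m - k)"
  define c where "c = (\<lambda>x. \<chi> x ^ l)"
  have l2: "2 * l = 2 ^ (m - (k - 1))"
    unfolding l_def power_Suc[symmetric] using k by (intro arg_cong[where f = "(^) 2"]) simp
  have c: "nontrivial_char c"
    unfolding c_def l_def using k by (intro nontrivial_chi_pow not_dvd_two_power) auto
  have cc: "(\<lambda>x. c x * c x) = (\<lambda>x. \<chi> x ^ (2 * l))"
    by (simp add: c_def fun_eq_iff power_add[symmetric] mult_2)
  have "nontrivial_char (\<lambda>x. \<chi> x ^ (2 * l))"
    unfolding l2 using k by (intro nontrivial_chi_pow not_dvd_two_power) auto
  hence "gauss_sum c * gauss_sum c = jacobi_sum c c * gauss_sum (\<lambda>x. \<chi> x ^ (2 * l))"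
    using gauss_sum_mult[of c c] nontrivial_charD[OF c] cc by simp
  hence "(G l)\<^sup>2 = jacobi_sum c c * G (2 * l)"
    by (simp add: G_def c_def power2_eq_square)
  moreover have "c 4 = (if k = m then -1 else 1)"
    unfolding c_def chi_four l_def using k by simp
  hence "jacobi_sum c c = (if k = m then -1 else 1) * jacobi_sum c \<phi>"
    using jacobi_sum_phi[OF c] by simp
  ultimately have "(G l)\<^sup>2 = (if k = m then -1 else 1) * jacobi_sum c \<phi> * G (2 * l)" by simp
  thus ?thesis unfolding l2 unfolding c_def l_def .
qed

lemma G_square_2: "(G (2 ^ (m - 2)))\<^sup>2 = (if m = 2 then -1 else 1) * J * G (2 ^ (m - 1))"
  using G_square[of 2] m2 by (simp add: J_def)

text \<open>Multiplication by \<open>\<phi>\<close> adds 2^(m-1) to the index of a character, which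
  turns 2^(m-k) into 2^(m-k) (1 + 2^(k-1)).\<close>

lemma jacobi_phi_gauss:
  assumes "2 \<le> k" "k \<le> m"
  shows "G (2 ^ (m - k)) * G (2 ^ (m - 1))
       = jacobi_sum (\<lambda>x. \<chi> x ^ 2 ^ (m - k)) \<phi> * G (2 ^ (m - k) * (1 + 2 ^ (k - 1)))"
    and "\<not> 2 ^ m dvd (2 ^ (m - k) * (1 + 2 ^ (k - 1)) :: nat)"
proof -
  have eq: "2 ^ (m - k) * (1 + 2 ^ (k - 1)) = 2 ^ (m - k) + (2 ^ (m - 1) :: nat)"
    using assms by (simp add: distrib_left power_add[symmetric])
  show nd: "\<not> 2 ^ m dvd (2 ^ (m - k) * (1 + 2 ^ (k - 1)) :: nat)"
  proof
    assume "2 ^ m dvd (2 ^ (m - k) * (1 + 2 ^ (k - 1)) :: nat)"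
    moreover have "2 ^ m = 2 ^ (m - k) * (2 ^ k :: nat)" using assms by (simp add: power_add[symmetric])
    ultimately have "2 ^ (m - k) * 2 ^ k dvd (2 ^ (m - k) * (1 + 2 ^ (k - 1)) :: nat)"
      by (simp only:)
    hence "2 ^ k dvd (1 + 2 ^ (k - 1) :: nat)"
      by (rule dvd_mult_cancel) simp
    hence "(2::nat) dvd 1 + 2 ^ (k - 1)"
      by (rule dvd_trans[of 2 "2 ^ k", rotated]) (use assms in simp)
    moreover have "even (2 ^ (k - 1) :: nat)" using assms by simp
    ultimately show False by simp
  qed
  have fe: "(\<lambda>x. \<chi> x ^ 2 ^ (m - k) * \<phi> x) = (\<lambda>x. \<chi> x ^ (2 ^ (m - k) * (1 + 2 ^ (k - 1))))"
    unfolding eq by (simp add: fun_eq_iff \<phi>_def power_add)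
  have phi: "G (2 ^ (m - 1)) = gauss_sum \<phi>" by (simp add: G_def \<phi>_def[abs_def])
  show "G (2 ^ (m - k)) * G (2 ^ (m - 1))
       = jacobi_sum (\<lambda>x. \<chi> x ^ 2 ^ (m - k)) \<phi> * G (2 ^ (m - k) * (1 + 2 ^ (k - 1)))"
    using gauss_sum_mult[of "\<lambda>x. \<chi> x ^ 2 ^ (m - k)" \<phi>] mult_char_chi_pow[of "2 ^ (m - k)"]
      nontrivial_charD[OF nontrivial_phi] nontrivial_chi_pow[OF nd]
    unfolding phi fe by (simp add: G_def)
qed

text \<open>For k >= 3 the factor 1 + 2^(k-1) is 1 modulo 4, so the same Gauss sum stands on both
  sides of \<open>jacobi_phi_gauss\<close> and cancels: the Jacobi sum with \<open>\<phi>\<close> is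
  the quadratic Gauss sum. For k = 2 the factor is 3 and only absolute values can be compared, so
  \<open>J\<close> needs its own evaluation.\<close>

lemma G_recursion:
  assumes k: "3 \<le> k" "k \<le> m"
  shows "(G (2 ^ (m - k)))\<^sup>2 = (if k = m then -1 else 1) * G (2 ^ (m - 1)) * G (2 ^ (m - (k - 1)))"
proof -
  have "4 dvd (2::nat) ^ (k - 1)" using le_imp_power_dvd[of 2 "k - 1" "2::nat"] k by simp
  hence "(1 + 2 ^ (k - 1)) mod (4::nat) = 1" by (auto elim!: dvdE)
  hence "G (2 ^ (m - k) * (1 + 2 ^ (k - 1))) = G (2 ^ (m - k))"
    using k by (intro G_one_mod_four) auto
  moreover have "G (2 ^ (m - k)) \<noteq> 0"
    unfolding G_def using k by (intro gauss_sum_nonzero nontrivial_chi_pow not_dvd_two_power) auto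
  ultimately have "jacobi_sum (\<lambda>x. \<chi> x ^ 2 ^ (m - k)) \<phi> = G (2 ^ (m - 1))"
    using jacobi_phi_gauss(1)[of k] k by (simp add: mult.commute)
  thus ?thesis using G_square[of k] k by simp
qed

section \<open>The quartic Jacobi sum as a Gaussian integer\<close>

lemma J_norm: "J * cnj J = of_nat q"
proof -
  define a b c where "a = G (2 ^ (m - 2))" and "b = G (2 ^ (m - 1))"
    and "c = G (2 ^ (m - 2) * (1 + 2 ^ (2 - 1)))"
  have "a * cnj a = of_nat q" "b * cnj b = of_nat q"
    unfolding a_def b_def using m2 by (intro G_norm not_dvd_two_power; simp)+
  moreover have "c * cnj c = of_nat q"
    unfolding c_def using G_norm[OF jacobi_phi_gauss(2)[of 2]] m2 by simp
  moreover have "a * b = J * c"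
    unfolding a_def b_def c_def J_def using jacobi_phi_gauss(1)[of 2] m2 by simp
  hence "(J * cnj J) * (c * cnj c) = (a * cnj a) * (b * cnj b)"
    by (metis (no_types, lifting) complex_cnj_mult mult.assoc mult.left_commute)
  ultimately show ?thesis using q1 by simp
qed

lemma lambda_g: "\<chi> (g ^ i) ^ 2 ^ (m - 2) = \<i> ^ i"
proof -
  have "\<chi> (g ^ i) ^ 2 ^ (m - 2) = (\<zeta> ^ 2 ^ (m - 2)) ^ i"
    unfolding chi_g by (simp only: power_mult[symmetric] mult.commute)
  also have "\<zeta> ^ 2 ^ (m - 2) = \<i>"
    using arg_cong[OF cnj_zeta_quarter, of cnj] by simp
  finally show ?thesis .
qed

text \<open>Every term of the sum of \<open>(1 - \<lambda>(x)) (1 - \<phi>(1 - x))\<close> lies in the ideal generated by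
  \<open>2 + 2\<i>\<close>, which normalises the Jacobi sum modulo that ideal.\<close>

lemma J_ideal: "\<exists>u v :: int. J = - of_nat q + (2 + 2 * \<i>) * (of_int u + \<i> * of_int v)"
proof -
  define c where "c = (\<lambda>x. \<chi> x ^ 2 ^ (m - 2))"
  define P where "P = (\<lambda>z :: complex. \<exists>u v :: int. z = (2 + 2 * \<i>) * (of_int u + \<i> * of_int v))"
  have P0: "P 0" unfolding P_def by (intro exI[of _ 0]) simp
  have Padd: "P (x + y)" if "P x" "P y" for x y
  proof -
    obtain u v u' v' where xy: "x = (2 + 2 * \<i>) * (of_int u + \<i> * of_int v)"
      "y = (2 + 2 * \<i>) * (of_int u' + \<i> * of_int v')"
      using \<open>P x\<close> \<open>P y\<close> unfolding P_def by blast
    show ?thesis unfolding P_def xy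
      by (rule exI[of _ "u + u'"], rule exI[of _ "v + v'"], simp add: algebra_simps)
  qed
  have c: "nontrivial_char c"
    unfolding c_def using m2 by (intro nontrivial_chi_pow not_dvd_two_power) auto
  have c0: "c 0 = 0" and c1: "c 1 = 1" using mult_charD[OF nontrivial_charD[OF c]] by auto
  have p1: "\<phi> 1 = 1" using mult_charD[OF nontrivial_charD[OF nontrivial_phi]] by auto
  \<comment> \<open>A fourth root of unity is 1 modulo 1 + i, and the second factor is 0 or 2. The
    excluded points x = 0 and x = 1 give the term 0.\<close>
  have summand: "P ((1 - c x) * (1 - \<phi> (1 - x)))" if x: "x \<noteq> 0" "x \<noteq> 1" for x
  proof -
    obtain i where i: "x = g ^ i" using x gen by blast
    have cx: "c x = \<i> ^ i" unfolding c_def i lambda_g ..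
    have "\<i> ^ i \<in> {1, \<i>, -1, -\<i>}"
      by (induction i) auto
    hence "\<exists>u v :: int. 1 - c x = (1 + \<i>) * (of_int u + \<i> * of_int v)"
    proof -
      consider "c x = 1" | "c x = \<i>" | "c x = -1" | "c x = -\<i>"
        using \<open>\<i> ^ i \<in> {1, \<i>, -1, -\<i>}\<close> cx by auto
      thus ?thesis
      proof cases
        case 1
        thus ?thesis by (intro exI[of _ 0]) simp
      next
        case 2
        thus ?thesis by - (rule exI[of _ 0], rule exI[of _ "-1"], simp add: algebra_simps)
      next
        case 3
        thus ?thesis by - (rule exI[of _ 1], rule exI[of _ "-1"], simp add: algebra_simps)
      next
        case 4
        thus ?thesis by - (rule exI[of _ 1], rule exI[of _ 0], simp add: algebra_simps)
      qed
    qed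
    then obtain u v :: int where uv: "1 - c x = (1 + \<i>) * (of_int u + \<i> * of_int v)" by blast
    from phi_cases[of "1 - x"] x have "\<phi> (1 - x) = 1 \<or> \<phi> (1 - x) = -1" by simp
    thus ?thesis
    proof
      assume "\<phi> (1 - x) = 1"
      thus ?thesis using P0 by simp
    next
      assume "\<phi> (1 - x) = -1"
      hence "(1 - c x) * (1 - \<phi> (1 - x)) = (2 + 2 * \<i>) * (of_int u + \<i> * of_int v)"
        unfolding uv by (simp add: algebra_simps)
      thus ?thesis unfolding P_def by blast
    qed
  qed
  have bij: "bij (\<lambda>x :: 'a. 1 - x)" by (intro bij_betwI[where g = "\<lambda>y. 1 - y"]) auto
  have sphi: "(\<Sum>x\<in>UNIV. \<phi> (1 - x)) = 0"
    using sum.reindex_bij_betw[OF bij, of \<phi>] nontrivial_char_sum[OF nontrivial_phi] by simp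
  have "(\<Sum>x\<in>UNIV. (1 - c x) * (1 - \<phi> (1 - x)))
      = (\<Sum>x\<in>(UNIV :: 'a set). 1) - (\<Sum>x\<in>UNIV. c x) - (\<Sum>x\<in>UNIV. \<phi> (1 - x)) + (\<Sum>x\<in>UNIV. c x * \<phi> (1 - x))"
    by (simp add: algebra_simps sum.distrib sum_subtractf)
  also have "\<dots> = of_nat q + J"
    using nontrivial_char_sum[OF c] sphi by (simp add: J_def jacobi_sum_def c_def card)
  finally have "J = - of_nat q + (\<Sum>x\<in>UNIV. (1 - c x) * (1 - \<phi> (1 - x)))" by simp
  moreover have "P (\<Sum>x\<in>UNIV. (1 - c x) * (1 - \<phi> (1 - x)))"
  proof (rule sum_pred_closed[OF P0 Padd])
    fix x :: 'a
    show "P ((1 - c x) * (1 - \<phi> (1 - x)))"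
      using summand[of x] P0 p1 c1 c0 by (cases "x = 0 \<or> x = 1") auto
  qed
  ultimately show ?thesis unfolding P_def by metis
qed

text \<open>The ideal gives a = -q + 2(u - v) and b = 2(u + v), and u - v has the parity of u + v.
  That parity is read off modulo 8 from q = a^2 + 4(u + v)^2 with a odd: it is odd if m = 2, where q
  - 1 is not divisible by 8, and even if m >= 3.\<close>

lemma J_gaussian_int:
  obtains a b :: int where "J = of_int a + \<i> * of_int b" "a\<^sup>2 + b\<^sup>2 = int q"
    "even b" "m = 2 \<Longrightarrow> [a = 1] (mod 4)" "m \<ge> 3 \<Longrightarrow> [a = -1] (mod 4)"
proof -
  obtain u v :: int where uv: "J = - of_nat q + (2 + 2 * \<i>) * (of_int u + \<i> * of_int v)"
    using J_ideal by blast
  define a b where "a = - int q + 2 * (u - v)" and "b = 2 * (u + v)"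
  have J: "J = of_int a + \<i> * of_int b"
    unfolding uv a_def b_def by (simp add: algebra_simps)
  have "of_int (a\<^sup>2 + b\<^sup>2) = J * cnj J"
    unfolding J by (simp add: algebra_simps power2_eq_square)
  hence ab: "a\<^sup>2 + b\<^sup>2 = int q"
    unfolding J_norm by (metis of_int_eq_iff of_int_of_nat_eq)
  obtain t where t: "q - 1 = 2 ^ m * t" using dvd by blast
  have q4: "q mod 4 = 1"
    using q1_four q1 by presburger
  have "odd a" unfolding a_def using q4 by simp presburger
  then obtain e where e: "a = 2 * e + 1" by (elim oddE)
  have "even (e * (e + 1))" by simp
  then obtain f where "e * (e + 1) = 2 * f" by blast
  hence a2: "a\<^sup>2 = 8 * f + 1" unfolding e by (simp add: power2_eq_square algebra_simps)
  have eq: "int q = 8 * f + 1 + 4 * (u + v)\<^sup>2"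
    using ab unfolding a2 b_def by (simp add: power2_eq_square algebra_simps)
  have par: "8 dvd 8 * f + 1 + 4 * w - 1 \<longleftrightarrow> even w" for w :: int by presburger
  show ?thesis
  proof (rule that[OF J ab])
    show "even b" by (simp add: b_def)
    show "[a = 1] (mod 4)" if "m = 2"
    proof -
      have "\<not> 8 dvd q - 1" using ndvd that by simp
      hence "\<not> 8 dvd int q - 1" using q1 by presburger
      hence "odd ((u + v)\<^sup>2)" unfolding eq using par by blast
      hence "odd (u + v)" by simp
      then obtain w where w: "u + v = 2 * w + 1" by (elim oddE)
      have "a - 1 = - int q + 1 + 4 * (w - v)" unfolding a_def using w by presburger
      moreover have "4 dvd int q - 1" using q4 by presburger
      ultimately show ?thesis unfolding cong_iff_dvd_diff by presburger
    qed
    show "[a = -1] (mod 4)" if "m \<ge> 3"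
    proof -
      have "8 dvd q - 1" using dvd le_imp_power_dvd[OF that, of "2::nat"] by (auto intro: dvd_trans)
      hence "8 dvd int q - 1" using q1 by presburger
      hence "even ((u + v)\<^sup>2)" unfolding eq using par by blast
      hence "even (u + v)" by simp
      then obtain w where w: "u + v = 2 * w" by blast
      have "a - (-1) = - int q + 1 + 4 * (w - v)" unfolding a_def using w by presburger
      moreover have "4 dvd int q - 1" using q4 by presburger
      ultimately show ?thesis unfolding cong_iff_dvd_diff by presburger
    qed
  qed
qed

lemma field_power_sum:
  "(\<Sum>x\<in>UNIV. (x :: 'a) ^ n) = (if n \<ge> 1 \<and> (q - 1) dvd n then -1 else 0)"
proof (cases "n = 0")
  case True
  have "of_nat q = (0 :: 'a)"
    using s by (simp add: of_nat_eq_0_iff_char_dvd CHAR q_def)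
  thus ?thesis using True by (simp add: card)
next
  case False
  have "(g ^ n) ^ (q - 1) = (g ^ (q - 1)) ^ n" by (simp only: power_mult[symmetric] mult.commute)
  hence "(g ^ n) ^ (q - 1) = 1" unfolding g_order by simp
  from geometric_sum_root_unity[OF this]
  have geo: "(\<Sum>i<q - 1. (g ^ n) ^ i) = (if g ^ n = 1 then of_nat (q - 1) else 0)" .
  have "g ^ n = 1 \<longleftrightarrow> (q - 1) dvd n"
    using g_pow_eq_iff[of n 0] by (simp add: cong_0_iff)
  moreover have "(of_nat (q - 1) :: 'a) = -1"
  proof -
    have "of_nat q = (0 :: 'a)"
      using s by (simp add: of_nat_eq_0_iff_char_dvd CHAR q_def)
    thus ?thesis using q1 by (simp add: of_nat_diff)
  qed
  moreover have "(\<Sum>x\<in>UNIV. (x :: 'a) ^ n) = (\<Sum>i<q - 1. (g ^ n) ^ i)"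
    unfolding sum_UNIV using False by (simp add: power_0_left power_mult[symmetric] mult.commute)
  ultimately show ?thesis using geo False by simp
qed

text \<open>Dividing by the square u^2 replaces \<open>\<phi>\<close>(u) \<open>\<phi>\<close>(1 -
  u) by \<open>\<phi>\<close>(1/u - 1). As 1/u runs through the nonzero elements, the complete sum
  lacks only the value at -1.\<close>

lemma jacobi_sum_phi_phi: "jacobi_sum \<phi> \<phi> = -1"
proof -
  have p1: "\<phi> 1 = 1" using mult_charD[OF nontrivial_charD[OF nontrivial_phi]] by auto
  have sq: "\<phi> u * \<phi> u = 1" if "u \<noteq> 0" for u
    using phi_cases[OF that] by auto
  have "jacobi_sum \<phi> \<phi> = (\<Sum>u\<in>-{0}. \<phi> u * \<phi> (1 - u))"
    unfolding jacobi_sum_def by (intro sum.mono_neutral_right) auto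
  also have "\<dots> = (\<Sum>u\<in>-{0}. \<phi> (inverse u - 1))"
  proof (rule sum.cong[OF refl])
    fix u :: 'a assume "u \<in> -{0}"
    hence u: "u \<noteq> 0" by simp
    have "\<phi> (inverse u - 1) = \<phi> u * \<phi> u * \<phi> (inverse u - 1)" using sq[OF u] by simp
    also have "\<dots> = \<phi> u * \<phi> (u * (inverse u - 1))" by (simp add: phi_mult)
    also have "u * (inverse u - 1) = 1 - u" using u by (simp add: algebra_simps)
    finally show "\<phi> u * \<phi> (1 - u) = \<phi> (inverse u - 1)" ..
  qed
  also have "\<dots> = (\<Sum>v\<in>-{0}. \<phi> (v - 1))"
    by (intro sum.reindex_bij_witness[of _ inverse inverse]) auto
  also have "\<dots> = (\<Sum>v\<in>UNIV. \<phi> (v - 1)) - \<phi> (-1)"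
    using sum.remove[of UNIV "0::'a" "\<lambda>v. \<phi> (v - 1)"] by (simp add: Compl_eq_Diff_UNIV)
  also have "(\<Sum>v\<in>UNIV. \<phi> (v - 1)) = (\<Sum>v\<in>UNIV. \<phi> v)"
    by (intro sum.reindex_bij_witness[of _ "\<lambda>v. v + 1" "\<lambda>v. v - 1"]) auto
  also have "\<dots> = 0" by (rule nontrivial_char_sum[OF nontrivial_phi])
  finally show ?thesis by (simp add: phi_minus_one)
qed

text \<open>Counting the points of \<open>y\<^sup>2 = 1 - x\<^sup>4\<close> in the field itself expresses \<open>2 Re J\<close> modulo \<open>p\<close>
  as a central binomial coefficient.\<close>

lemma J_not_dvd:
  assumes J: "J = of_int a + \<i> * of_int b"
  shows "\<not> int p dvd a"
proof
  assume pa: "int p dvd a"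
  obtain M where M: "q - 1 = 4 * M" using q1_four by blast
  have M0: "M > 0" using M q1 by (cases M) auto
  \<comment> \<open>The values are integers so that the same sum \<open>T\<close> can be mapped into
    the complex numbers, where it involves \<open>J\<close>, and into the field, where Euler's
    criterion makes it a sum of polynomial values.\<close>
  define e :: "'a \<Rightarrow> int" where
    "e = (\<lambda>y. if y = 0 then 0 else if \<phi> y = 1 then 1 else -1)"
  have e_phi: "of_int (e y) = \<phi> y" for y
    using phi_cases[of y] by (auto simp: e_def)
  have e_pow: "of_int (e y) = y ^ (2 * M)" for y
  proof (cases "y = 0")
    case True
    thus ?thesis using M0 by (simp add: e_def)
  next
    case False
    then obtain i where i: "y = g ^ i" using gen by blast
    have h: "(q - 1) div 2 = 2 * M" using M by simp
    have "y ^ (2 * M) = (g ^ (2 * M)) ^ i" unfolding i by (simp only: power_mult[symmetric] mult.commute)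
    also have "\<dots> = (-1) ^ i" unfolding minus_one_eq[unfolded h, symmetric] ..
    finally have "y ^ (2 * M) = (-1) ^ i" .
    moreover have "(1 :: complex) \<noteq> -1" by simp
    ultimately show ?thesis
      using False phi_g[of i] unfolding e_def i by (cases "even i") auto
  qed
  define T where "T = (\<Sum>x\<in>UNIV. e (1 - x ^ 4))"
  define c where "c = (\<lambda>x. \<chi> x ^ 2 ^ (m - 2))"
  have "of_int T = (\<Sum>x\<in>UNIV. \<phi> (1 - x ^ 4))" by (simp add: T_def e_phi)
  also have "\<dots> = (\<Sum>u\<in>UNIV. \<phi> (1 - u) * (1 + c u + \<phi> u + cnj (c u)))"
  proof -
    have set: "{Suc 0..<4} = {1, 2, 3}" by auto
    have l1: "0 < (2::nat) ^ (m - 2)" by simp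
    have pw: "(2::nat) ^ m = 4 * 2 ^ (m - 2)" "(2::nat) ^ (m - 1) = 2 * 2 ^ (m - 2)"
    proof -
      obtain r where "m = r + 2" using m2 by (metis le_add_diff_inverse2)
      thus "(2::nat) ^ m = 4 * 2 ^ (m - 2)" "(2::nat) ^ (m - 1) = 2 * 2 ^ (m - 2)" by simp_all
    qed
    have l2: "(2::nat) ^ (m - 2) < 2 ^ m" unfolding pw by simp
    have c3: "cnj (c u) = \<chi> u ^ (2 ^ (m - 2) * 3)" for u
      unfolding c_def cnj_chi_pow[OF l1 l2] pw by (simp add: mult.commute)
    have c2: "\<phi> u = \<chi> u ^ (2 ^ (m - 2) * 2)" for u
      unfolding \<phi>_def pw by (simp add: mult.commute)
    show ?thesis
      using sum_two_power[OF m2, of "\<lambda>u. \<phi> (1 - u)"] unfolding c3 c2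
      by (simp add: set c_def add.assoc)
  qed
  also have "\<dots> = (\<Sum>u\<in>UNIV. \<phi> (1 - u)) + (\<Sum>u\<in>UNIV. c u * \<phi> (1 - u))
      + (\<Sum>u\<in>UNIV. \<phi> u * \<phi> (1 - u)) + (\<Sum>u\<in>UNIV. cnj (c u) * \<phi> (1 - u))"
    by (simp add: algebra_simps sum.distrib)
  also have "(\<Sum>u\<in>UNIV. \<phi> (1 - u)) = (\<Sum>v\<in>UNIV. \<phi> v)"
    by (intro sum.reindex_bij_witness[of _ "\<lambda>v. 1 - v" "\<lambda>v. 1 - v"]) auto
  also have "\<dots> = 0" by (rule nontrivial_char_sum[OF nontrivial_phi])
  also have "(\<Sum>u\<in>UNIV. c u * \<phi> (1 - u)) = J" by (simp add: J_def jacobi_sum_def c_def)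
  also have "(\<Sum>u\<in>UNIV. \<phi> u * \<phi> (1 - u)) = -1" using jacobi_sum_phi_phi by (simp add: jacobi_sum_def)
  also have "(\<Sum>u\<in>UNIV. cnj (c u) * \<phi> (1 - u)) = cnj J"
    by (simp add: J_def jacobi_sum_def c_def e_phi[symmetric])
  also have "0 + J + -1 + cnj J = of_int (2 * a - 1)" unfolding J by simp
  finally have T: "T = 2 * a - 1" by (simp only: of_int_eq_iff)
  have "(of_int T :: 'a) = (\<Sum>x\<in>UNIV. (- (x ^ 4) + 1) ^ (2 * M))"
    by (simp add: T_def e_pow)
  also have "\<dots> = (\<Sum>x\<in>UNIV. \<Sum>j\<le>2 * M. of_nat ((2 * M) choose j) * (-1) ^ j * x ^ (4 * j))"
    by (subst binomial_ring) (intro sum.cong refl, subst power_minus, simp add: power_mult mult.assoc)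
  also have "\<dots> = (\<Sum>j\<le>2 * M. of_nat ((2 * M) choose j) * (-1) ^ j * (\<Sum>x\<in>UNIV. x ^ (4 * j)))"
    by (subst sum.swap) (simp add: sum_distrib_left)
  \<comment> \<open>The power sum is -1 exactly when 4j is a positive multiple of q - 1 = 4M. The
    term j = 2M will cancel the -1 in T = 2a - 1, leaving the central binomial coefficient from j =
    M.\<close>
  also have "\<dots> = (\<Sum>j\<le>2 * M. if j = M \<or> j = 2 * M then - (of_nat ((2 * M) choose j) * (-1) ^ j) else 0)"
  proof (rule sum.cong[OF refl])
    fix j assume "j \<in> {..2 * M}"
    hence j: "j \<le> 2 * M" by simp
    have "(4 * j \<ge> 1 \<and> (q - 1) dvd 4 * j) \<longleftrightarrow> j = M \<or> j = 2 * M"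
    proof
      assume A: "4 * j \<ge> 1 \<and> (q - 1) dvd 4 * j"
      hence "M dvd j" unfolding M by simp
      then obtain r where r: "j = M * r" by blast
      hence "r \<le> 2" using j M0 by simp
      moreover have "r \<noteq> 0" using A r by auto
      ultimately have "r = 1 \<or> r = 2" by linarith
      thus "j = M \<or> j = 2 * M" using r by auto
    qed (use M0 M in auto)
    thus "of_nat ((2 * M) choose j) * (-1) ^ j * (\<Sum>x\<in>UNIV. (x :: 'a) ^ (4 * j))
        = (if j = M \<or> j = 2 * M then - (of_nat ((2 * M) choose j) * (-1) ^ j) else 0)"
      unfolding field_power_sum by simp
  qed
  also have "\<dots> = (\<Sum>j\<in>{M, 2 * M}. - (of_nat ((2 * M) choose j) * (-1) ^ j))"
    by (rule sum.mono_neutral_cong_right) auto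
  also have "\<dots> = - (of_nat ((2 * M) choose M) * (-1) ^ M) - 1"
    using M0 by simp
  finally have "(of_int (2 * a) :: 'a) = - (of_nat ((2 * M) choose M) * (-1) ^ M)"
    unfolding T by (simp add: algebra_simps)
  moreover have "(of_int (2 * a) :: 'a) = 0"
  proof -
    obtain a' where "a = int p * a'" using pa by blast
    thus ?thesis using of_nat_CHAR[where 'a = 'a] unfolding CHAR by simp
  qed
  ultimately have "(of_nat ((2 * M) choose M) :: 'a) = 0" by simp
  hence "p dvd (2 * M) choose M" using of_nat_eq_0_iff_char_dvd[where 'a = 'a] CHAR by metis
  moreover have "M = (p ^ s - 1) div 4" using M q_def by simp
  ultimately show False using prime_not_dvd_central_binomial[OF p p_mod_4, of s] by simp
qed

section \<open>The quadratic Gauss sum for even s\<close>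

lemma even_s:
  assumes "m \<ge> 3"
  shows "even s"
proof (rule ccontr)
  assume "odd s"
  then obtain r where r: "s = 2 * r + 1" by (elim oddE)
  have "p\<^sup>2 mod 8 = 1" using power_mod[of p 8 2] p8 by simp
  hence "(p\<^sup>2) ^ r mod 8 = 1" using power_mod[of "p\<^sup>2" 8 r] by simp
  hence "q mod 8 = 5"
    unfolding q_def r power_add power_mult using p8 by (metis mod_mult_eq mult_1 power_one_right mod_mod_trivial)
  moreover have "8 dvd q - 1"
    using dvd le_imp_power_dvd[OF assms, of "2::nat"] by (auto intro: dvd_trans)
  ultimately show False using q1 by presburger
qed

text \<open>On the fixed field of \<open>x \<mapsto> x ^ Q\<close> the quadratic character is trivial. Averaging over that
  field leaves only the \<open>x\<close> with \<open>x ^ Q = - x\<close>, and these are nonsquares because \<open>Q\<close> is congruent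
  to 1 modulo 4.\<close>

lemma G_quadratic:
  assumes "even s"
  shows "G (2 ^ (m - 1)) = - of_nat (p ^ (s div 2))"
proof -
  define Q where "Q = p ^ (s div 2)"
  have qQ: "q = Q * Q"
    unfolding q_def Q_def power_add[symmetric] using assms by (auto elim!: evenE simp: mult_2)
  have Q4: "Q mod 4 = 1"
    unfolding Q_def using power_mod[of p 4 "s div 2"] p_mod_4 by simp
  have Q0: "Q > 0" using Q4 by (cases Q) auto
  define F where "F = {x :: 'a. x ^ Q = x}"
  \<comment> \<open>The nonzero part of the orthogonal complement of \<open>F\<close> under the
    pairing psi(bx); for every other nonzero x the sum over \<open>F\<close> vanishes.\<close>
  define E where "E = {x :: 'a. x \<noteq> 0 \<and> (\<forall>b\<in>F. \<psi> (b * x) = 1)}"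
  have F0: "0 \<in> F" using Q0 by (simp add: F_def)
  have F1: "1 \<in> F" by (simp add: F_def)
  have Fadd: "x + y \<in> F" if "x \<in> F" "y \<in> F" for x y
    using that unfolding F_def Q_def by (simp add: frob_add)
  have Fneg: "- x \<in> F" if "x \<in> F" for x
    using that unfolding F_def Q_def by (simp add: frob_minus)
  have xq: "x ^ Q ^ 2 = x" for x :: 'a
  proof (cases "x = 0")
    case False
    have "x ^ q = x ^ (q - 1) * x" using q1 power_Suc2[of x "q - 1"] by simp
    thus ?thesis
      using finite_field_power_card_minus_one[OF False] by (simp add: card qQ power2_eq_square)
  qed (use Q0 in simp)
  have phiF: "\<phi> b = 1" if b: "b \<in> F" "b \<noteq> 0" for b
  proof -
    obtain i where i: "b = g ^ i" using gen[OF b(2)] by blast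
    have "b ^ (Q - 1) * b = 1 * b"
      using b Q0 unfolding F_def by (simp flip: power_Suc2)
    hence "b ^ (Q - 1) = 1" using b by simp
    hence "g ^ (i * (Q - 1)) = g ^ 0" by (simp add: i power_mult)
    hence "(q - 1) dvd i * (Q - 1)" unfolding g_pow_eq_iff by (simp add: cong_0_iff)
    moreover have "q - 1 = (Q + 1) * (Q - 1)" unfolding qQ by (simp add: algebra_simps)
    ultimately have "(Q - 1) * (Q + 1) dvd (Q - 1) * i" by (simp only: mult.commute)
    moreover have "0 < Q - 1" using q1 qQ Q0 by (cases "Q = 1") auto
    ultimately have "(Q + 1) dvd i" by (rule dvd_mult_cancel)
    moreover have "even (Q + 1)" using Q4 by presburger
    ultimately have "even i" using dvd_trans by blast
    thus ?thesis by (simp add: i phi_g)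
  qed
  have phiE: "\<phi> x = -1" if x: "x \<in> E" for x
  proof -
    have x0: "x \<noteq> 0" and xF: "\<And>b. b \<in> F \<Longrightarrow> \<psi> (b * x) = 1" using x by (auto simp: E_def)
    have psiQ: "\<psi> (y ^ Q) = \<psi> y" for y unfolding Q_def by (rule psi_frob_power)
    have tr: "y + y ^ Q \<in> F" for y
    proof -
      have "(y + y ^ Q) ^ Q = y ^ Q + (y ^ Q) ^ Q" unfolding Q_def by (rule frob_add)
      also have "(y ^ Q) ^ Q = y" using xq[of y] by (simp add: power_mult[symmetric] power2_eq_square)
      finally show ?thesis by (simp add: F_def add.commute)
    qed
    \<comment> \<open>If the relative trace x + x^Q were nonzero, a multiple of it by some b in
      \<open>F\<close> would equal the relative trace of any given z. Then psi(z)^2 = psi(bx)^2 = 1,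
      which is impossible for a p-th root of unity other than 1 with p odd.\<close>
    have "x ^ Q = - x"
    proof (rule ccontr)
      assume "x ^ Q \<noteq> - x"
      hence t0: "x + x ^ Q \<noteq> 0" by (metis add.commute eq_neg_iff_add_eq_0)
      obtain z where z: "\<psi> z \<noteq> 1" using psi_nontrivial by blast
      define b where "b = (z + z ^ Q) / (x + x ^ Q)"
      have bF: "b \<in> F" using tr[of z] tr[of x] unfolding b_def F_def by (simp add: power_divide)
      have "\<psi> (b * (x + x ^ Q)) = \<psi> (b * x) * \<psi> (b * x ^ Q)"
        by (simp add: distrib_left psi_add)
      also have "b * x ^ Q = (b * x) ^ Q" using bF by (simp add: F_def power_mult_distrib)
      also have "\<psi> (b * x) * \<psi> ((b * x) ^ Q) = 1" by (simp add: psiQ xF[OF bF])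
      also have "b * (x + x ^ Q) = z + z ^ Q" using t0 by (simp add: b_def)
      finally have "\<psi> z * \<psi> z = 1" by (simp add: psi_add psiQ)
      hence "\<psi> z = -1" using z by (metis square_eq_1_iff)
      thus False using psi_pow[of z] odd_p by simp
    qed
    obtain i where i: "x = g ^ i" using gen[OF x0] by blast
    have "x ^ (Q - 1) * x = (-1) * x"
      using \<open>x ^ Q = - x\<close> Q0 by (simp flip: power_Suc2)
    hence "x ^ (Q - 1) = -1" using x0 by (metis mult_right_cancel)
    hence "g ^ (i * (Q - 1)) = g ^ ((q - 1) div 2)" unfolding minus_one_eq[symmetric] by (simp add: i power_mult)
    hence c: "[i * (Q - 1) = (q - 1) div 2] (mod (q - 1))" unfolding g_pow_eq_iff .
    \<comment> \<open>The condition x^(Q-1) = -1 says that the index of x is an odd multiple of (Q +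
      1) / 2, and this number is odd because Q is 1 modulo 4.\<close>
    define R where "R = (Q + 1) div 2"
    have R: "Q + 1 = 2 * R" "odd R" using Q4 unfolding R_def by presburger+
    have Q1: "Q - 1 > 0" using q1 qQ Q0 by (cases "Q = 1") auto
    have q': "q - 1 = (2 * R) * (Q - 1)" unfolding qQ R(1)[symmetric] by (simp add: algebra_simps)
    have "(q - 1) div 2 = R * (Q - 1)" unfolding q' by simp
    with c have "[i * (Q - 1) = R * (Q - 1)] (mod (2 * R) * (Q - 1))" unfolding q' by simp
    hence "i * (Q - 1) mod ((2 * R) * (Q - 1)) = R * (Q - 1) mod ((2 * R) * (Q - 1))" by (simp add: cong_def)
    hence "i mod (2 * R) * (Q - 1) = R mod (2 * R) * (Q - 1)" by (simp only: mult_mod_left)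
    hence "[i = R] (mod 2 * R)" using Q1 by (simp add: cong_def)
    hence "[i = R] (mod 2)" using cong_dvd_modulus_nat by fastforce
    hence "odd i" using R(2) by (simp add: cong_def odd_iff_mod_2_eq_one)
    thus ?thesis by (simp add: i phi_g)
  qed
  have Gphi: "G (2 ^ (m - 1)) = gauss_sum \<phi>" by (simp add: G_def \<phi>_def[abs_def])
  have "of_nat (card (F - {0})) * gauss_sum \<phi> = (\<Sum>b\<in>F - {0}. \<Sum>x\<in>UNIV. \<phi> x * \<psi> (b * x))"
    using phiF by (simp add: gauss_sum_twist[OF nontrivial_phi])
  also have "\<dots> = (\<Sum>x\<in>UNIV. \<phi> x * (\<Sum>b\<in>F - {0}. \<psi> (b * x)))"
    by (subst sum.swap) (simp add: sum_distrib_left)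
  also have "\<dots> = (\<Sum>x\<in>UNIV. \<phi> x * ((\<Sum>b\<in>F. \<psi> (b * x)) - 1))"
    using F0 by (simp add: sum_diff1 psi_zero)
  also have "\<dots> = (\<Sum>x\<in>UNIV. \<phi> x * (\<Sum>b\<in>F. \<psi> (b * x))) - (\<Sum>x\<in>UNIV. \<phi> x)"
    by (simp add: right_diff_distrib sum_subtractf)
  also have "(\<Sum>x\<in>UNIV. \<phi> x) = 0" by (rule nontrivial_char_sum[OF nontrivial_phi])
  also have "(\<Sum>x\<in>UNIV. \<phi> x * (\<Sum>b\<in>F. \<psi> (b * x))) = (\<Sum>x\<in>E. - of_nat (card F))"
  proof (rule sum.mono_neutral_cong_right)
    show "\<forall>x\<in>UNIV - E. \<phi> x * (\<Sum>b\<in>F. \<psi> (b * x)) = 0"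
    proof
      fix x assume x: "x \<in> UNIV - E"
      show "\<phi> x * (\<Sum>b\<in>F. \<psi> (b * x)) = 0"
      proof (cases "x = 0")
        case False
        then obtain b where "b \<in> F" "\<psi> (b * x) \<noteq> 1" using x by (auto simp: E_def)
        from psi_sum_subgroup[OF F0 Fadd Fneg this] show ?thesis by simp
      qed simp
    qed
    show "\<phi> x * (\<Sum>b\<in>F. \<psi> (b * x)) = - of_nat (card F)" if "x \<in> E" for x
      using phiE[OF that] that by (simp add: E_def)
  qed auto
  finally have *: "of_nat (card (F - {0})) * gauss_sum \<phi> = - of_nat (card E * card F)" by simp
  have "1 \<in> F - {0}" using F1 by simp
  hence cF: "card (F - {0}) > 0" by (metis card_gt_0_iff empty_iff finite)
  define f where "f = card (F - {0})"
  \<comment> \<open>Only the sign comes from the averaging: \<open>r\<close> is a nonnegative ratio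
    of cardinalities, and its value sqrt q comes from the known modulus of the Gauss sum, so
    \<open>E\<close> is never counted.\<close>
  define r where "r = real (card E * card F) / real f"
  have "gauss_sum \<phi> = (of_nat f * gauss_sum \<phi>) / of_nat f"
    using cF unfolding f_def[symmetric] by simp
  also have "\<dots> = - of_real r"
    unfolding f_def * unfolding r_def f_def by simp
  finally have Gr: "gauss_sum \<phi> = - of_real r" .
  have "of_real (r * r) = (of_nat q :: complex)"
    using gauss_sum_norm[OF nontrivial_phi] unfolding Gr by simp
  hence "r * r = real q" by (metis of_real_eq_iff of_real_of_nat_eq)
  hence "r\<^sup>2 = (real Q)\<^sup>2" unfolding qQ by (simp add: power2_eq_square)
  moreover have "r \<ge> 0" by (simp add: r_def)
  ultimately have "r = real Q" by (simp add: power2_eq_iff_nonneg)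
  thus ?thesis unfolding Gphi Gr Q_def by simp
qed

section \<open>Integrality in the ring generated by a p-th root of unity\<close>

definition cyclotomic :: "complex \<Rightarrow> bool" where
  "cyclotomic z \<longleftrightarrow> (\<exists>P :: int poly. z = poly (map_poly of_int P) (cis (2 * pi / real p)))"

lemma cyclotomic_of_int: "cyclotomic (of_int a)"
  unfolding cyclotomic_def by (intro exI[of _ "[:a:]"]) (simp add: of_int_hom.map_poly_pCons_hom)

lemma cyclotomic_add: "cyclotomic x \<Longrightarrow> cyclotomic y \<Longrightarrow> cyclotomic (x + y)"
  unfolding cyclotomic_def by (metis of_int_poly_hom.hom_add poly_add)

lemma cyclotomic_mult: "cyclotomic x \<Longrightarrow> cyclotomic y \<Longrightarrow> cyclotomic (x * y)"
  unfolding cyclotomic_def by (metis of_int_poly_hom.hom_mult poly_mult)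

lemma cyclotomic_diff: "cyclotomic x \<Longrightarrow> cyclotomic y \<Longrightarrow> cyclotomic (x - y)"
  using cyclotomic_add[of x "of_int (-1) * y"] cyclotomic_mult[OF cyclotomic_of_int[of "-1"]] by simp

lemma cyclotomic_psi: "cyclotomic (\<psi> x)"
proof -
  have p0: "p > 0" using p by (simp add: prime_gt_0_nat)
  have "\<psi> x \<in> {z. z ^ p = 1}" using psi_pow by simp
  then obtain k where k: "\<psi> x = cis (2 * pi * real k / real p)"
    using bij_betw_roots_unity[OF p0] by (auto simp: bij_betw_def)
  hence "\<psi> x = poly (map_poly of_int (monom 1 k :: int poly)) (cis (2 * pi / real p))"
    by (simp add: map_poly_monom poly_monom DeMoivre mult_ac)
  thus ?thesis unfolding cyclotomic_def by blast
qed

lemma cyclotomic_rational: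
  assumes "cyclotomic z" "z \<in> \<rat>"
  shows "z \<in> \<int>"
proof -
  have p0: "p > 0" using p by (simp add: prime_gt_0_nat)
  have "cis (2 * pi / real p) ^ p = 1" using p0 by (simp add: DeMoivre)
  from algebraic_int_poly_root_of_unity[OF this p0] assms(1) have "algebraic_int z"
    unfolding cyclotomic_def by blast
  thus ?thesis using assms(2) by (rule rational_algebraic_int_is_int)
qed

text \<open>Expanding the square expresses q^2 / 4 through z inside the ring. A rational member of
  the ring is an integer, but q is odd.\<close>

lemma cyclotomic_half_contradiction:
  assumes "cyclotomic z" "(2 * z - of_nat q)\<^sup>2 = 4 * of_int N"
  shows False
proof -
  have "(of_nat q)\<^sup>2 = 4 * (of_int N - z * z + of_int (int q) * z)"
    using assms(2) by (simp add: power2_eq_square algebra_simps)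
  hence eq: "(of_nat q)\<^sup>2 / 4 = of_int N - z * z + of_int (int q) * z" by simp
  have "cyclotomic ((of_nat q)\<^sup>2 / 4)"
    unfolding eq by (intro cyclotomic_add cyclotomic_diff cyclotomic_mult cyclotomic_of_int assms(1))
  moreover have "(of_nat q)\<^sup>2 / 4 \<in> (\<rat> :: complex set)" by simp
  ultimately have "(of_nat q)\<^sup>2 / 4 \<in> (\<int> :: complex set)" by (rule cyclotomic_rational)
  then obtain t where "(of_nat q)\<^sup>2 / 4 = (of_int t :: complex)" by (auto elim: Ints_cases)
  hence "of_int ((int q)\<^sup>2) = (of_int (4 * t) :: complex)" by (simp add: field_simps)
  hence "(int q)\<^sup>2 = 4 * t" by (simp only: of_int_eq_iff)
  hence "even ((int q)\<^sup>2)" by simp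
  thus False using q_def odd_p by simp
qed

text \<open>The contribution of the characters of order \<open>2 ^ k\<close> to a period is \<open>2 ^ (k - 1)\<close> times a
  difference of two sums of values of \<open>\<psi>\<close>.\<close>

lemma cyclotomic_order_part:
  assumes k: "2 \<le> k" "k \<le> m"
  shows "\<exists>Y. cyclotomic Y \<and> G (2 ^ (m - k)) + (if k = m then -1 else 1) * cnj (G (2 ^ (m - k))) = 2 * Y"
proof -
  define w where "w = (\<lambda>u. \<chi> u ^ 2 ^ (m - k))"
  define n :: nat where "n = 2 ^ (k - 2)"
  have k2: "2 ^ (k - 1) = 2 * n" and kk: "2 ^ k = 4 * n"
  proof -
    obtain r where "k = r + 2" using k(1) by (metis le_add_diff_inverse2)
    thus "2 ^ (k - 1) = 2 * n" "2 ^ k = 4 * n" by (simp_all add: n_def)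
  qed
  \<comment> \<open>The odd powers of w sum to 0 unless w^2 = 1, in which case each of them is w;
    \<open>e\<close> records this w as an integer and is 0 elsewhere.\<close>
  define e :: "'a \<Rightarrow> int" where "e = (\<lambda>u. if w u = 1 then 1 else if w u = -1 then -1 else 0)"
  have inner: "(\<Sum>l<2 * n. w u ^ (2 * l + 1)) = 2 * of_nat n * of_int (e u)" for u
  proof (cases "u = 0")
    case True
    thus ?thesis by (simp add: w_def e_def power_0_left)
  next
    case False
    have "(w u ^ 2) ^ (2 * n) = 1"
    proof -
      obtain i where "u = g ^ i" using gen False by blast
      hence "(w u ^ 2) ^ (2 * n) = \<zeta> ^ (i * (2 ^ (m - k) * 2 ^ k))"
        unfolding kk by (simp add: w_def power_mult[symmetric] mult_ac)
      also have "\<dots> = 1" unfolding zeta_pow_eq_1_iff using k by (simp add: power_add[symmetric])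
      finally show ?thesis .
    qed
    from geometric_sum_root_unity[OF this]
    have "(\<Sum>l<2 * n. (w u ^ 2) ^ l) = (if w u ^ 2 = 1 then of_nat (2 * n) else 0)" .
    moreover have "(\<Sum>l<2 * n. w u ^ (2 * l + 1)) = (\<Sum>l<2 * n. (w u ^ 2) ^ l) * w u"
      by (simp only: sum_distrib_right power_add power_mult power_one_right)
    ultimately show ?thesis
      by (auto simp: e_def power2_eq_1_iff)
  qed
  have "order_part k 0 = (\<Sum>l<2 * n. G (2 ^ (m - k) * (2 * l + 1)))"
    using sum_odd_multiples[OF k, of 0] unfolding k2 by simp
  also have "\<dots> = (\<Sum>l<2 * n. \<Sum>u\<in>UNIV. w u ^ (2 * l + 1) * \<psi> u)"
    unfolding G_def gauss_sum_def w_def power_mult[symmetric] ..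
  also have "\<dots> = (\<Sum>u\<in>UNIV. (\<Sum>l<2 * n. w u ^ (2 * l + 1)) * \<psi> u)"
    by (subst sum.swap) (simp only: sum_distrib_right)
  also have "\<dots> = 2 * of_nat n * (\<Sum>u\<in>UNIV. of_int (e u) * \<psi> u)"
    unfolding inner by (simp add: sum_distrib_left mult_ac)
  finally have "order_part k 0 = 2 * of_nat n * (\<Sum>u\<in>UNIV. of_int (e u) * \<psi> u)" .
  moreover have "order_part k 0 = of_nat n * (G (2 ^ (m - k)) + (if k = m then -1 else 1) * cnj (G (2 ^ (m - k))))"
    by (simp add: order_part_def n_def Let_def)
  moreover have "(of_nat n :: complex) \<noteq> 0" by (simp add: n_def)
  ultimately have "G (2 ^ (m - k)) + (if k = m then -1 else 1) * cnj (G (2 ^ (m - k)))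
      = 2 * (\<Sum>u\<in>UNIV. of_int (e u) * \<psi> u)" by simp
  moreover have "cyclotomic (\<Sum>u\<in>UNIV. of_int (e u) * \<psi> u)"
    by (rule sum_pred_closed[of cyclotomic])
       (use cyclotomic_of_int[of 0] in simp,
        auto intro: cyclotomic_add cyclotomic_mult cyclotomic_of_int cyclotomic_psi)
  ultimately show ?thesis by blast
qed

text \<open>Write a + e cnj a = 2Y for the Gauss sum a of order 2^k. Squaring and replacing a^2 by
  the recursion turns 4 e Y^2 into 2q - 2 sqrt q Re b, where b has order 2^(k-1). Integrality at one
  order thus constrains the real part one order below.\<close>

lemma cyclotomic_half:
  assumes k: "3 \<le> k" "k \<le> m"
  shows "cyclotomic ((of_nat q - of_nat (p ^ (s div 2)) * of_real (Re (G (2 ^ (m - (k - 1)))))) / 2)"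
proof -
  define e :: complex where "e = (if k = m then -1 else 1)"
  define a where "a = G (2 ^ (m - k))"
  define b where "b = G (2 ^ (m - (k - 1)))"
  define Q where "Q = p ^ (s div 2)"
  have e: "e * e = 1" "cnj e = e" by (auto simp: e_def)
  obtain Y where Y: "cyclotomic Y" "a + e * cnj a = 2 * Y"
    using cyclotomic_order_part[of k] k unfolding a_def e_def by auto
  have a2: "a * a = - e * of_nat Q * b"
    using G_recursion[OF k] G_quadratic[OF even_s] k
    unfolding a_def b_def e_def Q_def power2_eq_square by simp
  have ca2: "cnj a * cnj a = - e * of_nat Q * cnj b"
    using arg_cong[OF a2, of cnj] e(2) by simp
  have aa: "a * cnj a = of_nat q"
    unfolding a_def using k by (intro G_norm not_dvd_two_power) auto
  have "4 * (Y * Y) = (a + e * cnj a) * (a + e * cnj a)"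
    unfolding Y(2) by simp
  also have "\<dots> = a * a + (e * e) * (cnj a * cnj a) + 2 * e * (a * cnj a)"
    by (simp add: algebra_simps)
  also have "\<dots> = 2 * e * of_nat q - e * of_nat Q * (b + cnj b)"
    unfolding a2 ca2 aa e by (simp add: algebra_simps)
  also have "b + cnj b = 2 * of_real (Re b)" by (simp add: complex_add_cnj)
  finally have "e * (4 * (Y * Y)) = e * (2 * e * of_nat q - e * of_nat Q * (2 * of_real (Re b)))"
    by (rule arg_cong)
  also have "\<dots> = (e * e) * (2 * of_nat q - of_nat Q * (2 * of_real (Re b)))"
    by (simp add: algebra_simps)
  finally have 4: "4 * (e * (Y * Y)) = 2 * of_nat q - of_nat Q * (2 * of_real (Re b))"
    unfolding e by (simp add: mult_ac)
  have "(of_nat q - of_nat Q * of_real (Re b)) / 2 = (4 * (e * (Y * Y))) / 4"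
    unfolding 4 by (simp add: diff_divide_distrib)
  hence "(of_nat q - of_nat Q * of_real (Re b)) / 2 = e * (Y * Y)" by simp
  moreover have "cyclotomic (e * (Y * Y))"
  proof -
    have "e = of_int (if k = m then -1 else 1)" by (simp add: e_def)
    thus ?thesis using cyclotomic_mult[OF cyclotomic_of_int cyclotomic_mult[OF Y(1) Y(1)]] by metis
  qed
  ultimately show ?thesis unfolding b_def Q_def by simp
qed

lemma order_part_mult:
  "order_part k (2 ^ (k - 2) * i) = 2 ^ (k - 2) *
     ((- \<i>) ^ i * G (2 ^ (m - k)) + (if k = m then -1 else 1) * cnj ((- \<i>) ^ i * G (2 ^ (m - k))))"
  by (simp add: order_part_def Let_def del: complex_cnj_mult complex_cnj_power)

lemma order_part_odd_zero:
  assumes "odd i" "t + 2 < k"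
  shows "order_part k (2 ^ t * i) = 0"
proof -
  have "\<not> 2 ^ (k - 2) dvd 2 ^ t * i"
  proof
    assume "2 ^ (k - 2) dvd 2 ^ t * i"
    moreover have "2 ^ t * 2 dvd (2 :: nat) ^ (k - 2)"
      unfolding power_Suc2[symmetric] using assms by (intro le_imp_power_dvd) simp
    ultimately have "2 ^ t * 2 dvd 2 ^ t * i" using dvd_trans by blast
    hence "2 dvd i" by (rule dvd_mult_cancel) simp
    thus False using assms by simp
  qed
  thus ?thesis by (simp add: order_part_def)
qed

text \<open>At order 2^m only the real part of (G 1)^2 is used. It determines the real and imaginary
  parts of G 1 up to sign, and these are the square roots in the final formula.\<close>

lemma G_one_square:
  shows "(G 1 - cnj (G 1))\<^sup>2 = 2 * of_real (Re ((G 1)\<^sup>2)) - 2 * of_nat q"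
    and "(G 1 + cnj (G 1))\<^sup>2 = 2 * of_real (Re ((G 1)\<^sup>2)) + 2 * of_nat q"
proof -
  have n: "G 1 * cnj (G 1) = of_nat q" using G_norm[of 1] m2 by simp
  have r: "2 * of_real (Re ((G 1)\<^sup>2)) = (G 1)\<^sup>2 + (cnj (G 1))\<^sup>2"
    using complex_add_cnj[of "(G 1)\<^sup>2"] by simp
  show "(G 1 - cnj (G 1))\<^sup>2 = 2 * of_real (Re ((G 1)\<^sup>2)) - 2 * of_nat q"
    "(G 1 + cnj (G 1))\<^sup>2 = 2 * of_real (Re ((G 1)\<^sup>2)) + 2 * of_nat q"
    unfolding r n[symmetric] by (simp_all add: power2_eq_square algebra_simps)
qed

end

section \<open>Evaluation of the Gauss sums and of the periods\<close>

locale two_power_char_CD = two_power_char p s q \<psi> m g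
  for p s q :: nat and \<psi> :: "'a::{finite,field} \<Rightarrow> complex" and m :: nat and g :: 'a +
  fixes C D :: "nat \<Rightarrow> int"
  assumes CD: "1 \<le> r \<Longrightarrow> r \<le> m - 1 \<Longrightarrow>
      real p powr (real s / 2 ^ (r - 1)) = real_of_int ((C r)\<^sup>2 + (D r)\<^sup>2)
    \<and> [C r = -1] (mod 4) \<and> \<not> int p dvd C r"
begin

section \<open>Arithmetic of the integers C and D\<close>

definition N :: "nat \<Rightarrow> int" where "N r = (C r)\<^sup>2 + (D r)\<^sup>2"

text \<open>The scale factor with \<open>\<alpha> r\<close>^2 * \<open>N r\<close> = q, so that
  \<open>\<alpha> r\<close> (C r +- i D r) has modulus sqrt q. At r = 1 it is 1, which matches
  \<open>J\<close>.\<close>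

definition \<alpha> :: "nat \<Rightarrow> real" where "\<alpha> r = real q powr ((2 ^ (r - 1) - 1) / 2 ^ r)"

lemma q_pos: "real q > 0"
  using q1 by simp

lemma N_real:
  assumes "1 \<le> r" "r \<le> m - 1"
  shows "real_of_int (N r) = real q powr (1 / 2 ^ (r - 1))"
proof -
  have "real p > 0" using p by (simp add: prime_gt_0_nat)
  hence "real q powr (1 / 2 ^ (r - 1)) = (real p powr real s) powr (1 / 2 ^ (r - 1))"
    by (simp add: q_def powr_realpow)
  also have "\<dots> = real p powr (real s / 2 ^ (r - 1))" by (simp add: powr_powr)
  finally show ?thesis using CD[OF assms] by (simp add: N_def)
qed

lemma N_power:
  assumes "1 \<le> r" "r \<le> m - 1"
  shows "N r ^ 2 ^ (r - 1) = int q"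
proof -
  have "real_of_int (N r ^ 2 ^ (r - 1)) = (real q powr (1 / 2 ^ (r - 1))) ^ 2 ^ (r - 1)"
    by (simp add: N_real[OF assms])
  also have "\<dots> = (real q powr (1 / 2 ^ (r - 1))) powr real (2 ^ (r - 1))"
    using q_pos by (subst powr_realpow) simp_all
  also have "\<dots> = real_of_int (int q)"
    using q_pos by (simp add: powr_powr)
  finally show ?thesis by (simp only: of_int_eq_iff)
qed

lemma N_one: "N 1 = int q"
  using N_power[of 1] m2 by simp

lemma N_Suc_square:
  assumes "1 \<le> r" "Suc r \<le> m - 1"
  shows "(N (Suc r))\<^sup>2 = N r"
proof -
  have r: "(2::real) ^ r = 2 * 2 ^ (r - 1)" using assms(1) by (cases r) auto
  have "real_of_int ((N (Suc r))\<^sup>2) = (real q powr (1 / 2 ^ r))\<^sup>2"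
    using N_real[of "Suc r"] assms by simp
  also have "\<dots> = real q powr (1 / 2 ^ r + 1 / 2 ^ r)"
    unfolding power2_eq_square powr_add ..
  also have "1 / 2 ^ r + 1 / 2 ^ r = 1 / (2::real) ^ (r - 1)" unfolding r by simp
  also have "real q powr (1 / 2 ^ (r - 1)) = real_of_int (N r)" using N_real[of r] assms by simp
  finally show ?thesis by (simp only: of_int_eq_iff)
qed

lemma N_pos: "1 \<le> r \<Longrightarrow> r \<le> m - 1 \<Longrightarrow> N r > 0"
  using N_real[of r] q_pos by (metis of_int_0_less_iff powr_gt_zero less_irrefl)

lemma N_prime_power:
  assumes "1 \<le> r" "r \<le> m - 1"
  shows "\<exists>j. N r = int (p ^ j)"
proof -
  have "N r dvd int q"
    unfolding N_power[OF assms, symmetric] by (rule dvd_power) simp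
  hence "nat (N r) dvd p ^ s"
    using N_pos[OF assms] q_def by (metis int_dvd_int_iff int_nat_eq less_imp_le)
  then obtain j where "nat (N r) = p ^ j"
    using divides_primepow_nat[OF p] by blast
  thus ?thesis using N_pos[OF assms] by (metis int_nat_eq less_imp_le)
qed

lemma p_dvd_N:
  assumes "1 \<le> r" "r \<le> m - 1"
  shows "int p dvd N r"
proof -
  have "int p dvd int q" unfolding q_def using s by simp
  hence "int p dvd N r ^ 2 ^ (r - 1)" by (simp only: N_power[OF assms])
  thus ?thesis using p by (simp add: prime_dvd_power_int)
qed

lemma C_odd:
  assumes "1 \<le> r" "r \<le> m - 1"
  shows "odd (C r)"
proof -
  have "[C r = -1] (mod 4)" using CD[OF assms] by blast
  hence "4 dvd C r + 1" by (simp add: cong_iff_dvd_diff)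
  thus ?thesis by presburger
qed

lemma D_even:
  assumes "1 \<le> r" "r \<le> m - 1"
  shows "even (D r)"
proof -
  obtain j where "N r = int (p ^ j)" using N_prime_power[OF assms] by blast
  hence "odd (N r)" using odd_p by simp
  hence "even ((D r)\<^sup>2)" using C_odd[OF assms] unfolding N_def by simp
  thus ?thesis by simp
qed

text \<open>Both \<open>(C r, D r)\<close> and the square of \<open>(C (r + 1), D (r + 1))\<close> as a Gaussian integer are
  primitive representations of the same power of \<open>p\<close>.\<close>

lemma CD_descent:
  assumes r: "1 \<le> r" "Suc r \<le> m - 1"
  shows "C r = (D (Suc r))\<^sup>2 - (C (Suc r))\<^sup>2"
    and "D r = 2 * C (Suc r) * D (Suc r) \<or> D r = - (2 * C (Suc r) * D (Suc r))"
proof -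
  define c d where "c = C (Suc r)" and "d = D (Suc r)"
  define X Y where "X = c\<^sup>2 - d\<^sup>2" and "Y = 2 * c * d"
  have r1: "1 \<le> r" "r \<le> m - 1" and r2: "1 \<le> Suc r" "Suc r \<le> m - 1" using r by auto
  obtain j where j: "N r = int (p ^ j)" using N_prime_power[OF r1] by blast
  have oc: "odd c" and ed: "even d" unfolding c_def d_def by (rule C_odd[OF r2], rule D_even[OF r2])
  have "X\<^sup>2 + Y\<^sup>2 = (c\<^sup>2 + d\<^sup>2)\<^sup>2"
    unfolding X_def Y_def by (simp add: power2_eq_square algebra_simps)
  hence XY: "X\<^sup>2 + Y\<^sup>2 = N r"
    using N_Suc_square[OF r] by (simp add: N_def c_def d_def)
  have pp: "prime (int p)" using p by simp
  have "\<not> int p dvd X"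
  proof
    assume "int p dvd X"
    moreover have "int p dvd c\<^sup>2 + d\<^sup>2" using p_dvd_N[OF r2] unfolding N_def c_def d_def .
    ultimately have "int p dvd X + (c\<^sup>2 + d\<^sup>2)" by (rule dvd_add)
    hence "int p dvd 2 * c\<^sup>2" by (simp add: X_def)
    moreover have "\<not> int p dvd 2"
      using p odd_p by (metis even_numeral int_dvd_int_iff of_nat_numeral primes_dvd_imp_eq two_is_prime_nat)
    ultimately have "int p dvd c" using pp by (simp add: prime_dvd_mult_iff prime_dvd_power_iff)
    thus False using CD[OF r2] by (simp add: c_def)
  qed
  moreover have "odd X" unfolding X_def using oc ed by simp
  ultimately have sq: "X\<^sup>2 = (C r)\<^sup>2"
    using CD[OF r1] C_odd[OF r1] XY j N_def p odd_p
    by (intro sum_squares_prime_power_unique[where p = p and k = j and b = Y and d = "D r"]) auto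
  \<comment> \<open>As c is odd and d even, X is 1 modulo 4, while C r is -1 modulo 4; this fixes
    the sign left open by the squares.\<close>
  have "X \<noteq> C r"
  proof
    assume "X = C r"
    obtain c' where c': "c = 2 * c' + 1" using oc by (elim oddE)
    obtain d' where d': "d = 2 * d'" using ed by (elim evenE)
    have "X = 4 * (c' * c' + c' - d' * d') + 1"
      unfolding X_def c' d' by (simp add: power2_eq_square algebra_simps)
    moreover have "4 dvd X + 1" using CD[OF r1] \<open>X = C r\<close> by (simp add: cong_iff_dvd_diff)
    ultimately show False by presburger
  qed
  hence "C r = - X" using sq by (metis power2_eq_iff)
  thus "C r = (D (Suc r))\<^sup>2 - (C (Suc r))\<^sup>2" by (simp add: X_def c_def d_def)
  have "(D r)\<^sup>2 = Y\<^sup>2" using XY sq N_def[of r] by simp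
  thus "D r = 2 * C (Suc r) * D (Suc r) \<or> D r = - (2 * C (Suc r) * D (Suc r))"
    unfolding power2_eq_iff by (simp add: Y_def c_def d_def)
qed

lemma alpha_one: "\<alpha> 1 = 1"
  using q_pos by (simp add: \<alpha>_def)

lemma alpha_square:
  assumes "1 \<le> r"
  shows "(\<alpha> r)\<^sup>2 * real q powr (1 / 2 ^ (r - 1)) = real q"
proof -
  have r: "(2::real) ^ r = 2 * 2 ^ (r - 1)" using assms by (cases r) auto
  have "(\<alpha> r)\<^sup>2 * real q powr (1 / 2 ^ (r - 1))
      = real q powr ((2 ^ (r - 1) - 1) / 2 ^ r + (2 ^ (r - 1) - 1) / 2 ^ r + 1 / 2 ^ (r - 1))"
    unfolding \<alpha>_def power2_eq_square powr_add ..
  also have "(2 ^ (r - 1) - 1) / 2 ^ r + (2 ^ (r - 1) - 1) / 2 ^ r + 1 / 2 ^ (r - 1) = (1 :: real)"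
    unfolding r by (simp add: field_simps)
  finally show ?thesis using q_pos by simp
qed

lemma alpha_Suc_square:
  assumes "1 \<le> r"
  shows "real q powr (1 / 2) * \<alpha> r = (\<alpha> (Suc r))\<^sup>2"
proof -
  have r: "(2::real) ^ r = 2 * 2 ^ (r - 1)" using assms by (cases r) auto
  have "(\<alpha> (Suc r))\<^sup>2 = real q powr ((2 ^ r - 1) / 2 ^ Suc r + (2 ^ r - 1) / 2 ^ Suc r)"
    unfolding \<alpha>_def power2_eq_square powr_add diff_Suc_1 ..
  also have "(2 ^ r - 1) / 2 ^ Suc r + (2 ^ r - 1) / 2 ^ Suc r = 1 / 2 + (2 ^ (r - 1) - 1) / (2 :: real) ^ r"
    unfolding power_Suc r by (simp add: field_simps)
  finally show ?thesis by (simp add: \<alpha>_def powr_add)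
qed

lemma sqrt_q:
  assumes "m \<ge> 3"
  shows "real (p ^ (s div 2)) = real q powr (1 / 2)"
proof -
  have "(real (p ^ (s div 2)))\<^sup>2 = real q"
    unfolding q_def using even_s[OF assms] by (auto elim!: evenE simp: power_mult[symmetric] mult.commute)
  hence "real (p ^ (s div 2)) = sqrt (real q)" by (metis of_nat_0_le_iff real_sqrt_unique)
  thus ?thesis using q_pos by (simp add: powr_half_sqrt)
qed

section \<open>The Gauss sums in terms of C and D\<close>

lemma J_eq_C: "\<exists>\<sigma> :: int. (\<sigma> = 1 \<or> \<sigma> = -1)
    \<and> J = of_int (if m = 2 then - C 1 else C 1) + \<i> * of_int (\<sigma> * D 1)"
proof -
  obtain a b where ab: "J = of_int a + \<i> * of_int b" "a\<^sup>2 + b\<^sup>2 = int q" "even b"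
    "m = 2 \<Longrightarrow> [a = 1] (mod 4)" "m \<ge> 3 \<Longrightarrow> [a = -1] (mod 4)"
    using J_gaussian_int by metis
  have one: "1 \<le> (1::nat)" "1 \<le> m - 1" using m2 by auto
  have "odd (a\<^sup>2)" using ab(2,3) odd_p q_def by (metis even_add even_of_nat even_power pos2)
  hence "odd a" by simp
  hence sq: "a\<^sup>2 = (C 1)\<^sup>2"
    using J_not_dvd[OF ab(1)] CD[OF one] C_odd[OF one] ab(2) N_one N_def[of 1] p odd_p q_def
    by (intro sum_squares_prime_power_unique[where p = p and k = s and b = b and d = "D 1"]) auto
  have "b\<^sup>2 = (D 1)\<^sup>2"
    using ab(2) N_one N_def[of 1] sq by simp
  hence b: "b = D 1 \<or> b = - D 1"
    by (simp add: power2_eq_iff)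
  have a: "a = C 1 \<or> a = - C 1" using sq by (simp add: power2_eq_iff)
  have c4: "4 dvd C 1 + 1" using CD[OF one] by (simp add: cong_iff_dvd_diff)
  have "a = (if m = 2 then - C 1 else C 1)"
  proof (cases "m = 2")
    case True
    hence "4 dvd a - 1" using ab(4) by (simp add: cong_iff_dvd_diff)
    hence "a \<noteq> C 1" using c4 by presburger
    thus ?thesis using a True by simp
  next
    case False
    hence "4 dvd a + 1" using ab(5) m2 by (simp add: cong_iff_dvd_diff)
    hence "a \<noteq> - C 1" using c4 by presburger
    thus ?thesis using a False by simp
  qed
  moreover obtain \<sigma> :: int where "\<sigma> = 1 \<or> \<sigma> = -1" "b = \<sigma> * D 1"
    using b by (metis mult_1 mult_minus1)
  ultimately show ?thesis using ab(1) by blast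
qed

text \<open>\<open>J\<close> takes the place of the quadratic Gauss sum at k = 1. With this
  convention one recursion covers both \<open>G_square_2\<close> and \<open>G_recursion\<close>, and
  its starting value is the pair C 1, D 1.\<close>

definition H :: "nat \<Rightarrow> complex" where "H k = (if k = 1 then J else G (2 ^ (m - k)))"

lemma H_recursion:
  assumes "m \<ge> 3" "1 \<le> k" "Suc k \<le> m - 1"
  shows "(H (Suc k))\<^sup>2 = - of_real (real q powr (1 / 2)) * H k"
proof -
  have G1: "G (2 ^ (m - 1)) = - of_real (real q powr (1 / 2))"
    using G_quadratic[OF even_s] assms(1) sqrt_q[OF assms(1)] by (metis of_real_of_nat_eq)
  show ?thesis
  proof (cases "k = 1")
    case True
    thus ?thesis using G_square_2 G1 assms by (simp add: H_def numeral_2_eq_2)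
  next
    case False
    thus ?thesis using G_recursion[of "Suc k"] G1 assms by (simp add: H_def)
  qed
qed

text \<open>The recursion gives H (k + 1)^2 = \<open>\<epsilon>\<close> X^2 with X =
  \<open>\<alpha>\<close> (C +- i D) at k + 1. If \<open>\<epsilon>\<close> = -1, then H (k + 1) =
  +- i X has real part +- \<open>\<alpha>\<close> D, which the integrality of
  \<open>cyclotomic_half\<close> excludes. The sign at order k is thus decided only by looking at
  order k + 1.\<close>

lemma H_step:
  fixes \<epsilon> :: complex and \<sigma> :: int
  assumes m3: "m \<ge> 3" and k: "1 \<le> k" "Suc k \<le> m - 1"
    and \<epsilon>: "\<epsilon> = 1 \<or> \<epsilon> = -1" and \<sigma>: "\<sigma> = 1 \<or> \<sigma> = -1"
    and H: "H k = \<epsilon> * of_real (\<alpha> k) * (of_int (C k) + \<i> * of_int (\<sigma> * D k))"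
  shows "\<epsilon> = 1"
    and "\<exists>\<epsilon>' \<sigma>' :: int. (\<epsilon>' = 1 \<or> \<epsilon>' = -1) \<and> (\<sigma>' = 1 \<or> \<sigma>' = -1) \<and>
      H (Suc k) = of_int \<epsilon>' * of_real (\<alpha> (Suc k)) * (of_int (C (Suc k)) + \<i> * of_int (\<sigma>' * D (Suc k)))"
proof -
  define c d where "c = C (Suc k)" and "d = D (Suc k)"
  have k': "1 \<le> Suc k" "Suc k \<le> m - 1" using k by auto
  \<comment> \<open>The sign is chosen to make (c + i \<open>\<tau>\<close> d)^2 equal to -(C k + i
    \<open>\<sigma>\<close> D k); the minus sign cancels the one in the recursion.\<close>
  obtain \<tau> :: int where \<tau>: "\<tau> = 1 \<or> \<tau> = -1" "\<sigma> * D k = - (2 * \<tau> * c * d)"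
  proof (cases "\<sigma> * D k = - (2 * c * d)")
    case True
    thus ?thesis using that[of 1] by simp
  next
    case False
    hence "\<sigma> * D k = 2 * c * d" using CD_descent(2)[OF k] \<sigma> unfolding c_def d_def by auto
    thus ?thesis using that[of "-1"] by simp
  qed
  define X where "X = of_real (\<alpha> (Suc k)) * (of_int c + \<i> * of_int (\<tau> * d))"
  have \<tau>2: "\<tau> * \<tau> = 1" using \<tau>(1) by auto
  have sq: "(of_int c + \<i> * of_int (\<tau> * d))\<^sup>2 = - (of_int (C k) + \<i> * of_int (\<sigma> * D k) :: complex)"
  proof -
    have "(of_int c + \<i> * of_int (\<tau> * d))\<^sup>2
        = (of_int (c * c - (\<tau> * \<tau>) * (d * d)) + \<i> * of_int (2 * \<tau> * c * d) :: complex)"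
      by (simp add: power2_eq_square algebra_simps)
    thus ?thesis
      unfolding \<tau>2 \<tau>(2) CD_descent(1)[OF k] c_def d_def by (simp add: power2_eq_square)
  qed
  have al: "(of_real (\<alpha> (Suc k)) :: complex)\<^sup>2 = of_real (real q powr (1 / 2)) * of_real (\<alpha> k)"
    using alpha_Suc_square[OF k(1)] by (metis of_real_mult of_real_power)
  have "(H (Suc k))\<^sup>2 = \<epsilon> * X\<^sup>2"
    unfolding H_recursion[OF m3 k] H X_def power_mult_distrib sq al
    by (simp only: mult_minus_left mult_minus_right mult_ac)
  show eps1: "\<epsilon> = 1"
  proof (rule ccontr)
    assume "\<epsilon> \<noteq> 1"
    hence "(H (Suc k))\<^sup>2 = (\<i> * X)\<^sup>2"
      using \<epsilon> \<open>(H (Suc k))\<^sup>2 = \<epsilon> * X\<^sup>2\<close> by (simp add: power_mult_distrib)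
    hence HX: "H (Suc k) = \<i> * X \<or> H (Suc k) = - (\<i> * X)" by (simp add: power2_eq_iff)
    define R where "R = Re (G (2 ^ (m - Suc k)))"
    have "H (Suc k) = G (2 ^ (m - Suc k))" using k by (simp add: H_def)
    hence "R = \<alpha> (Suc k) * of_int (\<tau> * d) \<or> R = - (\<alpha> (Suc k) * of_int (\<tau> * d))"
      using HX unfolding R_def X_def by auto
    hence "R\<^sup>2 = (\<alpha> (Suc k) * of_int (\<tau> * d))\<^sup>2" by (auto simp: power2_eq_iff)
    also have "\<dots> = (\<alpha> (Suc k))\<^sup>2 * of_int (\<tau> * \<tau> * d\<^sup>2)" by (simp add: power2_eq_square mult_ac)
    finally have R2: "R\<^sup>2 = (\<alpha> (Suc k))\<^sup>2 * of_int (d\<^sup>2)" unfolding \<tau>2 by simp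
    have "N (Suc k) dvd int q" unfolding N_power[OF k', symmetric] by (rule dvd_power) simp
    then obtain t where t: "int q = N (Suc k) * t" by blast
    have "(\<alpha> (Suc k))\<^sup>2 * of_int (N (Suc k)) = real q"
      using alpha_square[of "Suc k"] N_real[OF k'] by simp
    also have "real q = of_int (N (Suc k) * t)" using t by (metis of_int_of_nat_eq)
    finally have al2: "(\<alpha> (Suc k))\<^sup>2 = of_int t" using N_pos[OF k'] by simp
    \<comment> \<open>Evenness of D is decisive here: (2z - q)^2 = q R^2 = q t d^2 becomes four
      times an integer.\<close>
    obtain d' where d': "d = 2 * d'" using D_even[OF k'] unfolding d_def by (elim evenE)
    define z :: complex where "z = (of_nat q - of_nat (p ^ (s div 2)) * of_real R) / 2"
    have "cyclotomic z"
      using cyclotomic_half[of "Suc (Suc k)"] k unfolding z_def R_def by simp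
    moreover have "(2 * z - of_nat q)\<^sup>2 = 4 * of_int (int q * t * d'\<^sup>2)"
    proof -
      have "2 * z - of_nat q = of_real (- (real q powr (1 / 2) * R))"
        unfolding z_def sqrt_q[OF m3, symmetric] by (simp add: diff_divide_distrib)
      hence "(2 * z - of_nat q)\<^sup>2 = of_real ((real q powr (1 / 2))\<^sup>2 * R\<^sup>2)"
        by (simp add: power_mult_distrib)
      also have "(real q powr (1 / 2))\<^sup>2 = real q"
        using q_pos by (simp add: powr_half_sqrt)
      finally show ?thesis unfolding R2 al2 d' by (simp add: power_mult_distrib mult_ac)
    qed
    ultimately show False by (rule cyclotomic_half_contradiction)
  qed
  have "H (Suc k) = X \<or> H (Suc k) = - X"
    using \<open>(H (Suc k))\<^sup>2 = \<epsilon> * X\<^sup>2\<close> eps1 by (simp add: power2_eq_iff)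
  then obtain \<epsilon>' :: int where "\<epsilon>' = 1 \<or> \<epsilon>' = -1" "H (Suc k) = of_int \<epsilon>' * X"
    by (metis mult_1 mult_minus1 of_int_1 of_int_minus)
  thus "\<exists>\<epsilon>' \<sigma>' :: int. (\<epsilon>' = 1 \<or> \<epsilon>' = -1) \<and> (\<sigma>' = 1 \<or> \<sigma>' = -1) \<and>
      H (Suc k) = of_int \<epsilon>' * of_real (\<alpha> (Suc k)) * (of_int (C (Suc k)) + \<i> * of_int (\<sigma>' * D (Suc k)))"
    using \<tau>(1) unfolding X_def c_def d_def by (metis mult.assoc)
qed

lemma H_form:
  assumes m3: "m \<ge> 3" and "1 \<le> k" "k \<le> m - 1"
  shows "\<exists>\<epsilon> \<sigma> :: int. (\<epsilon> = 1 \<or> \<epsilon> = -1) \<and> (\<sigma> = 1 \<or> \<sigma> = -1) \<and>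
      H k = of_int \<epsilon> * of_real (\<alpha> k) * (of_int (C k) + \<i> * of_int (\<sigma> * D k))"
  using assms(2,3)
proof (induction k rule: dec_induct)
  case base
  obtain \<sigma> :: int where \<sigma>: "\<sigma> = 1 \<or> \<sigma> = -1"
    "J = of_int (if m = 2 then - C 1 else C 1) + \<i> * of_int (\<sigma> * D 1)"
    using J_eq_C by blast
  have "H 1 = of_int 1 * of_real (\<alpha> 1) * (of_int (C 1) + \<i> * of_int (\<sigma> * D 1))"
    using \<sigma>(2) m3 unfolding alpha_one by (simp add: H_def)
  thus ?case using \<sigma>(1) by blast
next
  case (step k)
  then obtain \<epsilon> \<sigma> :: int where *: "\<epsilon> = 1 \<or> \<epsilon> = -1" "\<sigma> = 1 \<or> \<sigma> = -1"
    "H k = of_int \<epsilon> * of_real (\<alpha> k) * (of_int (C k) + \<i> * of_int (\<sigma> * D k))" by auto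
  thus ?case using H_step(2)[OF m3 step(1) step.prems, of "of_int \<epsilon>" \<sigma>] by auto
qed

text \<open>The sign is removed by the existence of a next order within range, so k = m - 1 keeps
  its sign.\<close>

lemma H_form_exact:
  assumes m3: "m \<ge> 3" and k: "1 \<le> k" "Suc k \<le> m - 1"
  shows "\<exists>\<sigma> :: int. (\<sigma> = 1 \<or> \<sigma> = -1) \<and> H k = of_real (\<alpha> k) * (of_int (C k) + \<i> * of_int (\<sigma> * D k))"
proof -
  obtain \<epsilon> \<sigma> :: int where *: "\<epsilon> = 1 \<or> \<epsilon> = -1" "\<sigma> = 1 \<or> \<sigma> = -1"
    "H k = of_int \<epsilon> * of_real (\<alpha> k) * (of_int (C k) + \<i> * of_int (\<sigma> * D k))"
    using H_form[OF m3 k(1)] k by auto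
  hence "(of_int \<epsilon> :: complex) = 1"
    by (intro H_step(1)[OF m3 k, of _ \<sigma>]) auto
  thus ?thesis using * by auto
qed

section \<open>The values of the periods and their power sums\<close>

definition tC :: "nat \<Rightarrow> complex" where
  "tC k = 2 ^ (k - 1) * of_int (C k) * of_real (\<alpha> k)"

definition tD :: "nat \<Rightarrow> complex" where
  "tD k = 2 ^ (k - 1) * of_int (D k) * of_real (\<alpha> k)"

text \<open>For k < m the part is 2^(k-1) times the real part of (-i)^i G. Each quarter turn
  exchanges the component from C k with the one from D k.\<close>

lemma order_part_values:
  fixes \<epsilon> \<sigma> :: int
  assumes k: "2 \<le> k" "k \<le> m - 1"
    and G: "G (2 ^ (m - k)) = of_int \<epsilon> * of_real (\<alpha> k) * (of_int (C k) + \<i> * of_int (\<sigma> * D k))"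
  shows "i mod 4 = 0 \<Longrightarrow> order_part k (2 ^ (k - 2) * i) = of_int \<epsilon> * tC k"
    and "i mod 4 = 1 \<Longrightarrow> order_part k (2 ^ (k - 2) * i) = of_int (\<epsilon> * \<sigma>) * tD k"
    and "i mod 4 = 2 \<Longrightarrow> order_part k (2 ^ (k - 2) * i) = - (of_int \<epsilon> * tC k)"
    and "i mod 4 = 3 \<Longrightarrow> order_part k (2 ^ (k - 2) * i) = - (of_int (\<epsilon> * \<sigma>) * tD k)"
proof -
  have km: "k \<noteq> m" using k m2 by linarith
  have pw: "(2::complex) ^ (k - 1) = 2 * 2 ^ (k - 2)"
    using k by (simp add: Suc_diff_le numeral_2_eq_2 Suc_diff_Suc flip: power_Suc)
  show "i mod 4 = 0 \<Longrightarrow> order_part k (2 ^ (k - 2) * i) = of_int \<epsilon> * tC k"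
    "i mod 4 = 1 \<Longrightarrow> order_part k (2 ^ (k - 2) * i) = of_int (\<epsilon> * \<sigma>) * tD k"
    "i mod 4 = 2 \<Longrightarrow> order_part k (2 ^ (k - 2) * i) = - (of_int \<epsilon> * tC k)"
    "i mod 4 = 3 \<Longrightarrow> order_part k (2 ^ (k - 2) * i) = - (of_int (\<epsilon> * \<sigma>) * tD k)"
    unfolding order_part_mult tC_def tD_def pw G using km
    by (simp_all add: minus_i_power algebra_simps)
qed

lemma G_eq_H: "2 \<le> k \<Longrightarrow> G (2 ^ (m - k)) = H k"
  by (simp add: H_def)

lemma order_part_C:
  assumes m3: "m \<ge> 3" and k: "2 \<le> k" "k \<le> m - 2"
  shows "i mod 4 = 0 \<Longrightarrow> order_part k (2 ^ (k - 2) * i) = tC k"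
    and "i mod 4 = 2 \<Longrightarrow> order_part k (2 ^ (k - 2) * i) = - tC k"
proof -
  have k'': "1 \<le> k" "Suc k \<le> m - 1" using k m3 by linarith+
  obtain \<sigma> :: int where "H k = of_real (\<alpha> k) * (of_int (C k) + \<i> * of_int (\<sigma> * D k))"
    using H_form_exact[OF m3 k''] by blast
  hence G: "G (2 ^ (m - k)) = of_int 1 * of_real (\<alpha> k) * (of_int (C k) + \<i> * of_int (\<sigma> * D k))"
    using G_eq_H[OF k(1)] by simp
  have k': "k \<le> m - 1" using k by simp
  show "i mod 4 = 0 \<Longrightarrow> order_part k (2 ^ (k - 2) * i) = tC k"
    "i mod 4 = 2 \<Longrightarrow> order_part k (2 ^ (k - 2) * i) = - tC k"
    using order_part_values(1,3)[OF k(1) k' G, of i] by simp_all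
qed

text \<open>All unknown signs are absorbed in one \<open>\<tau>\<close> that does not depend on i.
  Hence the classes 1 and 3 modulo 4 always receive opposite values, whichever comes first.\<close>

lemma order_part_D:
  assumes m3: "m \<ge> 3" and k: "2 \<le> k" "k \<le> m - 1"
  shows "\<exists>\<tau> :: complex. (\<tau> = 1 \<or> \<tau> = -1) \<and> (\<forall>i. i mod 4 = 1 \<longrightarrow> order_part k (2 ^ (k - 2) * i) = \<tau> * tD k)
     \<and> (\<forall>i. i mod 4 = 3 \<longrightarrow> order_part k (2 ^ (k - 2) * i) = - (\<tau> * tD k))"
proof -
  obtain \<epsilon> \<sigma> :: int where *: "\<epsilon> = 1 \<or> \<epsilon> = -1" "\<sigma> = 1 \<or> \<sigma> = -1"
    "G (2 ^ (m - k)) = of_int \<epsilon> * of_real (\<alpha> k) * (of_int (C k) + \<i> * of_int (\<sigma> * D k))"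
    using H_form[OF m3, of k] k G_eq_H[OF k(1)] by auto
  show ?thesis
    using order_part_values(2,4)[OF k *(3)] *(1,2)
    by (intro exI[of _ "of_int (\<epsilon> * \<sigma>)"]) auto
qed

lemma G_quadratic_powr: "m \<ge> 3 \<Longrightarrow> G (2 ^ (m - 1)) = - of_real (real q powr (1 / 2))"
  using G_quadratic[OF even_s] sqrt_q by (metis of_real_of_nat_eq)

text \<open>At odd indices only the characters of order 2 and 4 contribute, and the factor (-1)^j
  turns -sqrt q into sqrt q.\<close>

lemma period_odd:
  assumes m3: "m \<ge> 3"
  shows "\<exists>\<tau> :: complex. (\<tau> = 1 \<or> \<tau> = -1)
     \<and> (\<forall>i. i mod 4 = 1 \<longrightarrow> period i = of_real (real q powr (1 / 2)) + \<tau> * tD 2)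
     \<and> (\<forall>i. i mod 4 = 3 \<longrightarrow> period i = of_real (real q powr (1 / 2)) - \<tau> * tD 2)"
proof -
  have per: "period i = of_real (real q powr (1 / 2)) + order_part 2 i" if "odd i" for i
  proof -
    have "(\<Sum>k = 2..m. order_part k i) = (\<Sum>k\<in>{2}. order_part k i)"
    proof (rule sum.mono_neutral_right)
      show "\<forall>k\<in>{2..m} - {2}. order_part k i = 0"
        using order_part_odd_zero[OF that, of 0] by auto
    qed (use m2 in auto)
    thus ?thesis unfolding period_decomp G_quadratic_powr[OF m3] using that by simp
  qed
  have m31: "2 \<le> m - 1" using m3 by simp
  obtain \<tau> :: complex where \<tau>: "\<tau> = 1 \<or> \<tau> = -1"
    "\<And>i. i mod 4 = 1 \<Longrightarrow> order_part 2 i = \<tau> * tD 2" "\<And>i. i mod 4 = 3 \<Longrightarrow> order_part 2 i = - (\<tau> * tD 2)"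
    using order_part_D[OF m3 order.refl m31] by auto
  have odd: "odd i" if "i mod 4 = 1 \<or> i mod 4 = 3" for i :: nat using that by presburger
  show ?thesis using \<tau> per odd by (intro exI[of _ \<tau>]) auto
qed

text \<open>For j = 2^t i with i odd, the quotient j / 2^(k-2) is divisible by 4 if k <= t, is 2
  modulo 4 if k = t + 1, and is odd if k = t + 2. These give C k, -C (t + 1) and +-D (t + 2); higher
  orders vanish.\<close>

lemma period_valuation:
  assumes m3: "m \<ge> 3" and t: "1 \<le> t" "t \<le> m - 3"
  defines "A \<equiv> - of_real (real q powr (1 / 2)) + (\<Sum>k = 2..t. tC k) - tC (t + 1)"
  shows "\<exists>\<tau> :: complex. (\<tau> = 1 \<or> \<tau> = -1)
     \<and> (\<forall>i. i mod 4 = 1 \<longrightarrow> period (2 ^ t * i) = A + \<tau> * tD (t + 2))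
     \<and> (\<forall>i. i mod 4 = 3 \<longrightarrow> period (2 ^ t * i) = A - \<tau> * tD (t + 2))"
proof -
  have per: "period (2 ^ t * i) = A + order_part (t + 2) (2 ^ t * i)" if i: "odd i" for i
  proof -
    have "(\<Sum>k = 2..m. order_part k (2 ^ t * i)) = (\<Sum>k = 2..Suc (Suc t). order_part k (2 ^ t * i))"
    proof (rule sum.mono_neutral_right)
      show "\<forall>k\<in>{2..m} - {2..Suc (Suc t)}. order_part k (2 ^ t * i) = 0"
        using order_part_odd_zero[OF i, of t] by auto
    qed (use t in auto)
    also have "\<dots> = (\<Sum>k = 2..t. order_part k (2 ^ t * i)) + order_part (t + 1) (2 ^ t * i)
        + order_part (t + 2) (2 ^ t * i)"
      using t by simp
    also have "(\<Sum>k = 2..t. order_part k (2 ^ t * i)) = (\<Sum>k = 2..t. tC k)"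
    proof (rule sum.cong[OF refl])
      fix k assume "k \<in> {2..t}"
      hence k: "2 \<le> k" "k \<le> t" by auto
      have eq: "2 ^ t * i = 2 ^ (k - 2) * (2 ^ (t - k) * 4 * i)"
      proof -
        have "t = (k - 2) + (t - k) + 2" using k by simp
        hence "(2::nat) ^ t = 2 ^ (k - 2) * 2 ^ (t - k) * 2 ^ 2" by (metis power_add)
        thus ?thesis by simp
      qed
      have "k \<le> m - 2" using k t by simp
      thus "order_part k (2 ^ t * i) = tC k"
        unfolding eq by (intro order_part_C(1)[OF m3 k(1)]) simp_all
    qed
    also have "order_part (t + 1) (2 ^ t * i) = - tC (t + 1)"
    proof -
      have eq: "2 ^ t * i = 2 ^ (t + 1 - 2) * (2 * i)" using t by (cases t) auto
      have "(2 * i) mod 4 = 2" using i by presburger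
      thus ?thesis unfolding eq by (intro order_part_C(2)[OF m3]) (use t in simp_all)
    qed
    finally show ?thesis
      unfolding period_decomp G_quadratic_powr[OF m3] A_def using t by simp
  qed
  have t2: "2 \<le> t + 2" "t + 2 \<le> m - 1" using t by linarith+
  obtain \<tau> :: complex where \<tau>: "\<tau> = 1 \<or> \<tau> = -1"
    "\<And>i. i mod 4 = 1 \<Longrightarrow> order_part (t + 2) (2 ^ t * i) = \<tau> * tD (t + 2)"
    "\<And>i. i mod 4 = 3 \<Longrightarrow> order_part (t + 2) (2 ^ t * i) = - (\<tau> * tD (t + 2))"
    using order_part_D[OF m3 t2] by auto
  have odd: "odd i" if "i mod 4 = 1 \<or> i mod 4 = 3" for i :: nat using that by presburger
  show ?thesis using \<tau> per odd by (intro exI[of _ \<tau>]) auto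
qed

lemma period_last:
  assumes m3: "m \<ge> 3"
  defines "P \<equiv> - of_real (real q powr (1 / 2)) + (\<Sum>k = 2..m-2. tC k)"
  shows "period (2 ^ (m - 2) * i) = P + order_part (m - 1) (2 ^ (m - 2) * i) + order_part m (2 ^ (m - 2) * i)"
proof -
  obtain r where "m = 3 + r" using m3 le_Suc_ex by blast
  hence r: "m = Suc (Suc (Suc r))" by simp
  have "(\<Sum>k = 2..m. order_part k (2 ^ (m - 2) * i)) = (\<Sum>k = 2..m-2. order_part k (2 ^ (m - 2) * i))
      + order_part (m - 1) (2 ^ (m - 2) * i) + order_part m (2 ^ (m - 2) * i)"
    unfolding r by simp
  also have "(\<Sum>k = 2..m-2. order_part k (2 ^ (m - 2) * i)) = (\<Sum>k = 2..m-2. tC k)"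
  proof (rule sum.cong[OF refl])
    fix k assume "k \<in> {2..m-2}"
    hence k: "2 \<le> k" "k \<le> m - 2" by auto
    have eq: "2 ^ (m - 2) * i = 2 ^ (k - 2) * (2 ^ (m - 2 - k) * 4 * i)"
    proof -
      have "m - 2 = (k - 2) + (m - 2 - k) + 2" using k by simp
      hence "(2::nat) ^ (m - 2) = 2 ^ (k - 2) * 2 ^ (m - 2 - k) * 2 ^ 2" by (metis power_add)
      thus ?thesis by simp
    qed
    show "order_part k (2 ^ (m - 2) * i) = tC k"
      unfolding eq by (intro order_part_C(1)[OF m3 k]) simp
  qed
  finally show ?thesis
    unfolding period_decomp G_quadratic_powr[OF m3] P_def using m3 by simp
qed

text \<open>This makes both radicands nonnegative, so that the real square roots square back to
  them.\<close>

lemma C_bound: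
  shows "\<bar>real_of_int (C (m - 1))\<bar> \<le> real q powr (1 / 2 ^ (m - 1))"
proof -
  have m1: "1 \<le> m - 1" "m - 1 \<le> m - 1" using m2 by auto
  have pw: "(2::real) ^ (m - 1) = 2 * 2 ^ (m - 1 - 1)" using m1 by (cases "m - 1") auto
  have "(real_of_int (C (m - 1)))\<^sup>2 \<le> real_of_int (N (m - 1))" by (simp add: N_def)
  also have "\<dots> = real q powr (1 / 2 ^ (m - 1 - 1))" by (rule N_real[OF m1])
  also have "1 / 2 ^ (m - 1 - 1) = 1 / 2 ^ (m - 1) + 1 / (2::real) ^ (m - 1)"
    unfolding pw by simp
  also have "real q powr \<dots> = (real q powr (1 / 2 ^ (m - 1)))\<^sup>2"
    unfolding power2_eq_square powr_add ..
  finally have "\<bar>real_of_int (C (m - 1))\<bar> \<le> \<bar>real q powr (1 / 2 ^ (m - 1))\<bar>"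
    by (simp only: abs_le_square_iff)
  thus ?thesis by simp
qed

text \<open>The four parts of order 2^m are +-Z0 for even i and +-Z1 for odd i, so their squares
  suffice, and these follow from the real part of (G 1)^2. A change of \<open>\<epsilon>\<close>
  exchanges the even and the odd pair, which leaves the sum unchanged. P and U are kept general to
  serve m = 2, with P = 0, as well as m >= 3.\<close>

lemma last_values:
  fixes \<epsilon> :: int and P U :: complex
  assumes \<epsilon>: "\<epsilon> = 1 \<or> \<epsilon> = -1"
    and Re: "Re ((G 1)\<^sup>2) = of_int \<epsilon> * (\<alpha> m)\<^sup>2 * of_int (C (m - 1))"
  defines "V \<equiv> 2 ^ (m - 2) * of_real (\<alpha> m) * \<i>"
    and "Sm \<equiv> complex_of_real (sqrt (2 * (real q powr (1 / 2 ^ (m - 1)) - of_int (C (m - 1)))))"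
    and "Sp \<equiv> complex_of_real (sqrt (2 * (real q powr (1 / 2 ^ (m - 1)) + of_int (C (m - 1)))))"
  shows "(\<Sum>i<4. (P + (-1) ^ i * of_int \<epsilon> * U + order_part m (2 ^ (m - 2) * i)) ^ n)
      = (P + U + V * Sm) ^ n + (P + U - V * Sm) ^ n + (P - U + V * Sp) ^ n + (P - U - V * Sp) ^ n"
proof -
  define Z0 where "Z0 = 2 ^ (m - 2) * (G 1 - cnj (G 1))"
  define Z1 where "Z1 = - (2 ^ (m - 2) * \<i> * (G 1 + cnj (G 1)))"
  define c where "c = real_of_int (C (m - 1))"
  define x where "x = real q powr (1 / 2 ^ (m - 1))"
  have Sm2: "Sm\<^sup>2 = of_real (2 * (x - c))" and Sp2: "Sp\<^sup>2 = of_real (2 * (x + c))"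
    using C_bound unfolding Sm_def Sp_def x_def c_def of_real_power[symmetric]
    by (simp_all add: abs_le_iff)
  have qx: "real q = (\<alpha> m)\<^sup>2 * x"
    unfolding x_def using alpha_square[of m] m2 by simp
  have Re': "Re ((G 1)\<^sup>2) = of_int \<epsilon> * (\<alpha> m)\<^sup>2 * c" using Re by (simp add: c_def)
  have qc: "(of_nat q :: complex) = of_real ((\<alpha> m)\<^sup>2 * x)" using qx by (metis of_real_of_nat_eq)
  have V2: "V\<^sup>2 = - ((2 ^ (m - 2))\<^sup>2 * of_real ((\<alpha> m)\<^sup>2))"
    by (simp add: V_def power_mult_distrib)
  have Z0: "Z0\<^sup>2 = - ((2 ^ (m - 2))\<^sup>2 * of_real ((\<alpha> m)\<^sup>2)) * of_real (2 * (x - of_int \<epsilon> * c))"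
    unfolding Z0_def power_mult_distrib G_one_square(1) Re' qc by (simp add: algebra_simps)
  have Z1: "Z1\<^sup>2 = - ((2 ^ (m - 2))\<^sup>2 * of_real ((\<alpha> m)\<^sup>2)) * of_real (2 * (x + of_int \<epsilon> * c))"
    unfolding Z1_def power2_minus power_mult_distrib G_one_square(2) Re' qc by (simp add: algebra_simps)
  have o: "order_part m (2 ^ (m - 2) * i) = 2 ^ (m - 2) * ((- \<i>) ^ i * G 1 - cnj ((- \<i>) ^ i * G 1))" for i
    unfolding order_part_mult by simp
  have o0: "order_part m (2 ^ (m - 2) * 0) = Z0" unfolding o Z0_def by simp
  have o1: "order_part m (2 ^ (m - 2) * 1) = Z1" unfolding o Z1_def by (simp add: algebra_simps)
  have o2: "order_part m (2 ^ (m - 2) * 2) = - Z0" unfolding o Z0_def by (simp add: power2_eq_square algebra_simps)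
  have o3: "order_part m (2 ^ (m - 2) * 3) = - Z1" unfolding o Z1_def by (simp add: power3_eq_cube algebra_simps)
  have four: "{..<4::nat} = {0, 1, 2, 3}" by auto
  have L: "(\<Sum>i<4. (P + (-1) ^ i * of_int \<epsilon> * U + order_part m (2 ^ (m - 2) * i)) ^ n)
      = ((P + of_int \<epsilon> * U + Z0) ^ n + (P + of_int \<epsilon> * U - Z0) ^ n)
      + ((P - of_int \<epsilon> * U + Z1) ^ n + (P - of_int \<epsilon> * U - Z1) ^ n)"
    unfolding four using o0 o1 o2 o3 by (simp add: power3_eq_cube algebra_simps)
  have pm: "(a + y) ^ n + (a - y) ^ n = (a + z) ^ n + (a - z) ^ n" if "y\<^sup>2 = z\<^sup>2" for a y z :: complex
    using that unfolding power2_eq_iff by auto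
  show ?thesis
  proof (cases "\<epsilon> = 1")
    case True
    have Z: "Z0\<^sup>2 = (V * Sm)\<^sup>2" "Z1\<^sup>2 = (V * Sp)\<^sup>2"
      unfolding Z0 Z1 power_mult_distrib V2 Sm2 Sp2 using True by simp_all
    show ?thesis
      unfolding L pm[OF Z(1), of "P + of_int \<epsilon> * U"] pm[OF Z(2), of "P - of_int \<epsilon> * U"]
      using True by (simp add: add.assoc)
  next
    case False
    hence e: "\<epsilon> = -1" using \<epsilon> by simp
    have Z: "Z0\<^sup>2 = (V * Sp)\<^sup>2" "Z1\<^sup>2 = (V * Sm)\<^sup>2"
      unfolding Z0 Z1 power_mult_distrib V2 Sm2 Sp2 using e by simp_all
    show ?thesis
      unfolding L pm[OF Z(1), of "P + of_int \<epsilon> * U"] pm[OF Z(2), of "P - of_int \<epsilon> * U"]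
      using e by (simp add: add_ac)
  qed
qed

text \<open>Here G 2 is the quadratic Gauss sum, real of modulus sqrt q. Its sign is left open and
  enters as the \<open>\<epsilon>\<close> of \<open>last_values\<close>.\<close>

lemma period_power_sum_2:
  assumes m: "m = 2"
  shows "(\<Sum>j<2 ^ m. period j ^ n) =
      (- of_real (real q powr (1 / 2)) + of_real (\<alpha> 2) * \<i> * complex_of_real (sqrt (2 * (real q powr (1 / 2) + of_int (C 1))))) ^ n
    + (- of_real (real q powr (1 / 2)) - of_real (\<alpha> 2) * \<i> * complex_of_real (sqrt (2 * (real q powr (1 / 2) + of_int (C 1))))) ^ n
    + (of_real (real q powr (1 / 2)) + of_real (\<alpha> 2) * \<i> * complex_of_real (sqrt (2 * (real q powr (1 / 2) - of_int (C 1))))) ^ n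
    + (of_real (real q powr (1 / 2)) - of_real (\<alpha> 2) * \<i> * complex_of_real (sqrt (2 * (real q powr (1 / 2) - of_int (C 1))))) ^ n"
proof -
  define U :: complex where "U = of_real (real q powr (1 / 2))"
  have n2: "\<not> 2 ^ m dvd (2::nat)" using m by simp
  have "G 2 = cnj (G 2)" using G_complement[of 2] m by simp
  hence "(G 2)\<^sup>2 = of_nat q" using G_norm[OF n2] by (simp add: power2_eq_square)
  moreover have "U\<^sup>2 = of_nat q"
    unfolding U_def of_real_power[symmetric] using q_pos by (simp add: powr_half_sqrt)
  ultimately have "(G 2)\<^sup>2 = U\<^sup>2" by simp
  then obtain \<epsilon> :: int where \<epsilon>: "\<epsilon> = 1 \<or> \<epsilon> = -1" "G 2 = of_int \<epsilon> * U"
    unfolding power2_eq_iff by (metis mult_1 mult_minus1 of_int_1 of_int_minus)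
  obtain \<sigma> :: int where
    "J = of_int (if m = 2 then - C 1 else C 1) + \<i> * of_int (\<sigma> * D 1)"
    using J_eq_C by blast
  hence J: "J = - of_int (C 1) + \<i> * of_int (\<sigma> * D 1)" using m by simp
  have "(\<alpha> 2)\<^sup>2 = real q powr (1 / 2)" using alpha_Suc_square[of 1] alpha_one by (simp add: numeral_2_eq_2)
  moreover have "(G 1)\<^sup>2 = - J * G 2" using G_square_2 m by simp
  ultimately have "Re ((G 1)\<^sup>2) = of_int \<epsilon> * (\<alpha> m)\<^sup>2 * of_int (C (m - 1))"
    unfolding \<epsilon>(2) J U_def using m by simp
  from last_values[OF \<epsilon>(1) this, of 0 U n]
  have "(\<Sum>i<4. ((-1) ^ i * of_int \<epsilon> * U + order_part 2 i) ^ n)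
      = (U + of_real (\<alpha> 2) * \<i> * complex_of_real (sqrt (2 * (real q powr (1 / 2) - of_int (C 1))))) ^ n
      + (U - of_real (\<alpha> 2) * \<i> * complex_of_real (sqrt (2 * (real q powr (1 / 2) - of_int (C 1))))) ^ n
      + (- U + of_real (\<alpha> 2) * \<i> * complex_of_real (sqrt (2 * (real q powr (1 / 2) + of_int (C 1))))) ^ n
      + (- U - of_real (\<alpha> 2) * \<i> * complex_of_real (sqrt (2 * (real q powr (1 / 2) + of_int (C 1))))) ^ n"
    using m by simp
  moreover have "period i = (-1) ^ i * of_int \<epsilon> * U + order_part 2 i" for i
    unfolding period_decomp using m \<epsilon>(2) by simp
  ultimately show ?thesis using m unfolding U_def by (simp add: add_ac)
qed

lemma period_power_sum:
  assumes m3: "m \<ge> 3"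
  defines "Q \<equiv> complex_of_real (real q powr (1 / 2))"
  defines "A \<equiv> \<lambda>t. - Q + (\<Sum>k = 2..t. tC k) - tC (t + 1)"
    and "P \<equiv> - Q + (\<Sum>k = 2..m-2. tC k)"
    and "V \<equiv> 2 ^ (m - 2) * of_real (\<alpha> m) * \<i>"
    and "Sm \<equiv> complex_of_real (sqrt (2 * (real q powr (1 / 2 ^ (m - 1)) - of_int (C (m - 1)))))"
    and "Sp \<equiv> complex_of_real (sqrt (2 * (real q powr (1 / 2 ^ (m - 1)) + of_int (C (m - 1)))))"
  shows "(\<Sum>j<2 ^ m. period j ^ n) = 2 ^ (m - 2) * ((Q + tD 2) ^ n + (Q - tD 2) ^ n)
      + (\<Sum>t = 1..m-3. 2 ^ (m - t - 2) * ((A t + tD (t + 2)) ^ n + (A t - tD (t + 2)) ^ n))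
      + (P + tC (m - 1) + V * Sm) ^ n + (P + tC (m - 1) - V * Sm) ^ n
      + (P - tC (m - 1) + V * Sp) ^ n + (P - tC (m - 1) - V * Sp) ^ n"
proof -
  have T: "m - 2 \<le> m" by simp
  have mm: "m - (m - 2) = 2" using m2 by simp
  \<comment> \<open>Valuation 0 is split off because odd indices reverse the sign of the quadratic
    Gauss sum, which gives their periods a different shape.\<close>
  have set: "{..<m - 2} = insert 0 {1..m-3}" using m3 by auto
  have inner: "(\<Sum>l<2 ^ (m - t - 1). period (2 ^ t * (2 * l + 1)) ^ n) = 2 ^ (m - t - 2) * ((a + \<tau> * b) ^ n + (a - \<tau> * b) ^ n)"
    if "t \<le> m - 3" "\<And>i. i mod 4 = 1 \<Longrightarrow> period (2 ^ t * i) = a + \<tau> * b"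
      "\<And>i. i mod 4 = 3 \<Longrightarrow> period (2 ^ t * i) = a - \<tau> * b" for t a \<tau> b
  proof -
    have eq: "m - t - 1 = Suc (m - t - 2)" using that(1) m3 by simp
    show ?thesis
      unfolding eq
    proof (rule sum_odd_mod_four[of "\<lambda>i. period (2 ^ t * i) ^ n"])
      fix u :: nat
      have "(4 * u + 1) mod 4 = 1" "(4 * u + 3) mod 4 = 3" by presburger+
      thus "period (2 ^ t * (4 * u + 1)) ^ n = (a + \<tau> * b) ^ n"
        "period (2 ^ t * (4 * u + 3)) ^ n = (a - \<tau> * b) ^ n"
        by (simp_all only: that)
    qed
  qed
  have sym: "(a + \<tau> * b) ^ n + (a - \<tau> * b) ^ n = (a + b) ^ n + (a - b) ^ n" if "\<tau> = 1 \<or> \<tau> = -1" for a b \<tau> :: complex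
    using that by (auto simp: add_ac)
  have zero: "(\<Sum>l<2 ^ (m - 0 - 1). period (2 ^ 0 * (2 * l + 1)) ^ n) = 2 ^ (m - 0 - 2) * ((Q + tD 2) ^ n + (Q - tD 2) ^ n)"
  proof -
    obtain \<tau> :: complex where \<tau>: "\<tau> = 1 \<or> \<tau> = -1"
      "\<And>i. i mod 4 = 1 \<Longrightarrow> period i = Q + \<tau> * tD 2" "\<And>i. i mod 4 = 3 \<Longrightarrow> period i = Q - \<tau> * tD 2"
      using period_odd[OF m3] unfolding Q_def by blast
    have "(\<Sum>l<2 ^ (m - 0 - 1). period (2 ^ 0 * (2 * l + 1)) ^ n)
        = 2 ^ (m - 0 - 2) * ((Q + \<tau> * tD 2) ^ n + (Q - \<tau> * tD 2) ^ n)"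
      by (rule inner) (use \<tau> in simp_all)
    thus ?thesis by (simp only: sym[OF \<tau>(1)])
  qed
  have pos: "(\<Sum>l<2 ^ (m - t - 1). period (2 ^ t * (2 * l + 1)) ^ n)
      = 2 ^ (m - t - 2) * ((A t + tD (t + 2)) ^ n + (A t - tD (t + 2)) ^ n)" if t: "t \<in> {1..m-3}" for t
  proof -
    have t': "1 \<le> t" "t \<le> m - 3" using t by auto
    obtain \<tau> :: complex where \<tau>: "\<tau> = 1 \<or> \<tau> = -1"
      "\<And>i. i mod 4 = 1 \<Longrightarrow> period (2 ^ t * i) = A t + \<tau> * tD (t + 2)"
      "\<And>i. i mod 4 = 3 \<Longrightarrow> period (2 ^ t * i) = A t - \<tau> * tD (t + 2)"
      using period_valuation[OF m3 t'] unfolding A_def Q_def by blast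
    have "(\<Sum>l<2 ^ (m - t - 1). period (2 ^ t * (2 * l + 1)) ^ n)
        = 2 ^ (m - t - 2) * ((A t + \<tau> * tD (t + 2)) ^ n + (A t - \<tau> * tD (t + 2)) ^ n)"
      by (rule inner) (use \<tau> t' in simp_all)
    thus ?thesis by (simp only: sym[OF \<tau>(1)])
  qed
  have k1: "2 \<le> m - 1" "m - 1 \<le> m - 1" "1 \<le> m - 1" using m3 by auto
  obtain \<epsilon> \<sigma> :: int where \<epsilon>: "\<epsilon> = 1 \<or> \<epsilon> = -1" and \<sigma>: "\<sigma> = 1 \<or> \<sigma> = -1"
    and HH: "H (m - 1) = of_int \<epsilon> * of_real (\<alpha> (m - 1)) * (of_int (C (m - 1)) + \<i> * of_int (\<sigma> * D (m - 1)))"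
    using H_form[OF m3 k1(3) k1(2)] by blast
  have GG: "G (2 ^ (m - (m - 1))) = of_int \<epsilon> * of_real (\<alpha> (m - 1)) * (of_int (C (m - 1)) + \<i> * of_int (\<sigma> * D (m - 1)))"
    unfolding G_eq_H[OF k1(1)] by (rule HH)
  have "(G 1)\<^sup>2 = Q * (of_int \<epsilon> * of_real (\<alpha> (m - 1)) * (of_int (C (m - 1)) + \<i> * of_int (\<sigma> * D (m - 1))))"
    using G_recursion[OF m3 order.refl] unfolding GG G_quadratic_powr[OF m3] Q_def by simp
  hence "Re ((G 1)\<^sup>2) = of_int \<epsilon> * (real q powr (1 / 2) * \<alpha> (m - 1)) * of_int (C (m - 1))"
    unfolding Q_def by simp
  also have "real q powr (1 / 2) * \<alpha> (m - 1) = (\<alpha> m)\<^sup>2"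
    using alpha_Suc_square[OF k1(3)] m3 by simp
  finally have Re: "Re ((G 1)\<^sup>2) = of_int \<epsilon> * (\<alpha> m)\<^sup>2 * of_int (C (m - 1))" .
  \<comment> \<open>Relative to order 2^(m-1) the index is 2i, so only C (m - 1) occurs, with sign
    (-1)^i times the undetermined \<open>\<epsilon>\<close>.\<close>
  have last: "period (2 ^ (m - 2) * i) = P + (-1) ^ i * of_int \<epsilon> * tC (m - 1) + order_part m (2 ^ (m - 2) * i)" for i
  proof -
    have eq: "2 ^ (m - 2) * i = 2 ^ (m - 1 - 2) * (2 * i)"
    proof -
      have "m - 2 = Suc (m - 1 - 2)" using m3 by simp
      thus ?thesis by (metis mult.assoc power_Suc2)
    qed
    have "order_part (m - 1) (2 ^ (m - 2) * i) = (-1) ^ i * of_int \<epsilon> * tC (m - 1)"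
    proof (cases "even i")
      case True
      hence "(2 * i) mod 4 = 0" by presburger
      from order_part_values(1)[OF k1(1,2) GG this] show ?thesis unfolding eq using True by simp
    next
      case False
      hence "(2 * i) mod 4 = 2" by presburger
      from order_part_values(3)[OF k1(1,2) GG this] show ?thesis unfolding eq using False by simp
    qed
    thus ?thesis using period_last[OF m3, of i] unfolding P_def Q_def by simp
  qed
  have "(\<Sum>j<2 ^ m. period j ^ n) = (\<Sum>t<m - 2. \<Sum>l<2 ^ (m - t - 1). period (2 ^ t * (2 * l + 1)) ^ n)
      + (\<Sum>j<4. period (2 ^ (m - 2) * j) ^ n)"
    using sum_by_valuation[OF T, of "\<lambda>j. period j ^ n"] unfolding mm by simp
  also have "(\<Sum>t<m - 2. \<Sum>l<2 ^ (m - t - 1). period (2 ^ t * (2 * l + 1)) ^ n)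
      = 2 ^ (m - 2) * ((Q + tD 2) ^ n + (Q - tD 2) ^ n)
      + (\<Sum>t = 1..m-3. 2 ^ (m - t - 2) * ((A t + tD (t + 2)) ^ n + (A t - tD (t + 2)) ^ n))"
  proof -
    have "(\<Sum>t = 1..m-3. \<Sum>l<2 ^ (m - t - 1). period (2 ^ t * (2 * l + 1)) ^ n)
        = (\<Sum>t = 1..m-3. 2 ^ (m - t - 2) * ((A t + tD (t + 2)) ^ n + (A t - tD (t + 2)) ^ n))"
      by (rule sum.cong[OF refl]) (rule pos)
    moreover have "(\<Sum>t<m - 2. \<Sum>l<2 ^ (m - t - 1). period (2 ^ t * (2 * l + 1)) ^ n)
        = (\<Sum>l<2 ^ (m - 0 - 1). period (2 ^ 0 * (2 * l + 1)) ^ n)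
        + (\<Sum>t = 1..m-3. \<Sum>l<2 ^ (m - t - 1). period (2 ^ t * (2 * l + 1)) ^ n)"
      unfolding set by (rule sum.insert) auto
    ultimately show ?thesis unfolding zero by (simp only: diff_zero)
  qed
  also have "(\<Sum>j<4. period (2 ^ (m - 2) * j) ^ n)
      = (P + tC (m - 1) + V * Sm) ^ n + (P + tC (m - 1) - V * Sm) ^ n
      + (P - tC (m - 1) + V * Sp) ^ n + (P - tC (m - 1) - V * Sp) ^ n"
    unfolding last V_def Sm_def Sp_def by (rule last_values[OF \<epsilon> Re])
  finally show ?thesis by (simp only: add.assoc)
qed

end

theorem theorem4:
  fixes field_type :: "'a::{finite,field} itself"
    and p s q m n :: nat and C D :: "nat \<Rightarrow> int"
  assumes "card (UNIV :: 'a set) = q"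
    and "prime p" and "[int p = -3] (mod 8)"
    and "s \<ge> 1" and "q = p ^ s"
    and "m \<ge> 2" and "2 ^ m dvd (q - 1)" and "\<not> 2 ^ (m + 1) dvd (q - 1)"
    and "n \<ge> 1"
    and CD: "\<And>r. 1 \<le> r \<Longrightarrow> r \<le> m - 1 \<Longrightarrow>
               real p powr (real s / 2 ^ (r - 1)) = real_of_int ((C r)\<^sup>2 + (D r)\<^sup>2)
             \<and> [C r = -1] (mod 4) \<and> \<not> int p dvd C r"
  shows
   "(m = 2 \<longrightarrow>
      of_nat (num_sols field_type (2 ^ m) n) =
        of_nat q ^ (n - 1) + (of_nat q - 1) / (4 * of_nat q) *
        ( (- qp q (1/2) + qp q (1/4) * \<i> * complex_of_real (sqrt (2 * (real q powr (1/2) + of_int (C 1))))) ^ n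
        + (- qp q (1/2) - qp q (1/4) * \<i> * complex_of_real (sqrt (2 * (real q powr (1/2) + of_int (C 1))))) ^ n
        + (qp q (1/2) + qp q (1/4) * \<i> * complex_of_real (sqrt (2 * (real q powr (1/2) - of_int (C 1))))) ^ n
        + (qp q (1/2) - qp q (1/4) * \<i> * complex_of_real (sqrt (2 * (real q powr (1/2) - of_int (C 1))))) ^ n))
  \<and> (m \<ge> 3 \<longrightarrow>
      (let P = - qp q (1/2) + (\<Sum>r = 2..m-2. 2 ^ (r - 1) * of_int (C r) * qp q ((2 ^ (r - 1) - 1) / 2 ^ r));
           A = (\<lambda>t::nat. - qp q (1/2) + (\<Sum>r = 2..t. 2 ^ (r - 1) * of_int (C r) * qp q ((2 ^ (r - 1) - 1) / 2 ^ r))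
                   - 2 ^ t * of_int (C (t + 1)) * qp q ((2 ^ t - 1) / 2 ^ (t + 1)));
           E = (\<lambda>t::nat. 2 ^ (t + 1) * of_int (D (t + 2)) * qp q ((2 ^ (t + 1) - 1) / 2 ^ (t + 2)));
           U = 2 ^ (m - 2) * of_int (C (m - 1)) * qp q ((2 ^ (m - 2) - 1) / 2 ^ (m - 1));
           V = 2 ^ (m - 2) * qp q ((2 ^ (m - 1) - 1) / 2 ^ m) * \<i>;
           Sm = complex_of_real (sqrt (2 * (real q powr (1 / 2 ^ (m - 1)) - of_int (C (m - 1)))));
           Sp = complex_of_real (sqrt (2 * (real q powr (1 / 2 ^ (m - 1)) + of_int (C (m - 1)))))
       in of_nat (num_sols field_type (2 ^ m) n) =
          of_nat q ^ (n - 1) + (of_nat q - 1) / (2 ^ m * of_nat q) *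
          ( 2 ^ (m - 2) * ((qp q (1/2) + 2 * of_int (D 2) * qp q (1/4)) ^ n
                          + (qp q (1/2) - 2 * of_int (D 2) * qp q (1/4)) ^ n)
          + (\<Sum>t = 1..m-3. 2 ^ (m - t - 2) * ((A t + E t) ^ n + (A t - E t) ^ n))
          + (P + U + V * Sm) ^ n + (P + U - V * Sm) ^ n
          + (P - U + V * Sp) ^ n + (P - U - V * Sp) ^ n)))"
proof -
  have card: "CARD('a) = q" using assms(1) .
  obtain \<psi> :: "'a \<Rightarrow> complex" where \<psi>: "\<And>x y. \<psi> (x + y) = \<psi> x * \<psi> y"
    "\<And>x. \<psi> (x ^ p) = \<psi> x" "\<And>x. \<psi> x ^ p = 1" "\<exists>x. \<psi> x \<noteq> 1"
    using additive_character_exists[of p s, where 'a = 'a] card assms(2,4,5) by metis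
  obtain g :: 'a where g: "g \<noteq> 0" "\<And>x. x \<noteq> 0 \<Longrightarrow> \<exists>i<q - 1. x = g ^ i"
    using finite_field_generator[where 'a = 'a] card by auto
  have p8: "p mod 8 = 5"
  proof -
    have "8 dvd int p + 3" using assms(3) by (simp add: cong_iff_dvd_diff)
    thus ?thesis by presburger
  qed
  interpret X: two_power_char_CD p s q \<psi> m g C D
    by unfold_locales (use card assms \<psi> g p8 CD in blast)+
  have count: "of_nat (num_sols field_type (2 ^ m) n)
      = of_nat q ^ (n - 1) + (of_nat q - 1) / (2 ^ m * of_nat q) * (\<Sum>j<2 ^ m. X.period j ^ n)"
    unfolding num_sols_def by (rule X.num_zeros_eq) (use assms in simp)
  have qp_alpha: "qp q ((2 ^ (r - 1) - 1) / 2 ^ r) = of_real (X.\<alpha> r)" for r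
    by (simp add: qp_def X.\<alpha>_def)
  show ?thesis
  proof (intro conjI impI)
    assume m: "m = 2"
    have "qp q (1 / 4) = of_real (X.\<alpha> 2)" using qp_alpha[of 2] by simp
    moreover have "(2 :: complex) ^ m = 4" using m by simp
    ultimately show "of_nat (num_sols field_type (2 ^ m) n) =
        of_nat q ^ (n - 1) + (of_nat q - 1) / (4 * of_nat q) *
        ( (- qp q (1/2) + qp q (1/4) * \<i> * complex_of_real (sqrt (2 * (real q powr (1/2) + of_int (C 1))))) ^ n
        + (- qp q (1/2) - qp q (1/4) * \<i> * complex_of_real (sqrt (2 * (real q powr (1/2) + of_int (C 1))))) ^ n
        + (qp q (1/2) + qp q (1/4) * \<i> * complex_of_real (sqrt (2 * (real q powr (1/2) - of_int (C 1))))) ^ n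
        + (qp q (1/2) - qp q (1/4) * \<i> * complex_of_real (sqrt (2 * (real q powr (1/2) - of_int (C 1))))) ^ n)"
      unfolding count X.period_power_sum_2[OF m] by (simp only: qp_def)
  next
    assume m3: "m \<ge> 3"
    have tC: "2 ^ (r - 1) * of_int (C r) * qp q ((2 ^ (r - 1) - 1) / 2 ^ r) = X.tC r" for r
      unfolding qp_alpha X.tC_def ..
    have tC': "2 ^ t * of_int (C (t + 1)) * qp q ((2 ^ t - 1) / 2 ^ (t + 1)) = X.tC (t + 1)" for t
      using tC[of "t + 1"] by simp
    have tD: "2 ^ (t + 1) * of_int (D (t + 2)) * qp q ((2 ^ (t + 1) - 1) / 2 ^ (t + 2)) = X.tD (t + 2)" for t
      using qp_alpha[of "t + 2"] by (simp add: X.tD_def)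
    have tD2: "2 * of_int (D 2) * qp q (1 / 4) = X.tD 2"
      using qp_alpha[of 2] by (simp add: X.tD_def)
    have U: "2 ^ (m - 2) * of_int (C (m - 1)) * qp q ((2 ^ (m - 2) - 1) / 2 ^ (m - 1)) = X.tC (m - 1)"
      using tC[of "m - 1"] by (simp add: numeral_2_eq_2)
    show "let P = - qp q (1/2) + (\<Sum>r = 2..m-2. 2 ^ (r - 1) * of_int (C r) * qp q ((2 ^ (r - 1) - 1) / 2 ^ r));
           A = (\<lambda>t::nat. - qp q (1/2) + (\<Sum>r = 2..t. 2 ^ (r - 1) * of_int (C r) * qp q ((2 ^ (r - 1) - 1) / 2 ^ r))
                   - 2 ^ t * of_int (C (t + 1)) * qp q ((2 ^ t - 1) / 2 ^ (t + 1)));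
           E = (\<lambda>t::nat. 2 ^ (t + 1) * of_int (D (t + 2)) * qp q ((2 ^ (t + 1) - 1) / 2 ^ (t + 2)));
           U = 2 ^ (m - 2) * of_int (C (m - 1)) * qp q ((2 ^ (m - 2) - 1) / 2 ^ (m - 1));
           V = 2 ^ (m - 2) * qp q ((2 ^ (m - 1) - 1) / 2 ^ m) * \<i>;
           Sm = complex_of_real (sqrt (2 * (real q powr (1 / 2 ^ (m - 1)) - of_int (C (m - 1)))));
           Sp = complex_of_real (sqrt (2 * (real q powr (1 / 2 ^ (m - 1)) + of_int (C (m - 1)))))
       in of_nat (num_sols field_type (2 ^ m) n) =
          of_nat q ^ (n - 1) + (of_nat q - 1) / (2 ^ m * of_nat q) *
          ( 2 ^ (m - 2) * ((qp q (1/2) + 2 * of_int (D 2) * qp q (1/4)) ^ n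
                          + (qp q (1/2) - 2 * of_int (D 2) * qp q (1/4)) ^ n)
          + (\<Sum>t = 1..m-3. 2 ^ (m - t - 2) * ((A t + E t) ^ n + (A t - E t) ^ n))
          + (P + U + V * Sm) ^ n + (P + U - V * Sm) ^ n
          + (P - U + V * Sp) ^ n + (P - U - V * Sp) ^ n)"
      unfolding Let_def U tC tC' tD tD2 qp_alpha[of m] count X.period_power_sum[OF m3]
      unfolding qp_def ..
  qed
qed

end
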